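(* Let $f \geq 1$ be an integer. There is a deterministic fully dynamic algorithm which, for a hypergraph $\mathcal{G}=(V,E)$ on a fixed set of $n$ nodes in which every hyperedge contains at most $f$ nodes, starting from $E=\emptyset$ and undergoing an arbitrary sequence of hyperedge insertions and deletions, maintains after every update an $O(f^3)$-approximate maximum fractional matching and an $O(f^3)$-approximate minimum vertex cover of the current hypergraph, with $O(f^2)$ amortized update time.
   Context: A fractional matching in a hypergraph $\mathcal{G}=(V,E)$ is an assignment of weights $w(e)\geq 0$ to hyperedges such that for every node $v$, $\sum_{e \in E: v\in e} w(e)\leq 1$; its size is $\sum_{e} w(e)$. A vertex cover is a set of nodes intersecting every hyperedge. A $c$-approximate maximum fractional matching is a fractional matching of size at least $1/c$ times the maximum size of a fractional matching; a $c$-approximate minimum vertex cover is a vertex cover of size at most $c$ times the minimum size of a vertex cover. Amortized update time $O(g)$ means the total running time over any sequence of $T$ updates (starting from the empty hypergraph) is $O(g\cdot T)$. The adversary choosing the updates may be adaptive. *)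

theory Defs
  imports Complex_Main
begin


text \<open>
  A hypergraph has a finite node set \<open>V\<close> and a set \<open>E\<close> of hyperedges. Hyperedges are nonempty:
  no vertex cover could intersect an empty one.
\<close>

definition hyperedge :: "'a set \<Rightarrow> nat \<Rightarrow> 'a set \<Rightarrow> bool" where
  "hyperedge V f e \<longleftrightarrow> e \<noteq> {} \<and> e \<subseteq> V \<and> card e \<le> f"

definition fractional_matching :: "'a set \<Rightarrow> 'a set set \<Rightarrow> ('a set \<Rightarrow> real) \<Rightarrow> bool" where
  "fractional_matching V E w \<longleftrightarrow>
     (\<forall>e\<in>E. w e \<ge> 0) \<and> (\<forall>v\<in>V. (\<Sum>e | e \<in> E \<and> v \<in> e. w e) \<le> 1)"

definition matching_size :: "'a set set \<Rightarrow> ('a set \<Rightarrow> real) \<Rightarrow> real" where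
  "matching_size E w = (\<Sum>e\<in>E. w e)"

text \<open>
  The supremum below is a maximum: if \<open>V\<close> is finite and all hyperedges are nonempty subsets
  of \<open>V\<close>, the fractional matchings, restricted to \<open>E\<close>, form a nonempty compact polytope.
\<close>

definition max_matching_size :: "'a set \<Rightarrow> 'a set set \<Rightarrow> real" where
  "max_matching_size V E = Sup {matching_size E w | w. fractional_matching V E w}"

definition approx_max_fractional_matching ::
    "real \<Rightarrow> 'a set \<Rightarrow> 'a set set \<Rightarrow> ('a set \<Rightarrow> real) \<Rightarrow> bool" where
  "approx_max_fractional_matching c V E w \<longleftrightarrow>
     fractional_matching V E w \<and> matching_size E w \<ge> 1 / c * max_matching_size V E"

definition vertex_cover :: "'a set \<Rightarrow> 'a set set \<Rightarrow> 'a set \<Rightarrow> bool" where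
  "vertex_cover V E S \<longleftrightarrow> S \<subseteq> V \<and> (\<forall>e\<in>E. S \<inter> e \<noteq> {})"

definition min_cover_size :: "'a set \<Rightarrow> 'a set set \<Rightarrow> nat" where
  "min_cover_size V E = Min {card S | S. vertex_cover V E S}"

definition approx_min_vertex_cover ::
    "real \<Rightarrow> 'a set \<Rightarrow> 'a set set \<Rightarrow> 'a set \<Rightarrow> bool" where
  "approx_min_vertex_cover c V E S \<longleftrightarrow>
     vertex_cover V E S \<and> real (card S) \<le> c * real (min_cover_size V E)"



text \<open>
  Programs are while programs over finitely many arrays of natural numbers; \<open>s a i\<close> is the content
  of cell \<open>i\<close> of array \<open>a\<close>, and scalar variables are single cells. A program names its arrays by
  constants, so it can use only finitely many of them.

  Every operation, memory access and test costs one time unit. Words are bounded: a memory word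
  holds a number below \<open>B\<close>, and a computation in which any address or (intermediate) value reaches
  \<open>B\<close> has no outcome in \<open>exec\<close>. Without this, unit-cost arithmetic on huge numbers would be
  unrealistically powerful.
\<close>

type_synonym mem = "nat \<Rightarrow> nat \<Rightarrow> nat"

datatype binop = Add | Sub | Mul | Div | Mod | Less

fun binop_val :: "binop \<Rightarrow> nat \<Rightarrow> nat \<Rightarrow> nat" where
  "binop_val Add x y = x + y"
| "binop_val Sub x y = x - y"
| "binop_val Mul x y = x * y"
| "binop_val Div x y = x div y"
| "binop_val Mod x y = x mod y"
| "binop_val Less x y = (if x < y then 1 else 0)"

datatype aexp = Const nat | Read nat aexp | Op binop aexp aexp

fun aval :: "aexp \<Rightarrow> mem \<Rightarrow> nat" where
  "aval (Const k) s = k"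
| "aval (Read a x) s = s a (aval x s)"
| "aval (Op b x y) s = binop_val b (aval x s) (aval y s)"

fun acost :: "aexp \<Rightarrow> nat" where
  "acost (Const k) = 1"
| "acost (Read a x) = acost x + 1"
| "acost (Op b x y) = acost x + acost y + 1"

fun fits :: "nat \<Rightarrow> aexp \<Rightarrow> mem \<Rightarrow> bool" where
  "fits B (Const k) s \<longleftrightarrow> k < B"
| "fits B (Read a x) s \<longleftrightarrow> fits B x s \<and> aval (Read a x) s < B"
| "fits B (Op b x y) s \<longleftrightarrow> fits B x s \<and> fits B y s \<and> aval (Op b x y) s < B"

text \<open>Conditions are expressions; a nonzero value means true.\<close>

datatype com =
    SKIP
  | WRITE nat aexp aexp
  | SEQ com com
  | IF aexp com com
  | WHILE aexp com

text \<open>\<open>exec B c s t s'\<close>: started in \<open>s\<close>, the program \<open>c\<close> halts in \<open>s'\<close> after exactly \<open>t\<close> time units.\<close>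

inductive exec :: "nat \<Rightarrow> com \<Rightarrow> mem \<Rightarrow> nat \<Rightarrow> mem \<Rightarrow> bool" for B where
  Skip: "exec B SKIP s 1 s"
| Write: "fits B x s \<Longrightarrow> fits B y s \<Longrightarrow>
    exec B (WRITE a x y) s (acost x + acost y + 1) (s(a := (s a)(aval x s := aval y s)))"
| Seq: "exec B c1 s t1 s1 \<Longrightarrow> exec B c2 s1 t2 s2 \<Longrightarrow> exec B (SEQ c1 c2) s (t1 + t2) s2"
| IfTrue: "fits B b s \<Longrightarrow> aval b s \<noteq> 0 \<Longrightarrow> exec B c1 s t s' \<Longrightarrow>
    exec B (IF b c1 c2) s (acost b + 1 + t) s'"
| IfFalse: "fits B b s \<Longrightarrow> aval b s = 0 \<Longrightarrow> exec B c2 s t s' \<Longrightarrow>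
    exec B (IF b c1 c2) s (acost b + 1 + t) s'"
| WhileFalse: "fits B b s \<Longrightarrow> aval b s = 0 \<Longrightarrow> exec B (WHILE b c) s (acost b + 1) s"
| WhileTrue: "fits B b s \<Longrightarrow> aval b s \<noteq> 0 \<Longrightarrow> exec B c s t1 s1 \<Longrightarrow> exec B (WHILE b c) s1 t2 s2 \<Longrightarrow>
    exec B (WHILE b c) s (acost b + 1 + t1 + t2) s2"

inductive_cases SkipE: "exec B SKIP s t s'"
inductive_cases WriteE: "exec B (WRITE a x y) s t s'"
inductive_cases SeqE: "exec B (SEQ c1 c2) s t s'"
inductive_cases IfE: "exec B (IF b c1 c2) s t s'"
inductive_cases WhileE: "exec B (WHILE b c) s t s'"

lemma exec_deterministic:
  "exec B c s t s' \<Longrightarrow> exec B c s u s'' \<Longrightarrow> u = t \<and> s'' = s'"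
proof (induction arbitrary: u s'' rule: exec.induct)
  case (Skip s)
  then show ?case by (rule SkipE) simp
next
  case (Write x s y a)
  from Write.prems show ?case by (rule WriteE) simp
next
  case (Seq c1 s t1 s1 c2 t2 s2)
  from Seq.prems show ?case
  proof (rule SeqE)
    fix u1 r u2
    assume u: "u = u1 + u2" and 1: "exec B c1 s u1 r" and 2: "exec B c2 r u2 s''"
    from Seq.IH(1)[OF 1] have eq: "u1 = t1" "r = s1" by simp_all
    from Seq.IH(2)[OF 2[unfolded eq]] show ?thesis by (simp add: u eq)
  qed
next
  case (IfTrue b s c1 t s' c2)
  from IfTrue.prems show ?case
  proof (rule IfE)
    fix r assume u: "u = Suc (acost b + r)" and 1: "exec B c1 s r s''"
    from IfTrue.IH[OF 1] show ?thesis by (simp add: u)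
  next
    assume "aval b s = 0"
    with IfTrue.hyps(2) show ?thesis by contradiction
  qed
next
  case (IfFalse b s c2 t s' c1)
  from IfFalse.prems show ?case
  proof (rule IfE)
    assume "0 < aval b s"
    with IfFalse.hyps(2) show ?thesis by simp
  next
    fix r assume u: "u = Suc (acost b + r)" and 1: "exec B c2 s r s''"
    from IfFalse.IH[OF 1] show ?thesis by (simp add: u)
  qed
next
  case (WhileFalse b s c)
  from WhileFalse.prems show ?case
  proof (rule WhileE)
    assume "u = Suc (acost b)" "s'' = s"
    then show ?thesis by simp
  next
    assume "0 < aval b s"
    with WhileFalse.hyps(2) show ?thesis by simp
  qed
next
  case (WhileTrue b s c t1 s1 t2 s2)
  from WhileTrue.prems show ?case
  proof (rule WhileE)
    assume "aval b s = 0"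
    with WhileTrue.hyps(2) show ?thesis by contradiction
  next
    fix u1 r u2
    assume u: "u = Suc (acost b + u1 + u2)"
      and 1: "exec B c s u1 r" and 2: "exec B (WHILE b c) r u2 s''"
    from WhileTrue.IH(1)[OF 1] have eq: "u1 = t1" "r = s1" by simp_all
    from WhileTrue.IH(2)[OF 2[unfolded eq]] show ?thesis by (simp add: u eq)
  qed
qed



datatype 'a update = Insert "'a set" | Delete "'a set"

fun apply_update :: "'a update \<Rightarrow> 'a set set \<Rightarrow> 'a set set" where
  "apply_update (Insert e) E = insert e E"
| "apply_update (Delete e) E = E - {e}"

fun valid_update :: "'a set \<Rightarrow> nat \<Rightarrow> 'a set set \<Rightarrow> 'a update \<Rightarrow> bool" where
  "valid_update V f E (Insert e) \<longleftrightarrow> hyperedge V f e \<and> e \<notin> E"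
| "valid_update V f E (Delete e) \<longleftrightarrow> e \<in> E"

fun valid_updates :: "'a set \<Rightarrow> nat \<Rightarrow> 'a set set \<Rightarrow> 'a update list \<Rightarrow> bool" where
  "valid_updates V f E [] \<longleftrightarrow> True"
| "valid_updates V f E (u # us) \<longleftrightarrow> valid_update V f E u \<and> valid_updates V f (apply_update u E) us"

definition edges_after :: "'a update list \<Rightarrow> 'a set set" where
  "edges_after us = fold apply_update us {}"

text \<open>
  Interface between a program and its environment. The nodes are \<open>0, \<dots>, n - 1\<close>. Initially all
  memory is zero, except that cell 0 of array 0 contains \<open>n\<close>. An update is presented by storing its kind
  (1 for an insertion, 0 for a deletion) and the cardinality of the hyperedge in cells 1 and 2 of
  array 0, and the increasing list of its nodes in array 1. Everything else is kept between updates.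
\<close>

definition initial_mem :: "nat \<Rightarrow> mem" where
  "initial_mem n = (\<lambda>a i. if a = 0 \<and> i = 0 then n else 0)"

definition write_input :: "nat \<Rightarrow> nat set \<Rightarrow> mem \<Rightarrow> mem" where
  "write_input k e s =
     s(0 := (s 0)(1 := k, 2 := card e),
       1 := (\<lambda>i. if i < card e then sorted_list_of_set e ! i else 0))"

fun present :: "nat update \<Rightarrow> mem \<Rightarrow> mem" where
  "present (Insert e) s = write_input 1 e s"
| "present (Delete e) s = write_input 0 e s"

text \<open>
  The maintained solutions are explicit in memory. Array 2 is the characteristic vector of the
  vertex cover. Arrays 3 and 4 hold numerators and denominators of the hyperedge weights, indexed
  by the number whose digits in base \<open>n + 1\<close>, lowest first, are the increasingly ordered nodes
  plus one. As zero is not a digit, this is injective on sets of nodes; a hyperedge with at most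
  \<open>f\<close> nodes is mapped below \<open>(n + 1) ^ f\<close>.
\<close>

definition edge_index :: "nat \<Rightarrow> nat set \<Rightarrow> nat" where
  "edge_index n e = horner_sum Suc (n + 1) (sorted_list_of_set e)"

definition output_cover :: "nat \<Rightarrow> mem \<Rightarrow> nat set" where
  "output_cover n s = {v. v < n \<and> s 2 v \<noteq> 0}"

definition output_weight :: "nat \<Rightarrow> mem \<Rightarrow> nat set \<Rightarrow> real" where
  "output_weight n s e = real (s 3 (edge_index n e)) / real (s 4 (edge_index n e))"

text \<open>
  \<open>run B P n us s t\<close>: on \<open>n\<close> nodes, with the program \<open>P\<close> executed once for each of the updates
  \<open>us\<close>, in order, the memory is \<open>s\<close> afterwards and the total time spent is \<open>t\<close>. Preprocessing is
  not free: whatever \<open>P\<close> has to set up is counted.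
\<close>

inductive run :: "nat \<Rightarrow> com \<Rightarrow> nat \<Rightarrow> nat update list \<Rightarrow> mem \<Rightarrow> nat \<Rightarrow> bool" for B P n where
  start: "run B P n [] (initial_mem n) 0"
| step: "run B P n us s t \<Longrightarrow> exec B P (present u s) t' s' \<Longrightarrow> run B P n (us @ [u]) s' (t + t')"

text \<open>
  Word length \<open>O(f log n)\<close>, i.e. a word can hold a name of any one of the possible hyperedges:
  all numbers are below \<open>(n + 2) ^ (C * f)\<close>.
\<close>

definition word_bound :: "nat \<Rightarrow> nat \<Rightarrow> nat \<Rightarrow> nat" where
  "word_bound C f n = (n + 2) ^ (C * f)"

end

theory Submission
  imports Defs
begin

text \<open>
  Every node \<open>v\<close> has a level; a hyperedge \<open>e\<close> lies on the maximal level \<open>el e\<close> of its nodes and has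
  weight \<open>4 ^ - el e\<close>. A node whose incident weight reaches 1 moves one level up; a node on a positive
  level whose incident weight falls below \<open>1 / (400 f\<^sup>2)\<close> moves one level down, but only when no node has to
  move up. Once no node has to move, the weights form a fractional matching, and the nodes on positive levels form
  a cover: a hyperedge on level 0 would contribute weight 1 to its nodes. Every cover node has incident weight at
  least \<open>1 / (400 f\<^sup>2)\<close>, so the cover has at most \<open>400 f\<^sup>3\<close> times the size of the matching, and both
  guarantees follow by weak duality.

  Amortization. Between two moves down a node visits every level at most once, and a move up from level \<open>i\<close>
  costs \<open>O(f 4 ^ i)\<close>. Just after a move down the weight at the node is small, and when it moves up from level
  \<open>i\<close> it has weight 1, to which every incident hyperedge contributes at most \<open>4 ^ - i\<close>; hence at least
  \<open>4 ^ i / 2\<close> incidences were added since, each of which can pay \<open>O(f)\<close>. A move down from level \<open>i\<close>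
  affects only \<open>4 ^ i / (400 f\<^sup>2)\<close> hyperedges, although \<open>\<Omega>(4 ^ i)\<close> of the hyperedges that carried
  the weight of the node must have left or moved up; so each of these pays only \<open>O(1)\<close> per node, and it is
  affordable that the affected hyperedges count as added at each of their nodes.
\<close>


section \<open>Potential of the level scheme\<close>

text \<open>The two credits feed on each other: a move up takes weight from other nodes and raises
  their \<open>down_credit\<close>, a move down adds incidences and raises their
  \<open>up_credit\<close>. With rates \<open>K\<close> (down) and \<open>\<kappa>\<close> (up), a
  move up from level \<open>i\<close> releases \<open>(3/8 * \<kappa> - 2 * K) * f * 4 ^ i\<close>,
  a move down \<open>(K / 8 - \<kappa> * f\<^sup>2 / (4 * G)) * 4 ^ i\<close>. The first forces
  \<open>\<kappa>\<close> to exceed a multiple of \<open>K\<close>; the second then forces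
  \<open>G\<close> to be of order \<open>f\<^sup>2\<close>. This is the origin of the threshold
  \<open>1 / (4 * G)\<close>. The choice \<open>K = 4000\<close>, \<open>\<kappa> = 28800\<close>,
  \<open>G = 100 * f\<^sup>2\<close> leaves \<open>2800 * f * 4 ^ i\<close> and
  \<open>428 * 4 ^ i\<close> for the work. The update time is the credit \<open>\<kappa> * f\<close>
  placed on each of the at most \<open>f\<close> nodes of an inserted hyperedge.

  Moves up come first in order to keep all weights below 2: an update or a move down starts with all
  weights below 1 and adds at most 1 to each. The bound 2 limits the number of hyperedges that a
  move up affects.\<close>

lemma sum_incidence:
  fixes g :: "'e \<Rightarrow> real"
  assumes "finite V" "finite N" "\<And>e. e \<in> N \<Longrightarrow> nds e \<subseteq> V"
  shows "(\<Sum>v\<in>V. \<Sum>e | e \<in> N \<and> v \<in> nds e. g e) = (\<Sum>e\<in>N. real (card (nds e)) * g e)"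
proof -
  have "(\<Sum>v\<in>V. \<Sum>e | e \<in> N \<and> v \<in> nds e. g e) = (\<Sum>v\<in>V. \<Sum>e\<in>N. if v \<in> nds e then g e else 0)"
    by (rule sum.cong[OF refl], subst sum.inter_filter[symmetric, OF assms(2)]) (auto intro!: sum.cong)
  also have "\<dots> = (\<Sum>e\<in>N. \<Sum>v\<in>V. if v \<in> nds e then g e else 0)"
    by (rule sum.swap)
  also have "\<dots> = (\<Sum>e\<in>N. real (card (nds e)) * g e)"
  proof (rule sum.cong[OF refl])
    fix e assume "e \<in> N"
    then have eq: "{v \<in> V. v \<in> nds e} = nds e" using assms(3) by auto
    show "(\<Sum>v\<in>V. if v \<in> nds e then g e else 0) = real (card (nds e)) * g e"
      by (subst sum.inter_filter[symmetric, OF assms(1)]) (simp add: eq)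
  qed
  finally show ?thesis .
qed

locale hypergraph =
  fixes V :: "nat set" and nds :: "nat \<Rightarrow> nat set" and Edges :: "nat set" and f :: nat
  assumes finV: "finite V" and finE: "finite Edges"
    and nds: "e \<in> Edges \<Longrightarrow> nds e \<noteq> {} \<and> nds e \<subseteq> V \<and> card (nds e) \<le> f"
begin

section \<open>Levels, weights and credits\<close>

definition el :: "(nat \<Rightarrow> nat) \<Rightarrow> nat \<Rightarrow> nat" where
  "el lev e = Max (lev ` nds e)"

definition weight :: "nat set \<Rightarrow> (nat \<Rightarrow> nat) \<Rightarrow> nat \<Rightarrow> real" where
  "weight E lev v = (\<Sum>e | e \<in> E \<and> v \<in> nds e. (1/4) ^ el lev e)"

text \<open>Hyperedges below level \<open>j\<close> are treated as if they lay on level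
  \<open>j\<close>. So the budget can be demanded for every \<open>j\<close> from the level of
  \<open>v\<close> on, which lets it survive moves up of \<open>v\<close>, and an added hyperedge
  contributes at most \<open>(1/4) ^ j\<close>, exactly what one unit of the count allows.\<close>

definition capped_weight :: "nat set \<Rightarrow> (nat \<Rightarrow> nat) \<Rightarrow> nat \<Rightarrow> nat \<Rightarrow> real" where
  "capped_weight E lev v j = (\<Sum>e | e \<in> E \<and> v \<in> nds e. (1/4) ^ max (el lev e) j)"

text \<open>
  \<open>a v\<close> counts the incidences added at \<open>v\<close> since the last move down of \<open>v\<close>. It is no part of the memory and
  exists only in the analysis.
\<close>

definition budgeted :: "nat set \<Rightarrow> (nat \<Rightarrow> nat) \<Rightarrow> (nat \<Rightarrow> real) \<Rightarrow> bool" where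
  "budgeted E lev a \<longleftrightarrow> (\<forall>v\<in>V. a v \<ge> 0 \<and>
     (\<forall>j\<ge>lev v. capped_weight E lev v j \<le> 1/2 + a v * (1/4) ^ j))"

text \<open>
  The \<open>4 ^ l / 8\<close> subtracted from the count is what makes a move up release credit: it grows
  with the level while the count stays.
\<close>

definition up_credit :: "real \<Rightarrow> nat \<Rightarrow> real \<Rightarrow> real" where
  "up_credit \<kappa> l x = \<kappa> * real f * max 0 (x - 4 ^ l / 8)"

text \<open>The reference value \<open>1/4\<close> is the least weight left after a move up, so a
  node that has just moved up needs none of this credit. The factor \<open>4 ^ l\<close> makes the
  loss of one incidence cost at most \<open>K\<close>.\<close>

definition down_credit :: "real \<Rightarrow> nat \<Rightarrow> real \<Rightarrow> real" where
  "down_credit K l w = (if l = 0 then 0 else K * 4 ^ l * max 0 (1/4 - w))"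

definition pot :: "real \<Rightarrow> real \<Rightarrow> nat set \<Rightarrow> (nat \<Rightarrow> nat) \<Rightarrow> (nat \<Rightarrow> real) \<Rightarrow> real" where
  "pot K \<kappa> E lev a = (\<Sum>v\<in>V. up_credit \<kappa> (lev v) (a v) + down_credit K (lev v) (weight E lev v))"

text \<open>Only these hyperedges can change their level when \<open>x\<close> moves by one
  level.\<close>

definition level_edges :: "nat set \<Rightarrow> (nat \<Rightarrow> nat) \<Rightarrow> nat \<Rightarrow> nat set" where
  "level_edges E lev x = {e \<in> E. x \<in> nds e \<and> el lev e = lev x}"

lemma pot_nonneg: "K \<ge> 0 \<Longrightarrow> \<kappa> \<ge> 0 \<Longrightarrow> pot K \<kappa> E lev a \<ge> 0"
  unfolding pot_def up_credit_def down_credit_def by (intro sum_nonneg) auto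

lemma finite_nds: "e \<in> Edges \<Longrightarrow> finite (nds e)"
  using nds finV finite_subset by blast

lemma finite_inc: "E \<subseteq> Edges \<Longrightarrow> finite {e. e \<in> E \<and> P e}"
  using finE finite_subset by (metis (no_types, lifting) mem_Collect_eq subset_iff)

lemma el_ge: "e \<in> Edges \<Longrightarrow> v \<in> nds e \<Longrightarrow> lev v \<le> el lev e"
  unfolding el_def using finite_nds by simp

lemma el_witness: "e \<in> Edges \<Longrightarrow> \<exists>v\<in>nds e. lev v = el lev e"
  unfolding el_def using finite_nds nds Max_in[of "lev ` nds e"]
  by (metis (no_types, lifting) finite_imageI image_iff image_is_empty)

lemma el_eqI: "e \<in> Edges \<Longrightarrow> v \<in> nds e \<Longrightarrow> lev v = m \<Longrightarrow> (\<And>v. v \<in> nds e \<Longrightarrow> lev v \<le> m) \<Longrightarrow> el lev e = m"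
  unfolding el_def using finite_nds by (intro Max_eqI) auto

lemma weight_eq_capped: "E \<subseteq> Edges \<Longrightarrow> weight E lev v = capped_weight E lev v (lev v)"
  unfolding weight_def capped_weight_def
  by (rule sum.cong[OF refl]) (use el_ge in \<open>auto simp: max_absorb1 subset_iff\<close>)

lemma weight_nonneg: "weight E lev v \<ge> 0"
  unfolding weight_def by (intro sum_nonneg) auto

text \<open>Each of these hyperedges contributes exactly \<open>(1/4) ^ lev x\<close> to the weight
  of \<open>x\<close>. Thus the weight bounds the work of a move.\<close>

lemma card_level_edges_le:
  assumes "E \<subseteq> Edges"
  shows "real (card (level_edges E lev x)) \<le> weight E lev x * 4 ^ lev x"
proof -
  have "real (card (level_edges E lev x)) * (1/4) ^ lev x = (\<Sum>e\<in>level_edges E lev x. (1/4) ^ el lev e)"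
    unfolding level_edges_def by simp
  also have "\<dots> \<le> weight E lev x"
    unfolding weight_def level_edges_def
    by (intro sum_mono2 finite_inc assms) auto
  finally show ?thesis by (simp add: power_one_over field_simps)
qed

lemma sum_card_incidence_le:
  assumes "N \<subseteq> Edges"
  shows "(\<Sum>v\<in>V. real (card {e. e \<in> N \<and> v \<in> nds e})) \<le> real f * real (card N)"
proof -
  have "(\<Sum>v\<in>V. real (card {e. e \<in> N \<and> v \<in> nds e})) = (\<Sum>v\<in>V. \<Sum>e | e \<in> N \<and> v \<in> nds e. 1)" by simp
  also have "\<dots> = (\<Sum>e\<in>N. real (card (nds e)) * 1)"
    by (rule sum_incidence[OF finV]) (use assms finE nds finite_subset in blast)+
  also have "\<dots> \<le> (\<Sum>e\<in>N. real f)" by (intro sum_mono) (use assms nds in auto)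
  also have "\<dots> = real f * real (card N)" by simp
  finally show ?thesis .
qed

lemma down_credit_mono: "K \<ge> 0 \<Longrightarrow> w \<le> w' \<Longrightarrow> down_credit K l w' \<le> down_credit K l w"
  unfolding down_credit_def by (auto intro!: mult_left_mono)

lemma down_credit_decrease:
  assumes "K \<ge> 0" "w \<le> w'"
  shows "down_credit K l w \<le> down_credit K l w' + K * (4 ^ l * (w' - w))"
proof (cases "l = 0")
  case False
  have "max 0 (1/4 - w) \<le> max 0 (1/4 - w') + (w' - w)" using assms by linarith
  then have "K * 4 ^ l * max 0 (1/4 - w) \<le> K * 4 ^ l * (max 0 (1/4 - w') + (w' - w))"
    using assms by (intro mult_left_mono) auto
  then show ?thesis using False unfolding down_credit_def by (simp add: algebra_simps)
qed (use assms in \<open>simp add: down_credit_def\<close>)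

lemma up_credit_add: "\<kappa> \<ge> 0 \<Longrightarrow> y \<ge> 0 \<Longrightarrow> up_credit \<kappa> l (x + y) \<le> up_credit \<kappa> l x + \<kappa> * real f * y"
  unfolding up_credit_def
proof -
  assume "\<kappa> \<ge> 0" "y \<ge> 0"
  have "max 0 (x + y - 4 ^ l / 8) \<le> max 0 (x - 4 ^ l / 8) + y" using \<open>y \<ge> 0\<close> by auto
  then have "\<kappa> * real f * max 0 (x + y - 4 ^ l / 8) \<le> \<kappa> * real f * (max 0 (x - 4 ^ l / 8) + y)"
    using \<open>\<kappa> \<ge> 0\<close> by (intro mult_left_mono) auto
  then show "\<kappa> * real f * max 0 (x + y - 4 ^ l / 8) \<le> \<kappa> * real f * max 0 (x - 4 ^ l / 8) + \<kappa> * real f * y"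
    by (simp add: algebra_simps)
qed

section \<open>Effect of insertions and deletions on the potential\<close>

lemma incident_insert: "{e'. e' \<in> insert e E \<and> v \<in> nds e'} =
   (if v \<in> nds e then insert e {e'. e' \<in> E \<and> v \<in> nds e'} else {e'. e' \<in> E \<and> v \<in> nds e'})" by auto

lemma weight_insert:
  assumes "E \<subseteq> Edges" "e \<notin> E"
  shows "weight (insert e E) lev v = weight E lev v + (if v \<in> nds e then (1/4) ^ el lev e else 0)"
  unfolding weight_def using assms
  by (subst incident_insert) (auto simp: finite_inc)

lemma capped_weight_insert:
  assumes "E \<subseteq> Edges" "e \<notin> E"
  shows "capped_weight (insert e E) lev v j = capped_weight E lev v j + (if v \<in> nds e then (1/4) ^ max (el lev e) j else 0)"
  unfolding capped_weight_def using assms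
  by (subst incident_insert) (auto simp: finite_inc)

lemma sum_in_nds: "e \<in> Edges \<Longrightarrow> (\<Sum>v\<in>V. if v \<in> nds e then c else 0) \<le> real f * c" if "c \<ge> 0" for c :: real
proof -
  assume e: "e \<in> Edges"
  then have "{v \<in> V. v \<in> nds e} = nds e" using nds by auto
  then have "(\<Sum>v\<in>V. if v \<in> nds e then c else 0) = real (card (nds e)) * c"
    by (subst sum.inter_filter[symmetric, OF finV]) simp
  then show ?thesis using nds[OF e] that by (simp add: mult_right_mono)
qed

text \<open>The capped weight grows by at most \<open>(1/4) ^ j\<close> at each node of
  \<open>e\<close>, which one more unit of the count covers. Additional weight can only lower
  \<open>down_credit\<close>, so the cost is \<open>\<kappa> * f\<close> of \<open>up_credit\<close>
  at each of at most \<open>f\<close> nodes.\<close>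

lemma pot_insert:
  assumes "E \<subseteq> Edges" "e \<in> Edges" "e \<notin> E" "budgeted E lev a" "K \<ge> 0" "\<kappa> \<ge> 0"
  defines "a' \<equiv> \<lambda>v. a v + (if v \<in> nds e then 1 else 0)"
  shows "budgeted (insert e E) lev a'"
    and "pot K \<kappa> (insert e E) lev a' \<le> pot K \<kappa> E lev a + \<kappa> * real f * real f"
    and "weight (insert e E) lev v \<le> weight E lev v + 1"
proof -
  show "budgeted (insert e E) lev a'"
    unfolding budgeted_def
  proof (intro ballI conjI allI impI)
    fix v j assume v: "v \<in> V" and j: "lev v \<le> j"
    have "capped_weight E lev v j \<le> 1/2 + a v * (1/4) ^ j" using assms v j unfolding budgeted_def by auto
    moreover have "(1/4::real) ^ max (el lev e) j \<le> (1/4) ^ j" by (rule power_decreasing) auto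
    ultimately show "capped_weight (insert e E) lev v j \<le> 1/2 + a' v * (1/4) ^ j"
      unfolding capped_weight_insert[OF assms(1,3)] a'_def
      by (cases "v \<in> nds e"; simp only: if_True if_False distrib_right mult_1; linarith)
  qed (use assms in \<open>auto simp: budgeted_def a'_def\<close>)
  have "pot K \<kappa> (insert e E) lev a' \<le> (\<Sum>v\<in>V. (up_credit \<kappa> (lev v) (a v) + down_credit K (lev v) (weight E lev v))
     + (if v \<in> nds e then \<kappa> * real f else 0))"
    unfolding pot_def
  proof (rule sum_mono)
    fix v assume "v \<in> V"
    have "up_credit \<kappa> (lev v) (a' v) \<le> up_credit \<kappa> (lev v) (a v) + (if v \<in> nds e then \<kappa> * real f else 0)"
      using up_credit_add[of \<kappa> 1 "lev v" "a v"] assms(6) by (simp add: a'_def)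
    moreover have "down_credit K (lev v) (weight (insert e E) lev v) \<le> down_credit K (lev v) (weight E lev v)"
      by (rule down_credit_mono) (use assms in \<open>auto simp: weight_insert\<close>)
    ultimately show "up_credit \<kappa> (lev v) (a' v) + down_credit K (lev v) (weight (insert e E) lev v) \<le>
      up_credit \<kappa> (lev v) (a v) + down_credit K (lev v) (weight E lev v) + (if v \<in> nds e then \<kappa> * real f else 0)" by simp
  qed
  also have "\<dots> \<le> pot K \<kappa> E lev a + real f * (\<kappa> * real f)"
    unfolding sum.distrib pot_def using sum_in_nds[of "\<kappa> * real f" e] assms by (auto simp: sum.distrib)
  finally show "pot K \<kappa> (insert e E) lev a' \<le> pot K \<kappa> E lev a + \<kappa> * real f * real f" by (simp add: algebra_simps)
  show "weight (insert e E) lev v \<le> weight E lev v + 1"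
    using assms by (auto simp: weight_insert power_le_one)
qed

text \<open>The counts stay as they are. A node \<open>v\<close> of \<open>e\<close> loses weight
  \<open>(1/4) ^ el lev e\<close>, at most \<open>(1/4) ^ lev v\<close>, so its
  \<open>down_credit\<close> grows by at most \<open>K\<close>.\<close>

lemma pot_delete:
  assumes "E \<subseteq> Edges" "e \<in> E" "budgeted E lev a" "K \<ge> 0" "\<kappa> \<ge> 0"
  shows "budgeted (E - {e}) lev a"
    and "pot K \<kappa> (E - {e}) lev a \<le> pot K \<kappa> E lev a + K * real f"
    and "weight (E - {e}) lev v \<le> weight E lev v"
proof -
  have E: "insert e (E - {e}) = E" "E - {e} \<subseteq> Edges" using assms by auto
  note w = weight_insert[OF E(2), of e, unfolded E(1), simplified]
  note cw = capped_weight_insert[OF E(2), of e, unfolded E(1), simplified]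
  show "weight (E - {e}) lev v \<le> weight E lev v" by (simp add: w)
  show "budgeted (E - {e}) lev a"
    unfolding budgeted_def
  proof (intro ballI conjI allI impI)
    fix v j assume v: "v \<in> V" and j: "lev v \<le> j"
    have "capped_weight (E - {e}) lev v j \<le> capped_weight E lev v j" by (simp add: cw)
    also have "\<dots> \<le> 1/2 + a v * (1/4) ^ j" using assms v j unfolding budgeted_def by auto
    finally show "capped_weight (E - {e}) lev v j \<le> 1/2 + a v * (1/4) ^ j" .
  qed (use assms in \<open>auto simp: budgeted_def\<close>)
  have "pot K \<kappa> (E - {e}) lev a \<le> (\<Sum>v\<in>V. (up_credit \<kappa> (lev v) (a v) + down_credit K (lev v) (weight E lev v))
     + (if v \<in> nds e then K else 0))"
    unfolding pot_def
  proof (rule sum_mono)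
    fix v assume "v \<in> V"
    have "down_credit K (lev v) (weight (E - {e}) lev v) \<le> down_credit K (lev v) (weight E lev v)
       + K * (4 ^ lev v * (weight E lev v - weight (E - {e}) lev v))"
      by (rule down_credit_decrease) (use assms in \<open>auto simp: w\<close>)
    also have "K * (4 ^ lev v * (weight E lev v - weight (E - {e}) lev v)) \<le> (if v \<in> nds e then K else 0)"
    proof (cases "v \<in> nds e")
      case True
      have "(4::real) ^ lev v * (1/4) ^ el lev e \<le> 4 ^ el lev e * (1/4) ^ el lev e"
        using el_ge[of e v lev] assms True by (intro mult_right_mono power_increasing) auto
      then have "(4::real) ^ lev v * (1/4) ^ el lev e \<le> 1" by (simp add: power_one_over)
      then have "K * (4 ^ lev v * (1/4) ^ el lev e) \<le> K * 1" using assms(4) by (rule mult_left_mono)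
      then show ?thesis using True by (simp add: w)
    qed (simp add: w)
    finally show "up_credit \<kappa> (lev v) (a v) + down_credit K (lev v) (weight (E - {e}) lev v) \<le>
      up_credit \<kappa> (lev v) (a v) + down_credit K (lev v) (weight E lev v) + (if v \<in> nds e then K else 0)" by simp
  qed
  also have "\<dots> \<le> pot K \<kappa> E lev a + real f * K"
    unfolding sum.distrib pot_def using sum_in_nds[of K e] assms by (auto simp: sum.distrib)
  finally show "pot K \<kappa> (E - {e}) lev a \<le> pot K \<kappa> E lev a + K * real f" by (simp add: algebra_simps)
qed

section \<open>Effect of moving one node on the potential\<close>

lemma el_up:
  assumes "e \<in> Edges"
  shows "el (lev(x := Suc (lev x))) e = (if x \<in> nds e \<and> el lev e = lev x then Suc (lev x) else el lev e)"
proof -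
  obtain v where v: "v \<in> nds e" "lev v = el lev e" using el_witness[OF assms] by blast
  show ?thesis
  proof (cases "x \<in> nds e \<and> el lev e = lev x")
    case True
    then show ?thesis using el_ge[OF assms, of _ lev]
      by (simp, intro el_eqI[OF assms, of x]) (auto simp: le_SucI)
  next
    case False
    then have "x \<in> nds e \<longrightarrow> lev x < el lev e" using el_ge[OF assms, of x lev] by auto
    then show ?thesis using False el_ge[OF assms, of _ lev] v
      by (simp only: False if_False, intro el_eqI[OF assms, of v]) (auto simp: Suc_le_eq)
  qed
qed

text \<open>In contrast to a move up, a hyperedge on the level of \<open>x\<close> need not follow:
  another node on level \<open>Suc i\<close> may hold it there.\<close>

lemma el_down:
  assumes "e \<in> Edges" "lev x = Suc i"
  shows "el lev e \<noteq> Suc i \<or> x \<notin> nds e \<Longrightarrow> el (lev(x := i)) e = el lev e"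
    and "el lev e = Suc i \<Longrightarrow> x \<in> nds e \<Longrightarrow> el (lev(x := i)) e \<in> {i, Suc i}"
    and "el (lev(x := i)) e \<le> el lev e"
proof -
  obtain v where v: "v \<in> nds e" "lev v = el lev e" using el_witness[OF assms(1)] by blast
  have up: "(lev(x := i)) v \<le> el lev e" if "v \<in> nds e" for v
    using el_ge[OF assms(1) that, of lev] assms(2) by auto
  show le: "el (lev(x := i)) e \<le> el lev e"
    using el_witness[OF assms(1), of "lev(x := i)"] up by metis
  show "el (lev(x := i)) e = el lev e" if "el lev e \<noteq> Suc i \<or> x \<notin> nds e"
  proof (rule el_eqI[OF assms(1) v(1)])
    show "(lev(x := i)) v = el lev e" using that v assms(2) by auto
  qed (rule up)
  assume "el lev e = Suc i" "x \<in> nds e"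
  then show "el (lev(x := i)) e \<in> {i, Suc i}"
    using le el_ge[OF assms(1), of x "lev(x := i)"] by auto
qed

lemma incident_split:
  fixes g h :: "nat \<Rightarrow> real"
  assumes "E \<subseteq> Edges" "N \<subseteq> E" "\<And>e. e \<in> E - N \<Longrightarrow> h e = g e"
  shows "(\<Sum>e | e \<in> E \<and> w \<in> nds e. h e) = (\<Sum>e | e \<in> E \<and> w \<in> nds e. g e) + (\<Sum>e | e \<in> N \<and> w \<in> nds e. h e - g e)"
proof -
  have "(\<Sum>e | e \<in> E \<and> w \<in> nds e. h e) - (\<Sum>e | e \<in> E \<and> w \<in> nds e. g e) = (\<Sum>e | e \<in> E \<and> w \<in> nds e. h e - g e)"
    by (simp add: sum_subtractf)
  also have "\<dots> = (\<Sum>e | e \<in> N \<and> w \<in> nds e. h e - g e)"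
    by (rule sum.mono_neutral_right) (use assms finite_inc in auto)
  finally show ?thesis by simp
qed

text \<open>Let \<open>i = lev x\<close>. By the budget at \<open>j = i\<close>, weight at least 1
  forces \<open>a x \<ge> 4 ^ i / 2\<close>, so raising the subtracted term from
  \<open>4 ^ i / 8\<close> to \<open>4 ^ Suc i / 8\<close> releases
  \<open>3/8 * \<kappa> * f * 4 ^ i\<close>. Against this stands at most \<open>K\<close> for each
  of the at most \<open>2 * f * 4 ^ i\<close> incidences that lose weight.\<close>

lemma pot_up:
  assumes E: "E \<subseteq> Edges" and x: "x \<in> V" and bud: "budgeted E lev a" and K: "K \<ge> 0" and \<kappa>: "\<kappa> \<ge> 0"
    and heavy: "weight E lev x \<ge> 1" "weight E lev x < 2"
  defines "lev' \<equiv> lev(x := Suc (lev x))"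
  shows "budgeted E lev' a"
    and "pot K \<kappa> E lev' a + (3/8 * \<kappa> - 2 * K) * real f * 4 ^ lev x \<le> pot K \<kappa> E lev a"
    and "weight E lev' w \<le> weight E lev w"
    and "real (card (level_edges E lev x)) \<le> 2 * 4 ^ lev x"
    and "weight E lev' x \<ge> 1/4"
    and "w \<notin> (\<Union>e\<in>level_edges E lev x. nds e) \<Longrightarrow> weight E lev' w = weight E lev w"
proof -
  let ?N = "level_edges E lev x" and ?i = "lev x"
  have N: "?N \<subseteq> E" "?N \<subseteq> Edges" using E by (auto simp: level_edges_def)
  have el': "el lev' e = (if e \<in> ?N then Suc ?i else el lev e)" if "e \<in> E" for e
    using el_up[of e lev x] that E unfolding lev'_def level_edges_def by auto
  have elN: "el lev e = ?i" if "e \<in> ?N" for e using that by (auto simp: level_edges_def)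
  have lev'_ge: "lev v \<le> lev' v" for v by (simp add: lev'_def)
  show cardN: "real (card ?N) \<le> 2 * 4 ^ ?i"
  proof -
    have "weight E lev x * 4 ^ ?i \<le> 2 * 4 ^ ?i" using heavy(2) by (intro mult_right_mono) auto
    then show ?thesis using card_level_edges_le[OF E, of lev x] by linarith
  qed
  have W': "weight E lev' w = weight E lev w - 3/4 * (1/4) ^ ?i * real (card {e. e \<in> ?N \<and> w \<in> nds e})" for w
  proof -
    have "weight E lev' w = weight E lev w + (\<Sum>e | e \<in> ?N \<and> w \<in> nds e. (1/4) ^ el lev' e - (1/4) ^ el lev e)"
      unfolding weight_def by (rule incident_split[OF E N(1)]) (simp add: el')
    also have "(\<Sum>e | e \<in> ?N \<and> w \<in> nds e. (1/4) ^ el lev' e - (1/4::real) ^ el lev e) = (\<Sum>e | e \<in> ?N \<and> w \<in> nds e. - (3/4 * (1/4) ^ ?i))"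
      by (rule sum.cong[OF refl]) (use N in \<open>auto simp: el' elN subset_iff\<close>)
    finally show ?thesis by simp
  qed
  then show W'_le: "weight E lev' w \<le> weight E lev w" for w by simp
  show "weight E lev' w = weight E lev w" if "w \<notin> (\<Union>e\<in>?N. nds e)" 
  proof -
    have "{e. e \<in> ?N \<and> w \<in> nds e} = {}" using that by auto
    then show ?thesis using W'[of w] by (simp only: card.empty of_nat_0 mult_zero_right diff_zero)
  qed
  have cw: "capped_weight E lev' v j \<le> capped_weight E lev v j" for v j
    unfolding capped_weight_def by (rule sum_mono, rule power_decreasing) (auto simp: el' elN max_def)
  show "budgeted E lev' a"
    using bud cw lev'_ge unfolding budgeted_def by (meson order_trans)
  \<comment> \<open>No contribution shrinks by more than a factor 4, so \<open>x\<close> keeps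
    weight at least \<open>1/4\<close> and needs no \<open>down_credit\<close> on its new
    level.\<close>
  have "weight E lev x \<le> (\<Sum>e | e \<in> E \<and> x \<in> nds e. 4 * (1/4) ^ el lev' e)"
    unfolding weight_def by (rule sum_mono) (auto simp: el' elN)
  then have "weight E lev x \<le> 4 * weight E lev' x" by (simp add: weight_def sum_distrib_left)
  then show heavy': "weight E lev' x \<ge> 1/4" using heavy by simp
  have "1 \<le> 1/2 + a x * (1/4) ^ ?i"
    using bud x heavy(1) weight_eq_capped[OF E, of lev x] unfolding budgeted_def by fastforce
  then have ax: "a x \<ge> 4 ^ ?i / 2" by (simp add: power_one_over field_simps)
  let ?c = "\<lambda>v. real (card {e. e \<in> ?N \<and> v \<in> nds e})"
  have "pot K \<kappa> E lev' a \<le> (\<Sum>v\<in>V. (up_credit \<kappa> (lev v) (a v) + down_credit K (lev v) (weight E lev v))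
     + K * ?c v + (if v = x then - (3/8 * \<kappa> * real f * 4 ^ ?i) else 0))"
    unfolding pot_def
  proof (rule sum_mono)
    fix v assume v: "v \<in> V"
    show "up_credit \<kappa> (lev' v) (a v) + down_credit K (lev' v) (weight E lev' v) \<le> (up_credit \<kappa> (lev v) (a v) + down_credit K (lev v) (weight E lev v))
     + K * ?c v + (if v = x then - (3/8 * \<kappa> * real f * 4 ^ ?i) else 0)"
    proof (cases "v = x")
      case True
      have d0: "down_credit K (lev' x) (weight E lev' x) = 0" using heavy' by (simp add: down_credit_def)
      have d1: "down_credit K (lev x) (weight E lev x) \<ge> 0" using K by (simp add: down_credit_def)
      have four_pos: "0 < (4::real) ^ ?i" by simp
      \<comment> \<open>Neither maximum in \<open>up_credit\<close> is cut off at 0, before or after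
        the move: the new offset \<open>4 * 4 ^ ?i / 8\<close> is exactly the guaranteed
        \<open>4 ^ ?i / 2\<close>. This fixes the \<open>1/8\<close> in
        \<open>up_credit\<close>.\<close>
      have "4 ^ ?i / 8 \<le> a x" "4 * 4 ^ ?i / 8 \<le> a x" using ax four_pos by linarith+
      then have "up_credit \<kappa> (lev' x) (a x) = \<kappa> * real f * (a x - 4 * 4 ^ ?i / 8)"
        "up_credit \<kappa> (lev x) (a x) = \<kappa> * real f * (a x - 4 ^ ?i / 8)"
        by (simp_all add: up_credit_def lev'_def max_absorb2)
      then have "up_credit \<kappa> (lev' x) (a x) = up_credit \<kappa> (lev x) (a x) - 3/8 * \<kappa> * real f * 4 ^ ?i"
        by (simp add: algebra_simps)
      then show ?thesis using True d0 d1 K by simp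
    next
      case False
      have "down_credit K (lev v) (weight E lev' v) \<le> down_credit K (lev v) (weight E lev v) + K * (4 ^ lev v * (weight E lev v - weight E lev' v))"
        by (rule down_credit_decrease[OF K W'_le])
      also have "4 ^ lev v * (weight E lev v - weight E lev' v) \<le> ?c v"
      proof (cases "{e. e \<in> ?N \<and> v \<in> nds e} = {}")
        case True
        then have "?c v = 0" by (metis card.empty of_nat_0)
        then show ?thesis by (simp add: W')
      next
        case False
        then obtain e where "e \<in> ?N" "v \<in> nds e" by auto
        \<comment> \<open>A node of an affected hyperedge does not lie above level
          \<open>?i\<close>, so its factor \<open>4 ^ lev v\<close> is cancelled by the
          \<open>(1/4) ^ ?i\<close> in the weight lost per hyperedge.\<close>
        then have "lev v \<le> ?i" using el_ge[of e v lev] elN N by auto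
        then have "(4::real) ^ lev v \<le> 4 ^ ?i" by (rule power_increasing) simp
        then have "4 ^ lev v * (3/4 * (1/4) ^ ?i * ?c v) \<le> 4 ^ ?i * (3/4 * (1/4) ^ ?i * ?c v)"
          by (intro mult_right_mono) auto
        also have "\<dots> \<le> ?c v" by (simp add: power_one_over)
        finally show ?thesis by (simp add: W')
      qed
      finally show ?thesis using False K by (simp add: lev'_def mult_left_mono)
    qed
  qed
  also have "\<dots> = pot K \<kappa> E lev a + K * (\<Sum>v\<in>V. ?c v) - 3/8 * \<kappa> * real f * 4 ^ ?i"
    unfolding sum.distrib pot_def using x finV by (simp add: sum.distrib sum_distrib_left sum.delta)
  also have "\<dots> \<le> pot K \<kappa> E lev a + K * (real f * (2 * 4 ^ ?i)) - 3/8 * \<kappa> * real f * 4 ^ ?i"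
  proof -
    have "(\<Sum>v\<in>V. ?c v) \<le> real f * real (card ?N)" by (rule sum_card_incidence_le[OF N(2)])
    also have "\<dots> \<le> real f * (2 * 4 ^ ?i)" using cardN by (intro mult_left_mono) auto
    finally show ?thesis using K by (simp add: mult_left_mono)
  qed
  finally show "pot K \<kappa> E lev' a + (3/8 * \<kappa> - 2 * K) * real f * 4 ^ lev x \<le> pot K \<kappa> E lev a"
    by (simp add: algebra_simps)
qed

text \<open>The \<open>down_credit\<close> of \<open>x\<close> falls by at least
  \<open>K / 8 * 4 ^ lev x\<close>. Each of the at most \<open>4 ^ lev x / (4 * G)\<close> affected
  hyperedges is counted as a new incidence at its other nodes, which costs at most
  \<open>\<kappa> * f\<close> at each of them.\<close>

lemma pot_down:
  assumes E: "E \<subseteq> Edges" and x: "x \<in> V" and bud: "budgeted E lev a" and K: "K \<ge> 0" and \<kappa>: "\<kappa> \<ge> 0"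
    and G: "G \<ge> 4" and light: "weight E lev x < 1 / (4 * G)" and lx: "lev x = Suc i"
  defines "lev' \<equiv> lev(x := i)"
  shows "\<exists>a'. budgeted E lev' a' \<and>
      pot K \<kappa> E lev' a' + (K / 8 - \<kappa> * real f * real f / (4 * G)) * 4 ^ lev x \<le> pot K \<kappa> E lev a"
    and "weight E lev' w \<ge> weight E lev w"
    and "weight E lev' w \<le> weight E lev w + 1"
    and "real (card (level_edges E lev x)) \<le> 4 ^ lev x / (4 * G)"
    and "w \<notin> (\<Union>e\<in>level_edges E lev x. nds e) \<Longrightarrow> weight E lev' w = weight E lev w"
proof -
  let ?N = "level_edges E lev x"
  let ?c = "\<lambda>v. real (card {e. e \<in> ?N \<and> v \<in> nds e})"
  have N: "?N \<subseteq> E" "?N \<subseteq> Edges" "finite ?N" using E finE by (auto simp: level_edges_def intro: finite_subset)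
  have el': "el lev' e = el lev e" if "e \<in> E - ?N" for e
    using el_down(1)[of e lev x i] that E lx unfolding lev'_def level_edges_def by auto
  have elN: "el lev e = Suc i" "el lev' e \<in> {i, Suc i}" if "e \<in> ?N" for e
    using that el_down(2)[of e lev x i] E lx unfolding lev'_def level_edges_def by auto
  have el'_le: "el lev' e \<le> el lev e" if "e \<in> E" for e
    using that el_down(3)[of e lev x i] E lx unfolding lev'_def by auto
  show cardN: "real (card ?N) \<le> 4 ^ lev x / (4 * G)"
  proof -
    have "weight E lev x * 4 ^ lev x \<le> 1 / (4 * G) * 4 ^ lev x"
      using light by (intro mult_right_mono) auto
    then show ?thesis using card_level_edges_le[OF E, of lev x] by simp
  qed
  have cN: "?c w \<le> real (card ?N)" for w
    using N(3) by (auto intro!: card_mono)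
  have Wd: "weight E lev' w = weight E lev w + (\<Sum>e | e \<in> ?N \<and> w \<in> nds e. (1/4) ^ el lev' e - (1/4) ^ el lev e)" for w
    unfolding weight_def by (rule incident_split[OF E N(1)]) (simp add: el')
  have incr: "0 \<le> (1/4::real) ^ el lev' e - (1/4) ^ el lev e" "(1/4::real) ^ el lev' e - (1/4) ^ el lev e \<le> (1/4)^i" if "e \<in> ?N" for e
    using elN[OF that] by auto
  show W'_ge: "weight E lev' w \<ge> weight E lev w" for w
    unfolding Wd using incr by (auto intro!: sum_nonneg)
  \<comment> \<open>Each affected hyperedge gains at most \<open>(1/4) ^ i\<close>, and there are at
    most \<open>4 ^ Suc i / (4 * G)\<close> of them.\<close>
  have W'_le: "weight E lev' w \<le> weight E lev w + 1/G" for w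
  proof -
    have "(\<Sum>e | e \<in> ?N \<and> w \<in> nds e. (1/4) ^ el lev' e - (1/4::real) ^ el lev e) \<le> (\<Sum>e | e \<in> ?N \<and> w \<in> nds e. (1/4)^i)"
      by (rule sum_mono) (use incr in auto)
    also have "\<dots> = ?c w * (1/4)^i" by simp
    also have "\<dots> \<le> 4 ^ lev x / (4 * G) * (1/4)^i"
      using order_trans[OF cN cardN] by (intro mult_right_mono) auto
    also have "\<dots> = 1 / G" by (simp add: lx power_one_over)
    finally show ?thesis unfolding Wd by simp
  qed
  have G1: "1 / G \<le> 1/4" using G by (simp add: field_simps)
  then show "weight E lev' w \<le> weight E lev w + 1" using W'_le[of w] by linarith
  show "weight E lev' w = weight E lev w" if "w \<notin> (\<Union>e\<in>?N. nds e)"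
  proof -
    have "{e. e \<in> ?N \<and> w \<in> nds e} = {}" using that by auto
    then show ?thesis unfolding Wd by (metis (no_types, lifting) add.right_neutral sum.empty)
  qed
  \<comment> \<open>At \<open>x\<close> the count restarts, since the weight after the move fits
    into the \<open>1/2\<close> of the budget; at the other nodes the affected hyperedges count as
    added.\<close>
  define a' where "a' = (\<lambda>v. if v = x then 0 else a v + ?c v)"
  have a0: "a v \<ge> 0" if "v \<in> V" for v using bud that by (auto simp: budgeted_def)
  have "budgeted E lev' a'"
    unfolding budgeted_def
  proof (intro ballI conjI allI impI)
    fix v assume "v \<in> V"
    then show "a' v \<ge> 0" using a0 by (simp add: a'_def)
  next
    fix v j assume v: "v \<in> V" and j: "lev' v \<le> j"
    show "capped_weight E lev' v j \<le> 1/2 + a' v * (1/4) ^ j"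
    proof (cases "v = x")
      case True
      have "capped_weight E lev' x j \<le> weight E lev' x"
        unfolding capped_weight_def weight_def by (rule sum_mono, rule power_decreasing) auto
      also have "\<dots> \<le> 1/2"
      proof -
        have "1 / (4 * G) \<le> 1/4" using G by (simp add: field_simps)
        then show ?thesis using W'_le[of x] light G1 by linarith
      qed
      finally show ?thesis using True by (simp add: a'_def)
    next
      case False
      have "capped_weight E lev' v j = capped_weight E lev v j + (\<Sum>e | e \<in> ?N \<and> v \<in> nds e. (1/4) ^ max (el lev' e) j - (1/4) ^ max (el lev e) j)"
        unfolding capped_weight_def by (rule incident_split[OF E N(1)]) (simp add: el')
      moreover have "(\<Sum>e | e \<in> ?N \<and> v \<in> nds e. (1/4) ^ max (el lev' e) j - (1/4::real) ^ max (el lev e) j) \<le> (\<Sum>e | e \<in> ?N \<and> v \<in> nds e. (1/4) ^ j)"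
      proof (rule sum_mono)
        fix e
        have "(1/4::real) ^ max (el lev' e) j \<le> (1/4) ^ j" by (rule power_decreasing) auto
        then show "(1/4) ^ max (el lev' e) j - (1/4::real) ^ max (el lev e) j \<le> (1/4) ^ j"
          using zero_le_power[of "1/4::real" "max (el lev e) j"] by linarith
      qed
      moreover have "(\<Sum>e | e \<in> ?N \<and> v \<in> nds e. (1/4::real) ^ j) = ?c v * (1/4) ^ j" by simp
      moreover have "capped_weight E lev v j \<le> 1/2 + a v * (1/4) ^ j"
        using bud v j False unfolding budgeted_def lev'_def by auto
      moreover have "a' v * (1/4) ^ j = a v * (1/4) ^ j + ?c v * (1/4) ^ j"
        using False by (simp add: a'_def distrib_right)
      ultimately show ?thesis by linarith
    qed
  qed
  moreover have "pot K \<kappa> E lev' a' + (K / 8 - \<kappa> * real f * real f / (4 * G)) * 4 ^ lev x \<le> pot K \<kappa> E lev a"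
  proof -
    have "pot K \<kappa> E lev' a' \<le> (\<Sum>v\<in>V. (up_credit \<kappa> (lev v) (a v) + down_credit K (lev v) (weight E lev v))
       + \<kappa> * real f * ?c v + (if v = x then - (K / 8 * 4 ^ lev x) else 0))"
      unfolding pot_def
    proof (rule sum_mono)
      fix v assume v: "v \<in> V"
      show "up_credit \<kappa> (lev' v) (a' v) + down_credit K (lev' v) (weight E lev' v) \<le> (up_credit \<kappa> (lev v) (a v) + down_credit K (lev v) (weight E lev v))
       + \<kappa> * real f * ?c v + (if v = x then - (K / 8 * 4 ^ lev x) else 0)"
      proof (cases "v = x")
        case True
        have u: "up_credit \<kappa> (lev' x) (a' x) = 0" by (simp add: up_credit_def a'_def)
        have u': "up_credit \<kappa> (lev x) (a x) \<ge> 0" using \<kappa> by (simp add: up_credit_def)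
        have q: "1 / (4 * G) \<le> 1/16" using G by (simp add: field_simps)
        have "down_credit K (lev' x) (weight E lev' x) \<le> K * 4 ^ i * (1/4)"
        proof -
          have "K * 4 ^ i * max 0 (1/4 - weight E lev' x) \<le> K * 4 ^ i * (1/4)"
            using K weight_nonneg[of E lev' x] by (intro mult_left_mono) (linarith, simp)
          then show ?thesis using K by (simp add: down_credit_def lev'_def)
        qed
        also have "\<dots> = K * 4 ^ lev x * (1/16)" by (simp add: lx)
        \<comment> \<open>The weight is below \<open>1/16\<close>, so the old deficit is at least
          \<open>3/16\<close>; the new credit, measured in units of \<open>K * 4 ^ lev x\<close>, is
          at most \<open>1/16\<close>. The difference is the released \<open>1/8\<close>.\<close>
        also have "\<dots> \<le> K * 4 ^ lev x * (max 0 (1/4 - weight E lev x) - 1/8)"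
          using light q K by (intro mult_left_mono) auto
        also have "\<dots> = down_credit K (lev x) (weight E lev x) - K / 8 * 4 ^ lev x"
          by (simp add: down_credit_def lx algebra_simps)
        finally have "down_credit K (lev' x) (weight E lev' x) \<le> down_credit K (lev x) (weight E lev x) - K / 8 * 4 ^ lev x" .
        moreover have "\<kappa> * real f * ?c x \<ge> 0" using \<kappa> by simp
        ultimately show ?thesis using True u u' by simp
      next
        case False
        have "down_credit K (lev v) (weight E lev' v) \<le> down_credit K (lev v) (weight E lev v)"
          by (rule down_credit_mono[OF K W'_ge])
        moreover have "up_credit \<kappa> (lev v) (a' v) \<le> up_credit \<kappa> (lev v) (a v) + \<kappa> * real f * ?c v"
          using up_credit_add[OF \<kappa>, of "?c v" "lev v" "a v"] False by (simp add: a'_def)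
        ultimately show ?thesis using False by (simp add: lev'_def)
      qed
    qed
    also have "\<dots> = pot K \<kappa> E lev a + \<kappa> * real f * (\<Sum>v\<in>V. ?c v) - K / 8 * 4 ^ lev x"
      unfolding sum.distrib pot_def using x finV by (simp add: sum.distrib sum_distrib_left sum.delta)
    also have "\<dots> \<le> pot K \<kappa> E lev a + \<kappa> * real f * (real f * (4 ^ lev x / (4 * G))) - K / 8 * 4 ^ lev x"
    proof -
      have "(\<Sum>v\<in>V. ?c v) \<le> real f * real (card ?N)" by (rule sum_card_incidence_le[OF N(2)])
      also have "\<dots> \<le> real f * (4 ^ lev x / (4 * G))" using cardN by (intro mult_left_mono) auto
      finally have "\<kappa> * real f * (\<Sum>v\<in>V. ?c v) \<le> \<kappa> * real f * (real f * (4 ^ lev x / (4 * G)))"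
        using \<kappa> by (intro mult_left_mono) simp_all
      then show ?thesis by linarith
    qed
    finally show ?thesis by (simp add: algebra_simps)
  qed
  ultimately show "\<exists>a'. budgeted E lev' a' \<and>
      pot K \<kappa> E lev' a' + (K / 8 - \<kappa> * real f * real f / (4 * G)) * 4 ^ lev x \<le> pot K \<kappa> E lev a" by blast
qed

text \<open>No incident hyperedge weighs more than \<open>(1/4) ^ lev x\<close>, so weight 1 takes
  at least \<open>4 ^ lev x\<close> of them. This bounds the levels and thereby the numbers in
  memory.\<close>

lemma max_level_bound:
  assumes "E \<subseteq> Edges" "weight E lev x \<ge> 1" "card E \<le> M"
  shows "4 ^ lev x \<le> M"
proof -
  have fin: "finite E" using assms(1) finE finite_subset by blast
  have "weight E lev x \<le> (\<Sum>e | e \<in> E \<and> x \<in> nds e. (1/4) ^ lev x)"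
    unfolding weight_def by (rule sum_mono, rule power_decreasing) (use assms el_ge in auto)
  also have "\<dots> = real (card {e \<in> E. x \<in> nds e}) * (1/4) ^ lev x" by simp
  also have "\<dots> \<le> real M * (1/4) ^ lev x"
    using assms(3) card_mono[OF fin, of "{e \<in> E. x \<in> nds e}"] by (intro mult_right_mono) auto
  finally have "weight E lev x * 4 ^ lev x \<le> real M" by (simp add: power_one_over field_simps)
  moreover have "1 * 4 ^ lev x \<le> weight E lev x * 4 ^ lev x" using assms(2) by (intro mult_right_mono) auto
  ultimately have "(4::real) ^ lev x \<le> real M" by linarith
  then show ?thesis using of_nat_le_iff[of "4 ^ lev x" M, where 'a = real] by simp
qed

end

section \<open>Program logic and incidence edge_lists\<close>

text \<open>\<open>T\<close> is a time credit; the postcondition receives the final memory and the unspent credit.\<close>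

definition ok :: "nat \<Rightarrow> com \<Rightarrow> mem \<Rightarrow> real \<Rightarrow> (mem \<Rightarrow> real \<Rightarrow> bool) \<Rightarrow> bool" where
  "ok B c s T Q \<longleftrightarrow> (\<exists>t s'. exec B c s t s' \<and> real t \<le> T \<and> Q s' (T - real t))"

lemma ok_SKIP: "ok B SKIP s T Q \<longleftrightarrow> 1 \<le> T \<and> Q s (T - 1)"
  unfolding ok_def by (metis SkipE exec.Skip of_nat_1)

lemma ok_WRITE: "ok B (WRITE a x y) s T Q \<longleftrightarrow> fits B x s \<and> fits B y s \<and> real (acost x + acost y + 1) \<le> T \<and>
   Q (s(a := (s a)(aval x s := aval y s))) (T - real (acost x + acost y + 1))"
  unfolding ok_def by (auto elim!: WriteE) (metis exec.Write Suc_eq_plus1 of_nat_Suc of_nat_add)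

lemma ok_SEQ: "ok B (SEQ c1 c2) s T Q \<longleftrightarrow> ok B c1 s T (\<lambda>s' T'. ok B c2 s' T' Q)"
proof
  assume "ok B (SEQ c1 c2) s T Q"
  then obtain t s' where "exec B (SEQ c1 c2) s t s'" "real t \<le> T" "Q s' (T - real t)" by (auto simp: ok_def)
  then show "ok B c1 s T (\<lambda>s' T'. ok B c2 s' T' Q)"
  proof (elim SeqE)
    fix t1 s1 t2 assume "t = t1 + t2" "exec B c1 s t1 s1" "exec B c2 s1 t2 s'"
    then show ?thesis using \<open>real t \<le> T\<close> \<open>Q s' (T - real t)\<close> unfolding ok_def
      by (intro exI[of _ t1] exI[of _ s1]) (auto intro!: exI[of _ t2] exI[of _ s'] simp: algebra_simps)
  qed
next
  assume "ok B c1 s T (\<lambda>s' T'. ok B c2 s' T' Q)"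
  then obtain t1 s1 t2 s2 where "exec B c1 s t1 s1" "exec B c2 s1 t2 s2" "real t1 \<le> T" "real t2 \<le> T - real t1" "Q s2 (T - real t1 - real t2)"
    by (auto simp: ok_def)
  then show "ok B (SEQ c1 c2) s T Q"
    unfolding ok_def by (intro exI[of _ "t1 + t2"] exI[of _ s2]) (auto intro: exec.Seq simp: algebra_simps)
qed

lemma ok_IF: "ok B (IF b c1 c2) s T Q \<longleftrightarrow> fits B b s \<and>
   (if aval b s \<noteq> 0 then ok B c1 s (T - real (acost b + 1)) Q else ok B c2 s (T - real (acost b + 1)) Q)"
proof -
  have 1: "ok B (IF b c1 c2) s T Q" if b: "fits B b s" "aval b s \<noteq> 0" and c: "ok B c1 s (T - real (acost b + 1)) Q"
  proof -
    obtain t s' where "exec B c1 s t s'" "real t \<le> T - real (acost b + 1)" "Q s' (T - real (acost b + 1) - real t)"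
      using c by (auto simp: ok_def)
    then show ?thesis using exec.IfTrue[OF b] unfolding ok_def
      by (intro exI[of _ "acost b + 1 + t"] exI[of _ s']) (auto simp: algebra_simps)
  qed
  have 2: "ok B (IF b c1 c2) s T Q" if b: "fits B b s" "aval b s = 0" and c: "ok B c2 s (T - real (acost b + 1)) Q"
  proof -
    obtain t s' where "exec B c2 s t s'" "real t \<le> T - real (acost b + 1)" "Q s' (T - real (acost b + 1) - real t)"
      using c by (auto simp: ok_def)
    then show ?thesis using exec.IfFalse[OF b] unfolding ok_def
      by (intro exI[of _ "acost b + 1 + t"] exI[of _ s']) (auto simp: algebra_simps)
  qed
  show ?thesis
  proof
    assume "ok B (IF b c1 c2) s T Q"
    then obtain t s' where e: "exec B (IF b c1 c2) s t s'" and r: "real t \<le> T" "Q s' (T - real t)" by (auto simp: ok_def)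
    show "fits B b s \<and> (if aval b s \<noteq> 0 then ok B c1 s (T - real (acost b + 1)) Q else ok B c2 s (T - real (acost b + 1)) Q)"
      using e
    proof (cases rule: exec.cases)
      case (IfTrue u)
      then show ?thesis using r unfolding ok_def by (auto intro!: exI[of _ u] exI[of _ s'] simp: algebra_simps)
    next
      case (IfFalse u)
      then show ?thesis using r unfolding ok_def by (auto intro!: exI[of _ u] exI[of _ s'] simp: algebra_simps)
    qed
  qed (use 1 2 in \<open>auto split: if_splits\<close>)
qed

lemmas ok_simps = ok_SKIP ok_WRITE ok_SEQ ok_IF

lemma ok_mono: "ok B c s T Q \<Longrightarrow> (\<And>s' T'. Q s' T' \<Longrightarrow> Q' s' T') \<Longrightarrow> ok B c s T Q'"
  unfolding ok_def by blast

text \<open>A specification fixes a worst-case time \<open>k\<close>, and the caller learns only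
  that at least \<open>T - k\<close> is left. Exact running times of fragments never have to be
  known.\<close>

lemma ok_call:
  assumes "ok B c s k (\<lambda>s' _. P s')" "k \<le> T" "\<And>s' T'. P s' \<Longrightarrow> T - k \<le> T' \<Longrightarrow> Q s' T'"
  shows "ok B c s T Q"
proof -
  obtain t s' where "exec B c s t s'" "real t \<le> k" "P s'" using assms(1) by (auto simp: ok_def)
  then show ?thesis using assms(2) assms(3)[of s' "T - real t"] unfolding ok_def by (intro exI[of _ t] exI[of _ s']) auto
qed

text \<open>Termination needs no separate argument: every iteration consumes credit, which never becomes negative.\<close>

lemma ok_WHILE:
  assumes step: "\<And>s T. I s T \<Longrightarrow> fits B b s \<and>
      (if aval b s \<noteq> 0 then ok B c s (T - real (acost b + 1)) I
       else real (acost b + 1) \<le> T \<and> Q s (T - real (acost b + 1)))"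
    and "I s T"
  shows "ok B (WHILE b c) s T Q"
  using \<open>I s T\<close>
proof (induction "nat \<lceil>T\<rceil>" arbitrary: s T rule: less_induct)
  case less
  note st = step[OF less.prems]
  show ?case
  proof (cases "aval b s = 0")
    case True
    then show ?thesis using st unfolding ok_def by (auto intro!: exI[of _ "acost b + 1"] exI[of _ s] intro: exec.WhileFalse)
  next
    case False
    then obtain t1 s1 where 1: "exec B c s t1 s1" "real t1 \<le> T - real (acost b + 1)" "I s1 (T - real (acost b + 1) - real t1)"
      using st by (auto simp: ok_def)
    have "nat \<lceil>T - real (acost b + 1) - real t1\<rceil> < nat \<lceil>T\<rceil>" using 1(2) by linarith
    from less.hyps[OF this 1(3)] obtain t2 s2 where 2: "exec B (WHILE b c) s1 t2 s2"
      "real t2 \<le> T - real (acost b + 1) - real t1" "Q s2 (T - real (acost b + 1) - real t1 - real t2)"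
      by (auto simp: ok_def)
    have "exec B (WHILE b c) s (acost b + 1 + t1 + t2) s2"
      using st False 1(1) 2(1) by (intro exec.WhileTrue) auto
    then show ?thesis using 2 unfolding ok_def
      by (intro exI[of _ "acost b + 1 + t1 + t2"] exI[of _ s2]) (auto simp: algebra_simps)
  qed
qed

text \<open>
  Memory layout, with \<open>M = (n + 1) ^ f\<close>. A level \<open>l\<close> is represented by \<open>q = 4 ^ l\<close>, and array 2 holds
  \<open>q - 1\<close>, so that exactly the nodes on level 0 have entry 0. The hyperedges of value \<open>q\<close> at \<open>v\<close> are
  listed in array 6 from cell \<open>(q * n + v) * M\<close> on; cell \<open>q * n + v\<close> of array 5 is the length of that list,
  and cell \<open>e * n + v\<close> of array 7 is the position of \<open>e\<close> in its list at \<open>v\<close>. The weight at \<open>v\<close> is the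
  entry of array 8 over one plus the entry of array 9. Arrays 10, 11, 12 are a stack (items, membership flags, height)
  of the nodes that may have to move up, and arrays 13, 14, 15 one of those that may have to move down. Of the
  scalars, 16 holds \<open>M\<close>, 17 the current hyperedge and 19 the current node.
\<close>

abbreviation "var a \<equiv> Read a (Const 0)"

text \<open>The flags keep each node on the stack at most once, so a stack never exceeds
  \<open>n\<close> items and each item can carry its own time credit.\<close>

definition push :: "nat \<Rightarrow> com" where
  "push a = IF (Read (Suc a) (var 19)) SKIP
     (SEQ (WRITE a (var (Suc (Suc a))) (var 19))
     (SEQ (WRITE (Suc a) (var 19) (Const 1))
          (WRITE (Suc (Suc a)) (Const 0) (Op Add (var (Suc (Suc a))) (Const 1)))))"

text \<open>The list is selected by the value currently stored for the hyperedge. Hence a pair has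
  to be removed before that value is overwritten.\<close>

definition key :: aexp where
  "key = Op Add (Op Mul (Read 4 (var 17)) (var 0)) (var 19)"

definition slot :: "aexp \<Rightarrow> aexp" where
  "slot k = Op Add (Op Mul (var 20) (var 16)) k"

text \<open>The last entry of the list fills the gap, so removal takes constant time. The node has
  lost weight and becomes a candidate for a move down.\<close>

definition remove_pair :: com where
  "remove_pair =
    SEQ (WRITE 20 (Const 0) key)
   (SEQ (WRITE 5 (var 20) (Op Sub (Read 5 (var 20)) (Const 1)))
   (SEQ (WRITE 22 (Const 0) (Read 6 (slot (Read 5 (var 20)))))
   (SEQ (WRITE 23 (Const 0) (Read 7 (Op Add (Op Mul (var 17) (var 0)) (var 19))))
   (SEQ (WRITE 6 (slot (var 23)) (var 22))
   (SEQ (WRITE 7 (Op Add (Op Mul (var 22) (var 0)) (var 19)) (var 23))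
   (SEQ (WRITE 8 (var 19) (Op Sub (Read 8 (var 19)) (Op Div (Op Add (Read 9 (var 19)) (Const 1)) (Read 4 (var 17)))))
        (push 13)))))))"

text \<open>If the common denominator at the node is too small for the new value, numerator and
  denominator are scaled up first. The denominator is never lowered again. The node has gained
  weight and becomes a candidate for a move up.\<close>

definition add_pair :: com where
  "add_pair =
    SEQ (WRITE 20 (Const 0) key)
   (SEQ (WRITE 6 (slot (Read 5 (var 20))) (var 17))
   (SEQ (WRITE 7 (Op Add (Op Mul (var 17) (var 0)) (var 19)) (Read 5 (var 20)))
   (SEQ (WRITE 5 (var 20) (Op Add (Read 5 (var 20)) (Const 1)))
   (SEQ (IF (Op Less (Op Add (Read 9 (var 19)) (Const 1)) (Read 4 (var 17)))
          (SEQ (WRITE 8 (var 19) (Op Mul (Read 8 (var 19)) (Op Div (Read 4 (var 17)) (Op Add (Read 9 (var 19)) (Const 1)))))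
               (WRITE 9 (var 19) (Op Sub (Read 4 (var 17)) (Const 1))))
          SKIP)
   (SEQ (WRITE 8 (var 19) (Op Add (Read 8 (var 19)) (Op Div (Op Add (Read 9 (var 19)) (Const 1)) (Read 4 (var 17)))))
        (push 10))))))"

section \<open>Invariants of stacks, incidence lists and stored weights\<close>

definition stack :: "nat \<Rightarrow> nat \<Rightarrow> nat set \<Rightarrow> mem \<Rightarrow> bool" where
  "stack n a X s \<longleftrightarrow> (\<exists>xs. distinct xs \<and> set xs = X \<and> X \<subseteq> {..<n} \<and> s (Suc (Suc a)) 0 = length xs \<and>
     (\<forall>i<length xs. s a i = xs ! i) \<and> (\<forall>v<n. s (Suc a) v = (if v \<in> X then 1 else 0)))"

lemma stack_cong: "s' a = s a \<Longrightarrow> s' (Suc a) = s (Suc a) \<Longrightarrow> s' (Suc (Suc a)) = s (Suc (Suc a)) \<Longrightarrow> stack n a X s' = stack n a X s"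
  by (simp add: stack_def)

lemma length_le_of_subset: "distinct xs \<Longrightarrow> set xs \<subseteq> {..<n} \<Longrightarrow> length xs \<le> n"
  using card_mono[of "{..<n}" "set xs"] by (simp add: distinct_card)

text \<open>The condition on \<open>a\<close> keeps the three stack arrays apart from array 19,
  which holds the node.\<close>

lemma push_ok:
  assumes "stack n a X s" "s 19 0 < n" "n + 1 < B" "a < 17 \<or> a > 19"
  shows "ok B (push a) s 20 (\<lambda>s' _. stack n a (insert (s 19 0) X) s' \<and> (\<forall>b. b \<noteq> a \<longrightarrow> b \<noteq> Suc a \<longrightarrow> b \<noteq> Suc (Suc a) \<longrightarrow> s' b = s b))"
proof -
  obtain xs where xs: "distinct xs" "set xs = X" "X \<subseteq> {..<n}" "s (Suc (Suc a)) 0 = length xs"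
     "\<forall>i<length xs. s a i = xs ! i" "\<forall>v<n. s (Suc a) v = (if v \<in> X then 1 else 0)"
    using assms(1) by (auto simp: stack_def)
  have len: "length xs \<le> n" using length_le_of_subset xs by auto
  have ne: "a \<noteq> 19" "Suc a \<noteq> 19" "Suc (Suc a) \<noteq> 19" using assms(4) by auto
  show ?thesis
  proof (cases "s 19 0 \<in> X")
    case True
    then show ?thesis using assms xs by (simp add: push_def ok_simps insert_absorb)
  next
    case False
    have "length xs < n"
    proof -
      have "length (s 19 0 # xs) \<le> n" by (rule length_le_of_subset) (use xs False assms(2) in auto)
      then show ?thesis by simp
    qed
    then show ?thesis using False assms xs ne
      apply (simp add: push_def ok_simps)
      unfolding stack_def
      apply (rule exI[of _ "xs @ [s 19 0]"])
      apply (auto simp: nth_append less_Suc_eq)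
      done
  qed
qed

text \<open>\<open>C\<close>, \<open>L\<close> and \<open>P\<close> are lengths, entries and
  positions, \<open>d\<close> the values of the hyperedges. The two clauses make \<open>P\<close>
  and \<open>L\<close> inverse to each other, so each incidence sits in exactly one used cell and
  can be located in constant time.\<close>

definition edge_lists :: "nat \<Rightarrow> nat \<Rightarrow> (nat \<times> nat) set \<Rightarrow> (nat \<Rightarrow> nat) \<Rightarrow> (nat \<Rightarrow> nat) \<Rightarrow> (nat \<Rightarrow> nat) \<Rightarrow> (nat \<Rightarrow> nat) \<Rightarrow> bool" where
  "edge_lists n M I d C L P \<longleftrightarrow>
    (\<forall>e v. (e, v) \<in> I \<longrightarrow> v < n \<and> e < M \<and> P (e * n + v) < C (d e * n + v) \<and> L ((d e * n + v) * M + P (e * n + v)) = e) \<and>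
    (\<forall>v<n. \<forall>q k. k < C (q * n + v) \<longrightarrow>
       (L ((q * n + v) * M + k), v) \<in> I \<and> d (L ((q * n + v) * M + k)) = q \<and> P (L ((q * n + v) * M + k) * n + v) = k)"

text \<open>All weights at \<open>v\<close> share the denominator \<open>Suc (D v)\<close>. It is a
  power of 4, and so is every value at \<open>v\<close>, so the integer quotients are exact. Keeping
  the denominator minus one lets zeroed memory mean denominator 1.\<close>

definition stored_weights :: "nat \<Rightarrow> nat \<Rightarrow> (nat \<times> nat) set \<Rightarrow> (nat \<Rightarrow> nat) \<Rightarrow> (nat \<Rightarrow> nat) \<Rightarrow> (nat \<Rightarrow> nat) \<Rightarrow> bool" where
  "stored_weights n M I d N D \<longleftrightarrow> (\<forall>v<n. (\<exists>i. Suc (D v) = 4 ^ i) \<and> Suc (D v) \<le> 4 * M \<and>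
     (\<forall>e. (e, v) \<in> I \<longrightarrow> (\<exists>i. d e = 4 ^ i) \<and> d e \<le> Suc (D v)) \<and>
     N v = (\<Sum>e | (e, v) \<in> I. Suc (D v) div d e))"

lemma pair_code_inj: "v < n \<Longrightarrow> v' < n \<Longrightarrow> q * n + v = q' * n + v' \<longleftrightarrow> q = q' \<and> v = (v'::nat)"
proof
  assume "v < n" "v' < n" "q * n + v = q' * n + v'"
  then have "(q * n + v) div n = (q' * n + v') div n" "(q * n + v) mod n = (q' * n + v') mod n" by auto
  then show "q = q' \<and> v = v'" using \<open>v < n\<close> \<open>v' < n\<close> by simp
qed auto

text \<open>The positions \<open>P\<close> supply the inverse of the bijection. As the entries of a
  list are distinct numbers below \<open>M\<close>, rows of width \<open>M\<close> suffice.\<close>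

lemma edge_lists_count:
  assumes "edge_lists n M I d C L P" "v < n"
  shows "C (q * n + v) = card {e. (e, v) \<in> I \<and> d e = q}" "bij_betw (\<lambda>k. L ((q * n + v) * M + k)) {..<C (q * n + v)} {e. (e, v) \<in> I \<and> d e = q}"
    "{e. (e, v) \<in> I \<and> d e = q} \<subseteq> {..<M}" "C (q * n + v) \<le> M"
proof -
  show bij: "bij_betw (\<lambda>k. L ((q * n + v) * M + k)) {..<C (q * n + v)} {e. (e, v) \<in> I \<and> d e = q}"
    by (rule bij_betw_byWitness[where f' = "\<lambda>e. P (e * n + v)"]) (use assms in \<open>auto simp: edge_lists_def\<close>)
  show sub: "{e. (e, v) \<in> I \<and> d e = q} \<subseteq> {..<M}" using assms by (auto simp: edge_lists_def)
  show c: "C (q * n + v) = card {e. (e, v) \<in> I \<and> d e = q}" using bij_betw_same_card[OF bij] by simp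
  show "C (q * n + v) \<le> M" unfolding c using card_mono[OF _ sub] by simp
qed

text \<open>The last entry \<open>w\<close> moves to the position \<open>p\<close> of
  \<open>e\<close>. If \<open>e\<close> is itself the last entry, then \<open>p = c\<close> and the
  writes leave \<open>L\<close> and \<open>P\<close> as they were.\<close>

lemma edge_lists_remove:
  assumes l: "edge_lists n M I d C L P" and ev: "(e, v) \<in> I"
    and k: "k = d e * n + v" and c: "c = C k - 1" and w: "w = L (k * M + c)" and p: "p = P (e * n + v)"
  shows "edge_lists n M (I - {(e, v)}) d (C(k := c)) (L(k * M + p := w)) (P(w * n + v := p))"
proof -
  have l1: "v < n" "e < M" "P (e * n + v) < C (d e * n + v)" "L ((d e * n + v) * M + P (e * n + v)) = e" if "(e, v) \<in> I" for e v
    using l that by (auto simp: edge_lists_def)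
  have l2: "(L ((q * n + v) * M + k), v) \<in> I" "d (L ((q * n + v) * M + k)) = q" "P (L ((q * n + v) * M + k) * n + v) = k"
    if "v < n" "k < C (q * n + v)" for q v k
    using l that by (auto simp: edge_lists_def)
  note b = l1[OF ev]
  have cC: "c < C k" "p < C k" "p \<le> c" using b c k p by auto
  note lc = edge_lists_count(4)[OF l]
  have W: "(w, v) \<in> I" "d w = d e" "P (w * n + v) = c"
    using l2[OF b(1), of c "d e"] cC k w by auto
  have pe: "w = e \<longleftrightarrow> p = c" using b p w W k by auto
  have CM: "C (q * n + v) \<le> M" if "v < n" for q v using lc[OF that] .
  show ?thesis
    unfolding edge_lists_def
  proof (intro conjI allI impI)
    fix e' v' assume a: "(e', v') \<in> I - {(e, v)}"
    then have b': "v' < n" "e' < M" "P (e' * n + v') < C (d e' * n + v')" "L ((d e' * n + v') * M + P (e' * n + v')) = e'"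
      using l1 by auto
    show "v' < n" "e' < M" by fact+
    show "(P(w * n + v := p)) (e' * n + v') < (C(k := c)) (d e' * n + v')"
    proof (cases "e' = w \<and> v' = v")
      case True
      then have "p \<noteq> c" using pe a by auto
      then show ?thesis using True W cC k by auto
    next
      case False
      \<comment> \<open>Only \<open>w\<close> occupied the last position of this list, so all other
        entries stay below the reduced length.\<close>
      then have "P (e' * n + v') \<noteq> c" if "v' = v" "d e' = d e" using that b' w k by auto
      then show ?thesis using False b'(3) c pair_code_inj[OF b'(1) b(1)] k
        by (cases "v' = v \<and> d e' = d e") auto
    qed
    show "(L(k * M + p := w)) ((d e' * n + v') * M + (P(w * n + v := p)) (e' * n + v')) = e'"
    proof (cases "e' = w \<and> v' = v")
      case True
      then show ?thesis using W k by auto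
    next
      case False
      have "(d e' * n + v') * M + P (e' * n + v') \<noteq> k * M + p"
      proof
        assume *: "(d e' * n + v') * M + P (e' * n + v') = k * M + p"
        moreover have "P (e' * n + v') < M" "p < M" using b' CM[OF b'(1), of "d e'"] cC CM[OF b(1), of "d e"] k by auto
        ultimately have "d e' * n + v' = k" by (simp add: pair_code_inj)
        then have "v' = v" using pair_code_inj[OF b'(1) b(1)] k by blast
        moreover have "e' = e" using * b'(4) b(4) k p by metis
        ultimately show False using a by auto
      qed
      then show ?thesis using False b' b pair_code_inj[of v' n v] by auto
    qed
  next
    fix v' q k' assume v': "v' < n" and k': "k' < (C(k := c)) (q * n + v')"
    then have k'C: "k' < C (q * n + v')" using cC by (auto split: if_splits)
    let ?u = "(q * n + v') * M + k'"
    note b' = l2[OF v' k'C]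
    have "k' < M" "p < M" using k'C CM[OF v', of q] cC CM[OF b(1), of "d e"] k by auto
    then have eq: "?u = k * M + p \<longleftrightarrow> q * n + v' = k \<and> k' = p" using pair_code_inj by auto
    have "(((L(k * M + p := w)) ?u, v') \<in> I - {(e, v)} \<and> d ((L(k * M + p := w)) ?u) = q \<and>
           (P(w * n + v := p)) ((L(k * M + p := w)) ?u * n + v') = k')"
    proof (cases "q * n + v' = k")
      case True
      then have t: "q = d e" "v' = v" using pair_code_inj v' b(1) k by auto
      have k'c: "k' < c" using k' True by simp
      show ?thesis
      proof (cases "k' = p")
        case True
        then have "w \<noteq> e" using k'c pe by auto
        then show ?thesis using True t W eq k by auto
      next
        case False
        then have "L ?u \<noteq> e" "L ?u \<noteq> w" using b' t p k'c W by auto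
        then show ?thesis using False eq b' t b pair_code_inj[of v n v] by auto
      qed
    next
      case False
      have "\<not> (L ?u = w \<and> v' = v)" using b' W False k by auto
      moreover have "\<not> (L ?u = e \<and> v' = v)" using b' False k by auto
      ultimately show ?thesis using False eq b' v' b pair_code_inj[of v' n v] by auto
    qed
    then show "((L(k * M + p := w)) ?u, v') \<in> I - {(e, v)}" "d ((L(k * M + p := w)) ?u) = q"
           "(P(w * n + v := p)) ((L(k * M + p := w)) ?u * n + v') = k'" by blast+
  qed
qed

text \<open>The free cell \<open>c < M\<close> exists because the old entries together with
  \<open>e\<close> are distinct numbers below \<open>M\<close>.\<close>

lemma edge_lists_add:
  assumes l: "edge_lists n M I d C L P" and ev: "(e, v) \<notin> I" and e: "e < M" and v: "v < n"
    and k: "k = d e * n + v" and c: "c = C k"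
  shows "edge_lists n M (insert (e, v) I) d (C(k := Suc c)) (L(k * M + c := e)) (P(e * n + v := c))" "c < M"
proof -
  have l1: "v < n" "e < M" "P (e * n + v) < C (d e * n + v)" "L ((d e * n + v) * M + P (e * n + v)) = e" if "(e, v) \<in> I" for e v
    using l that by (auto simp: edge_lists_def)
  have l2: "(L ((q * n + v) * M + k), v) \<in> I" "d (L ((q * n + v) * M + k)) = q" "P (L ((q * n + v) * M + k) * n + v) = k"
    if "v < n" "k < C (q * n + v)" for q v k
    using l that by (auto simp: edge_lists_def)
  note lc = edge_lists_count[OF l]
  have CM: "C (q * n + v) \<le> M" if "v < n" for q v using lc(4)[OF that] .
  show cM: "c < M"
  proof -
    have "insert e {e'. (e', v) \<in> I \<and> d e' = d e} \<subseteq> {..<M}" using lc(3)[OF v, of "d e"] e by auto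
    then have "card (insert e {e'. (e', v) \<in> I \<and> d e' = d e}) \<le> M" using card_mono[of "{..<M}"] by fastforce
    moreover have "finite {e'. (e', v) \<in> I \<and> d e' = d e}" using lc(3)[OF v, of "d e"] finite_subset by blast
    ultimately show ?thesis using ev lc(1)[OF v, of "d e"] c k by simp
  qed
  show "edge_lists n M (insert (e, v) I) d (C(k := Suc c)) (L(k * M + c := e)) (P(e * n + v := c))"
    unfolding edge_lists_def
  proof (intro conjI allI impI)
    fix e' v' assume a: "(e', v') \<in> insert (e, v) I"
    show v'n: "v' < n" and "e' < M" using a l1 e v by auto
    show "(P(e * n + v := c)) (e' * n + v') < (C(k := Suc c)) (d e' * n + v')"
    proof (cases "e' = e \<and> v' = v")
      case False
      then show ?thesis using a l1(3)[of e' v'] pair_code_inj[OF v'n v] c by (auto simp: less_Suc_eq)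
    qed (simp add: k)
    show "(L(k * M + c := e)) ((d e' * n + v') * M + (P(e * n + v := c)) (e' * n + v')) = e'"
    proof (cases "e' = e \<and> v' = v")
      case False
      then have b': "P (e' * n + v') < C (d e' * n + v')" "L ((d e' * n + v') * M + P (e' * n + v')) = e'"
        using a l1 by auto
      have "(d e' * n + v') * M + P (e' * n + v') \<noteq> k * M + c"
      proof
        assume "(d e' * n + v') * M + P (e' * n + v') = k * M + c"
        moreover have "P (e' * n + v') < M" using b'(1) CM[OF v'n, of "d e'"] by auto
        ultimately have "d e' * n + v' = k" "P (e' * n + v') = c" using cM by (simp_all add: pair_code_inj)
        then show False using b' c by auto
      qed
      then show ?thesis using False b' pair_code_inj[OF v'n v] by auto
    qed (simp add: k)
  next
    fix v' q k' assume v': "v' < n" and k': "k' < (C(k := Suc c)) (q * n + v')"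
    let ?u = "(q * n + v') * M + k'"
    have "k' < M" using k' CM[OF v', of q] cM by (auto split: if_splits)
    then have eq: "?u = k * M + c \<longleftrightarrow> q * n + v' = k \<and> k' = c" using pair_code_inj cM by auto
    have "(((L(k * M + c := e)) ?u, v') \<in> insert (e, v) I \<and> d ((L(k * M + c := e)) ?u) = q \<and>
           (P(e * n + v := c)) ((L(k * M + c := e)) ?u * n + v') = k')"
    proof (cases "q * n + v' = k \<and> k' = c")
      case True
      then have t: "q = d e" "v' = v" using pair_code_inj v' v k by auto
      then show ?thesis using True eq by auto
    next
      case False
      then have k'C: "k' < C (q * n + v')" using k' c by (auto split: if_splits)
      note b' = l2[OF v' k'C]
      have "\<not> (L ?u = e \<and> v' = v)" using b'(1) ev by auto
      then show ?thesis using False eq b' pair_code_inj[OF v' v] by auto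
    qed
    then show "((L(k * M + c := e)) ?u, v') \<in> insert (e, v) I" "d ((L(k * M + c := e)) ?u) = q"
           "(P(e * n + v := c)) ((L(k * M + c := e)) ?u * n + v') = k'" by blast+
  qed
qed

text \<open>Permits overwriting the value of a hyperedge while it is in no list.\<close>

lemma edge_lists_cong:
  assumes "\<And>e v. (e, v) \<in> I \<Longrightarrow> d' e = d e" "edge_lists n M I d C L P"
  shows "edge_lists n M I d' C L P"
proof -
  have "d' (L ((q * n + v) * M + k)) = q" if "v < n" "k < C (q * n + v)" for v q k
    using assms that unfolding edge_lists_def by metis
  then show ?thesis using assms unfolding edge_lists_def by auto
qed

lemma pow4_dvd: "(a::nat) = 4 ^ i \<Longrightarrow> b = 4 ^ j \<Longrightarrow> a \<le> b \<Longrightarrow> a dvd b"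
  by (simp add: le_imp_power_dvd)

lemma stored_weights_cong: "(\<And>e v. (e, v) \<in> I \<Longrightarrow> d' e = d e) \<Longrightarrow> stored_weights n M I d N D \<Longrightarrow> stored_weights n M I d' N D"
proof -
  assume d: "\<And>e v. (e, v) \<in> I \<Longrightarrow> d' e = d e" and w: "stored_weights n M I d N D"
  have "(\<Sum>e | (e, v) \<in> I. Suc (D v) div d e) = (\<Sum>e | (e, v) \<in> I. Suc (D v) div d' e)" for v
    by (rule sum.cong) (use d in auto)
  then show ?thesis using w d unfolding stored_weights_def by auto
qed

lemma stored_weights_remove:
  assumes w: "stored_weights n M I d N D" and ev: "(e, v) \<in> I" and fin: "finite {e. (e, v) \<in> I}"
  shows "stored_weights n M (I - {(e, v)}) d (N(v := N v - Suc (D v) div d e)) D"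
proof -
  have "{e'. (e', v') \<in> I - {(e, v)}} = (if v' = v then {e'. (e', v) \<in> I} - {e} else {e'. (e', v') \<in> I})" for v' by auto
  then have "(\<Sum>e' | (e', v') \<in> I - {(e, v)}. Suc (D v') div d e') = (\<Sum>e' | (e', v') \<in> I. Suc (D v') div d e') - (if v' = v then Suc (D v) div d e else 0)" for v'
    using ev fin by (auto simp: sum_diff1_nat)
  then show ?thesis using w unfolding stored_weights_def by auto
qed

lemma stored_weights_add:
  assumes w: "stored_weights n M I d N D" and ev: "(e, v) \<notin> I" and fin: "finite {e. (e, v) \<in> I}"
    and de: "d e = 4 ^ i" "d e \<le> Suc (D v)"
  shows "stored_weights n M (insert (e, v) I) d (N(v := N v + Suc (D v) div d e)) D"
proof -
  have "{e'. (e', v') \<in> insert (e, v) I} = (if v' = v then insert e {e'. (e', v) \<in> I} else {e'. (e', v') \<in> I})" for v' by auto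
  then have "(\<Sum>e' | (e', v') \<in> insert (e, v) I. Suc (D v') div d e') = (\<Sum>e' | (e', v') \<in> I. Suc (D v') div d e') + (if v' = v then Suc (D v) div d e else 0)" for v'
    using ev fin by auto
  then show ?thesis using w de unfolding stored_weights_def by auto
qed

text \<open>Every value at \<open>v\<close> divides the old denominator, and this divides the new
  one, all being powers of 4. So multiplying the numerator commutes with the integer
  quotients.\<close>

lemma stored_weights_rescale:
  assumes w: "stored_weights n M I d N D" and de: "d e = 4 ^ i" "Suc (D v) < d e" "d e \<le> 4 * M"
  shows "stored_weights n M I d (N(v := N v * (d e div Suc (D v)))) (D(v := d e - 1))"
  unfolding stored_weights_def
proof (intro allI impI)
  fix v' assume v': "v' < n"
  note w' = w[unfolded stored_weights_def, rule_format, OF v']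
  show "(\<exists>i. Suc ((D(v := d e - 1)) v') = 4 ^ i) \<and> Suc ((D(v := d e - 1)) v') \<le> 4 * M \<and>
     (\<forall>e'. (e', v') \<in> I \<longrightarrow> (\<exists>i. d e' = 4 ^ i) \<and> d e' \<le> Suc ((D(v := d e - 1)) v')) \<and>
     (N(v := N v * (d e div Suc (D v)))) v' = (\<Sum>e' | (e', v') \<in> I. Suc ((D(v := d e - 1)) v') div d e')"
  proof (cases "v' = v")
    case True
    obtain j where j: "Suc (D v) = 4 ^ j" using w' True by auto
    have pos: "Suc (d e - 1) = d e" using de(2) by simp
    have div: "Suc (D v) div d e' * (d e div Suc (D v)) = d e div d e'" if i: "(e', v) \<in> I" for e'
    proof -
      obtain i' where "d e' = 4 ^ i'" "d e' \<le> Suc (D v)" using w' True i by auto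
      then have 1: "d e' dvd Suc (D v)" using pow4_dvd j by blast
      have 2: "Suc (D v) dvd d e" using pow4_dvd[OF j de(1)] de by simp
      obtain x y where "Suc (D v) = d e' * x" "d e = Suc (D v) * y" using 1 2 by (meson dvdE)
      moreover have pos': "0 < d e'" using \<open>d e' = 4 ^ i'\<close> by simp
      ultimately have "d e = d e' * (x * y)" by simp
      then have "d e div d e' = x * y" using pos' by simp
      moreover have "Suc (D v) div d e' = x" using \<open>Suc (D v) = d e' * x\<close> pos' by simp
      moreover have "d e div Suc (D v) = y" using \<open>d e = Suc (D v) * y\<close>
        by (metis nonzero_mult_div_cancel_left nat.distinct(1))
      ultimately show ?thesis by metis
    qed
    have "N v * (d e div Suc (D v)) = (\<Sum>e' | (e', v) \<in> I. Suc (D v) div d e' * (d e div Suc (D v)))"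
      using w' True by (simp add: sum_distrib_right)
    also have "\<dots> = (\<Sum>e' | (e', v) \<in> I. d e div d e')"
      by (rule sum.cong[OF refl], rule div) simp
    finally have sum: "N v * (d e div Suc (D v)) = (\<Sum>e' | (e', v) \<in> I. d e div d e')" .
    have "\<forall>e'. (e', v) \<in> I \<longrightarrow> (\<exists>i. d e' = 4 ^ i) \<and> d e' \<le> d e"
    proof (intro allI impI)
      fix e' assume "(e', v) \<in> I"
      then have "(\<exists>i. d e' = 4 ^ i) \<and> d e' \<le> Suc (D v)" using w' True by blast
      then show "(\<exists>i. d e' = 4 ^ i) \<and> d e' \<le> d e" using de(2) by (meson less_imp_le order_trans)
    qed
    moreover have "\<exists>i. d e = 4 ^ i" using de(1) by (rule exI)
    ultimately show ?thesis unfolding True fun_upd_same pos by (intro conjI de(3) sum)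
  qed (use w' in auto)
qed

lemma stored_weights_bound:
  assumes w: "stored_weights n M I d N D" and v: "v < n" and I: "{e. (e, v) \<in> I} \<subseteq> {..<M}"
  shows "N v \<le> M * Suc (D v)"
proof -
  have "N v = (\<Sum>e | (e, v) \<in> I. Suc (D v) div d e)" using w v by (auto simp: stored_weights_def)
  also have "\<dots> \<le> (\<Sum>e | (e, v) \<in> I. Suc (D v))" by (rule sum_mono) simp
  also have "\<dots> = card {e. (e, v) \<in> I} * Suc (D v)" by simp
  also have "\<dots> \<le> M * Suc (D v)" using card_mono[OF _ I] by (intro mult_right_mono) auto
  finally show ?thesis .
qed

section \<open>Detaching and attaching a hyperedge\<close>

definition core :: "nat \<Rightarrow> nat \<Rightarrow> (nat \<times> nat) set \<Rightarrow> mem \<Rightarrow> bool" where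
  "core n M I s \<longleftrightarrow> edge_lists n M I (s 4) (s 5) (s 6) (s 7) \<and> stored_weights n M I (s 4) (s 8) (s 9)"

definition header :: "nat \<Rightarrow> nat \<Rightarrow> mem \<Rightarrow> bool" where
  "header n M s \<longleftrightarrow> s 0 0 = n \<and> s 16 0 = M"

definition frame :: "nat set \<Rightarrow> mem \<Rightarrow> mem \<Rightarrow> bool" where
  "frame A s s' \<longleftrightarrow> (\<forall>a. a \<notin> A \<longrightarrow> s' a = s a)"

lemma frame_refl: "frame A s s" by (simp add: frame_def)

lemma frame_trans: "frame A s s' \<Longrightarrow> frame A' s' s'' \<Longrightarrow> A \<subseteq> A'' \<Longrightarrow> A' \<subseteq> A'' \<Longrightarrow> frame A'' s s''"
  unfolding frame_def by (metis subsetD)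

lemma frameD: "frame A s s' \<Longrightarrow> a \<notin> A \<Longrightarrow> s' a = s a" by (simp add: frame_def)

lemma core_frame: "frame A s s' \<Longrightarrow> A \<inter> {4,5,6,7,8,9} = {} \<Longrightarrow> core n M I s' = core n M I s"
  unfolding core_def by (subst (1 2 3 4 5 6 7) frameD[of A s s'], auto)

lemma header_frame: "frame A s s' \<Longrightarrow> 0 \<notin> A \<Longrightarrow> 16 \<notin> A \<Longrightarrow> header n M s' = header n M s"
  unfolding header_def by (simp add: frameD)

lemma stack_frame: "frame A s s' \<Longrightarrow> A \<inter> {a, Suc a, Suc (Suc a)} = {} \<Longrightarrow> stack n a X s' = stack n a X s"
  by (rule stack_cong; rule frameD; auto)

abbreviation attach_arrays :: "nat set" where
  "attach_arrays \<equiv> {3,4,5,6,7,8,9,10,11,12,18,19,20,28}"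

abbreviation detach_arrays :: "nat set" where
  "detach_arrays \<equiv> {5,6,7,8,13,14,15,18,19,20,22,23}"

text \<open>\<open>M\<close> bounds the codes of hyperedges, and \<open>1 / (4 * G)\<close> is the
  threshold for a move down. The bound on \<open>B\<close> leaves room for list addresses of order
  \<open>M ^ 3\<close> and for the threshold test, which multiplies a numerator of order
  \<open>M ^ 2\<close> by \<open>4 * G\<close>.\<close>

locale machine =
  fixes n M G B :: nat
  assumes n_pos: "0 < n" and n_M: "n < M" and G_pos: "0 < G" and B: "64 * G * M ^ 3 < B"
begin

lemma bound6: "x \<le> 16 * M ^ 3 \<Longrightarrow> x < B"
proof -
  have "1 * M ^ 3 \<le> G * M ^ 3" using G_pos by (intro mult_right_mono) auto
  then show "x \<le> 16 * M ^ 3 \<Longrightarrow> x < B" using B unfolding mult.assoc by linarith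
qed

lemma M_pos: "0 < M" using n_M by simp

lemma M_powers: "M \<le> M ^ 2" "M ^ 2 \<le> M ^ 3" "1 \<le> M" "M * M = M ^ 2" "M ^ 2 * M = M ^ 3"
  using M_pos by (auto simp: power2_eq_square power3_eq_cube)

lemma small: "x \<le> 4 * M \<Longrightarrow> x < B" "M < B" "n < B" "1 < B" "0 < B" "Suc 0 < B" "n + 2 < B" "x < M \<Longrightarrow> x < B" "x < n \<Longrightarrow> x < B"
proof -
  have "M \<le> M ^ 3" using M_powers(1,2) by linarith
  then show "x \<le> 4 * M \<Longrightarrow> x < B" "M < B" "n < B" "1 < B" "0 < B" "Suc 0 < B" "n + 2 < B" "x < M \<Longrightarrow> x < B" "x < n \<Longrightarrow> x < B"
    using n_M by (auto intro!: bound6)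
qed

text \<open>Values are allowed up to \<open>4 * M\<close> because a node can move up only from a
  value of at most \<open>M\<close>.\<close>

lemma code_small:
  assumes "q \<le> 4 * M" "v < n"
  shows "q * n < B" "q * n + v < B" "(q * n + v) * M < B" "k \<le> M \<Longrightarrow> (q * n + v) * M + k < B"
proof -
  have "q * n \<le> 4 * M * M" using assms n_M by (intro mult_le_mono) auto
  then have 1: "q * n \<le> 4 * M ^ 2" by (simp add: power2_eq_square)
  then have 2: "q * n + v \<le> 5 * M ^ 2" using assms n_M M_powers(1) by linarith
  then have "(q * n + v) * M \<le> 5 * M ^ 2 * M" by (rule mult_right_mono) simp
  then have 3: "(q * n + v) * M \<le> 5 * M ^ 3" by (simp add: power2_eq_square power3_eq_cube)
  show "q * n < B" "q * n + v < B" "(q * n + v) * M < B" "k \<le> M \<Longrightarrow> (q * n + v) * M + k < B"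
    using 1 2 3 M_powers by (auto intro!: bound6)
qed

lemma core_finite: "core n M I s \<Longrightarrow> {e. (e, v) \<in> I} \<subseteq> {..<M}" "core n M I s \<Longrightarrow> finite {e. (e, v) \<in> I}"
proof -
  show "core n M I s \<Longrightarrow> {e. (e, v) \<in> I} \<subseteq> {..<M}" by (auto simp: core_def edge_lists_def)
  then show "core n M I s \<Longrightarrow> finite {e. (e, v) \<in> I}" using finite_subset by blast
qed

lemma stored_weights_small:
  assumes "core n M I s" "v < n"
  shows "s 8 v < B" "Suc (s 9 v) < B" "Suc (s 9 v) \<le> 4 * M" "s 8 v * (4 * G) < B"
proof -
  have w: "Suc (s 9 v) \<le> 4 * M" "s 8 v \<le> M * Suc (s 9 v)"
    using assms stored_weights_bound[of n M I "s 4" "s 8" "s 9" v] core_finite[OF assms(1)]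
    by (auto simp: core_def stored_weights_def)
  show "Suc (s 9 v) \<le> 4 * M" by fact
  then show "Suc (s 9 v) < B" by (rule small)
  have "s 8 v \<le> M * (4 * M)" using w by (meson le_trans mult_le_mono2)
  then have 1: "s 8 v \<le> 4 * M ^ 2" by (simp add: power2_eq_square)
  then show "s 8 v < B" using M_powers by (intro bound6) auto
  have "s 8 v \<le> 4 * M ^ 3" using 1 M_powers by linarith
  then have "s 8 v * (4 * G) \<le> 4 * M ^ 3 * (4 * G)" by (rule mult_right_mono) simp
  also have "\<dots> \<le> 64 * G * M ^ 3" by simp
  finally show "s 8 v * (4 * G) < B" using B by (rule le_less_trans)
qed

lemma remove_pair_ok:
  assumes core: "core n M I s" and hdr: "header n M s" and ev: "(e, v) \<in> I"
    and s: "s 17 0 = e" "s 19 0 = v" and st: "stack n 13 X s"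
  shows "ok B remove_pair s 200 (\<lambda>s' _. core n M (I - {(e, v)}) s' \<and> stack n 13 (insert v X) s' \<and>
     frame {5,6,7,8,13,14,15,20,22,23} s s')"
proof -
  have l: "edge_lists n M I (s 4) (s 5) (s 6) (s 7)" and w: "stored_weights n M I (s 4) (s 8) (s 9)" using core by (auto simp: core_def)
  have v: "v < n" and eM: "e < M" using l ev by (auto simp: edge_lists_def)
  have d: "s 4 e \<le> Suc (s 9 v)" using w v ev by (auto simp: stored_weights_def)
  note ws = stored_weights_small[OF core v]
  have d4: "s 4 e \<le> 4 * M" using d ws(3) by linarith
  define k where "k = s 4 e * n + v"
  define c where "c = s 5 k - Suc 0"
  define u where "u = s 6 (k * M + c)"
  define p where "p = s 7 (e * n + v)"
  have Ck: "s 5 k \<le> M" using edge_lists_count(4)[OF l v, of "s 4 e"] by (simp add: k_def)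
  have pc: "p < s 5 k" using l ev by (auto simp: edge_lists_def k_def p_def)
  then have cC: "c < s 5 k" by (simp add: c_def)
  have uM: "u < M"
  proof -
    have "(u, v) \<in> I" using l v cC by (auto simp: edge_lists_def u_def k_def)
    then show ?thesis using l by (auto simp: edge_lists_def)
  qed
  note cs = code_small[OF d4 v, folded k_def]
  have e4: "e \<le> 4 * M" "u \<le> 4 * M" using eM uM by auto
  note fits = small(1)[OF d4] cs(1-3) cs(4)[of c] cs(4)[of p] code_small(1,2)[OF e4(1) v] code_small(1,2)[OF e4(2) v]
     ws(1,2) Suc_lessD[OF ws(2)] small(2-6) small(8)[OF eM] small(8)[OF uM] small(9)[OF v]
  have cpM: "c \<le> M" "p \<le> M" "c < B" "p < B" "s 5 k < B" "s 5 k - Suc 0 < B"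
    using cC pc Ck small(2) by auto
  have dv: "Suc (s 9 v) div s 4 e < B" using ws(2) by (meson div_le_dividend le_less_trans)
  have sv: "s 8 v - Suc (s 9 v) div s 4 e < B" using ws(1) by simp
  have st': "stack n 13 X (s(20 := (s 20)(0 := k), 5 := (s 5)(k := c), 22 := (s 22)(0 := u), 23 := (s 23)(0 := p),
      6 := (s 6)(k * M + p := u), 7 := (s 7)(u * n + v := p), 8 := (s 8)(v := s 8 v - Suc (s 9 v) div s 4 e)))" (is "stack n 13 X ?s")
    using st by (simp cong: stack_cong add: stack_def)
  have core': "core n M (I - {(e, v)}) ?s"
    using edge_lists_remove[OF l ev k_def c_def[folded One_nat_def] u_def p_def] stored_weights_remove[OF w ev core_finite(2)[OF core]]
    unfolding core_def by simp
  have "ok B (push 13) ?s 20 (\<lambda>s' _. stack n 13 (insert v X) s' \<and> (\<forall>b. b \<noteq> 13 \<longrightarrow> b \<noteq> 14 \<longrightarrow> b \<noteq> 15 \<longrightarrow> s' b = ?s b))"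
    using push_ok[OF st', of B] s v small(7) by simp
  then have push: "ok B (push 13) ?s T (\<lambda>s' _. core n M (I - {(e, v)}) s' \<and> stack n 13 (insert v X) s' \<and>
     frame {5,6,7,8,13,14,15,20,22,23} s s')" if "20 \<le> T" for T
    by (rule ok_call[OF _ that]) (use core' in \<open>auto simp: core_def frame_def\<close>)
  show ?thesis
    using hdr s unfolding header_def
    by (simp add: remove_pair_def key_def slot_def ok_simps fits cpM dv sv
      k_def[symmetric] c_def[symmetric] u_def[symmetric] p_def[symmetric] push)
qed


lemma add_pair_ok:
  assumes core: "core n M I s" and hdr: "header n M s" and ev: "(e, v) \<notin> I" and eM: "e < M" and v: "v < n"
    and de: "s 4 e = 4 ^ i" and d4: "s 4 e \<le> 4 * M"
    and s: "s 17 0 = e" "s 19 0 = v" and st: "stack n 10 X s"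
  shows "ok B add_pair s 200 (\<lambda>s' _. core n M (insert (e, v) I) s' \<and> stack n 10 (insert v X) s' \<and>
     frame {5,6,7,8,9,10,11,12,20} s s')"
proof -
  have l: "edge_lists n M I (s 4) (s 5) (s 6) (s 7)" and w: "stored_weights n M I (s 4) (s 8) (s 9)" using core by (auto simp: core_def)
  note ws = stored_weights_small[OF core v]
  define k where "k = s 4 e * n + v"
  define c where "c = s 5 k"
  note la = edge_lists_add[OF l ev eM v k_def c_def]
  have cM: "c < M" by (rule la)
  note cs = code_small[OF d4 v, folded k_def]
  have e4: "e \<le> 4 * M" using eM by auto
  note fits = small(1)[OF d4] cs(1-3) cs(4)[of c] code_small(1,2)[OF e4 v]
     ws(1,2) Suc_lessD[OF ws(2)] small(2-6) small(8)[OF eM] small(9)[OF v]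
  have cM': "c \<le> M" "c < B" "Suc c < B"
    using cM small(2) by auto
  have d0: "0 < s 4 e" using de by simp
  note fin = core_finite(2)[OF core]
  have push: "ok B (push 10) s' T (\<lambda>s' _. core n M (insert (e, v) I) s' \<and> stack n 10 (insert v X) s' \<and>
      frame {5,6,7,8,9,10,11,12,20} s s')"
    if "20 \<le> T" "frame {5,6,7,8,9,20} s s'" "core n M (insert (e, v) I) s'" for T s'
  proof (rule ok_call[OF _ that(1)])
    show "ok B (push 10) s' 20 (\<lambda>s'' _. stack n 10 (insert v X) s'' \<and> (\<forall>b. b \<noteq> 10 \<longrightarrow> b \<noteq> 11 \<longrightarrow> b \<noteq> 12 \<longrightarrow> s'' b = s' b))"
      using push_ok[of n 10 X s' B] st s v small(7) that(2) stack_frame[OF that(2), of 10] frameD[OF that(2), of 19] by simp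
  qed (use that in \<open>auto simp: core_def frame_def\<close>)
  show ?thesis
  proof (cases "Suc (s 9 v) < s 4 e")
    case True
    define N where "N = s 8 v * (s 4 e div Suc (s 9 v))"
    note wr = stored_weights_rescale[OF w de True d4, folded N_def]
    have pd: "Suc (s 4 e - Suc 0) = s 4 e" "s 4 e div s 4 e = 1" using d0 by auto
    \<comment> \<open>The general bound on numerators is applied to the rescaled state; there the
      new hyperedge contributes the summand 1.\<close>
    have "N \<le> M * s 4 e"
      using stored_weights_bound[OF wr v core_finite(1)[OF core]] pd by simp
    also have "\<dots> \<le> M * (4 * M)" using d4 by (rule mult_le_mono2)
    finally have "Suc N \<le> 16 * M ^ 3" using M_powers by simp
    then have NB: "Suc N < B" "N < B" using bound6 Suc_lessD by blast+
    have db: "s 4 e div Suc (s 9 v) < B" using small(1)[OF d4] by (meson div_le_dividend le_less_trans)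
    have db2: "s 4 e - Suc 0 < B" using small(1)[OF d4] by simp
    have wa: "stored_weights n M (insert (e, v) I) (s 4) ((s 8)(v := Suc N)) ((s 9)(v := s 4 e - Suc 0))"
      using stored_weights_add[OF wr ev fin de] pd by simp
    show ?thesis
      using hdr s True unfolding header_def
      apply (simp add: add_pair_def key_def slot_def ok_simps fits cM' k_def[symmetric] c_def[symmetric] N_def[symmetric] NB db db2 pd d0)
      apply (rule push)
      using la(1) wa by (simp_all add: frame_def core_def)
  next
    case False
    have "s 8 v \<le> M * Suc (s 9 v)" by (rule stored_weights_bound[OF w v core_finite(1)[OF core]])
    also have "\<dots> \<le> M * (4 * M)" using ws(3) by (rule mult_le_mono2)
    finally have "s 8 v \<le> 4 * M ^ 2" by (simp add: power2_eq_square)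
    moreover have "Suc (s 9 v) div s 4 e \<le> 4 * M" using ws(3) by (meson div_le_dividend le_trans)
    ultimately have "s 8 v + Suc (s 9 v) div s 4 e \<le> 16 * M ^ 3" "Suc (s 9 v) div s 4 e \<le> 16 * M ^ 3" using M_powers by linarith+
    then have NB: "s 8 v + Suc (s 9 v) div s 4 e < B" "Suc (s 9 v) div s 4 e < B" by (simp_all add: bound6)
    have wa: "stored_weights n M (insert (e, v) I) (s 4) ((s 8)(v := s 8 v + Suc (s 9 v) div s 4 e)) (s 9)"
      using stored_weights_add[OF w ev fin de] False by simp
    show ?thesis
      using hdr s False unfolding header_def
      apply (simp add: add_pair_def key_def slot_def ok_simps fits cM' k_def[symmetric] c_def[symmetric] NB d0)
      apply (rule push)
      using la(1) wa by (simp_all add: frame_def core_def)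
  qed
qed

end

section \<open>Decoding a hyperedge code into its nodes\<close>

function digs :: "nat \<Rightarrow> nat \<Rightarrow> nat list" where
  "digs n r = (if r = 0 \<or> n = 0 then [] else (r mod Suc n - Suc 0) # digs n (r div Suc n))"
  by auto
termination by (relation "measure snd") auto

declare digs.simps [simp del]

lemma digs_Suc: "0 < n \<Longrightarrow> 0 < r \<Longrightarrow> digs n r = (r mod Suc n - Suc 0) # digs n (r div Suc n)"
  by (simp add: digs.simps)

lemma digs_0: "digs n 0 = []" by (simp add: digs.simps)

text \<open>Truncated subtraction sends a digit 0 to node 0, so this holds for every number and not
  only for codes of hyperedges.\<close>

lemma set_digs: "set (digs n r) \<subseteq> {..<n}"
proof (induction n r rule: digs.induct)
  case (1 n r)
  have "0 < n \<Longrightarrow> r mod Suc n - Suc 0 < n"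
    using mod_less_divisor[of "Suc n" r] by linarith
  then show ?case using 1 by (subst digs.simps) auto
qed

lemma digs_horner: "set xs \<subseteq> {..<n} \<Longrightarrow> digs n (horner_sum Suc (Suc n) xs) = xs"
proof (induction xs)
  case (Cons x xs)
  have "(Suc x + Suc n * b) mod Suc n = Suc x" "(Suc x + Suc n * b) div Suc n = b" for b
    using Cons.prems by (simp_all del: add_Suc mult_Suc)
  then show ?case using Cons by (simp add: digs_Suc del: mult_Suc)
qed (simp add: digs_0)

lemma horner_less: "set xs \<subseteq> {..<n} \<Longrightarrow> horner_sum Suc (Suc n) xs < Suc n ^ length xs"
proof (induction xs)
  case (Cons x xs)
  then have "Suc (horner_sum Suc (Suc n) xs) \<le> Suc n ^ length xs" by simp
  then have "Suc n * Suc (horner_sum Suc (Suc n) xs) \<le> Suc n * Suc n ^ length xs" by (rule mult_le_mono2)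
  moreover have "x < n" using Cons.prems by simp
  ultimately show ?case by simp
qed simp

text \<open>Exposes one iteration, for loops verified by induction on a number in memory instead of
  by an invariant on the credit.\<close>

lemma ok_WHILE_unfold:
  assumes "fits B b s" "if aval b s \<noteq> 0 then ok B c s (T - real (acost b + 1)) (\<lambda>s' T'. ok B (WHILE b c) s' T' Q)
       else real (acost b + 1) \<le> T \<and> Q s (T - real (acost b + 1))"
  shows "ok B (WHILE b c) s T Q"
proof (cases "aval b s = 0")
  case True
  then show ?thesis using assms unfolding ok_def by (auto intro!: exI[of _ "acost b + 1"] exI[of _ s] intro: exec.WhileFalse)
next
  case False
  then obtain t1 s1 t2 s2 where "exec B c s t1 s1" "real t1 \<le> T - real (acost b + 1)" "exec B (WHILE b c) s1 t2 s2"
    "real t2 \<le> T - real (acost b + 1) - real t1" "Q s2 (T - real (acost b + 1) - real t1 - real t2)"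
    using assms(2) by (auto simp: ok_def)
  then show ?thesis using exec.WhileTrue[OF assms(1) False] unfolding ok_def
    by (intro exI[of _ "acost b + 1 + t1 + t2"] exI[of _ s2]) (auto simp: algebra_simps)
qed

text \<open>The nodes are read off the code itself, digit by digit in base \<open>n + 1\<close>, so
  node lists of hyperedges need not be stored.\<close>

definition for_nodes :: "com \<Rightarrow> com" where
  "for_nodes c = SEQ (WRITE 18 (Const 0) (var 17)) (WHILE (var 18)
     (SEQ (WRITE 19 (Const 0) (Op Sub (Op Mod (var 18) (Op Add (var 0) (Const 1))) (Const 1)))
     (SEQ (WRITE 18 (Const 0) (Op Div (var 18) (Op Add (var 0) (Const 1)))) c)))"

text \<open>Array 28 accumulates the maximal value among the nodes, starting from 1, the value of
  level 0. The weight is stored as 1 over that maximum.\<close>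

definition attach :: com where
  "attach = SEQ (WRITE 28 (Const 0) (Const 1))
    (SEQ (for_nodes (IF (Op Less (var 28) (Op Add (Read 2 (var 19)) (Const 1)))
                        (WRITE 28 (Const 0) (Op Add (Read 2 (var 19)) (Const 1))) SKIP))
    (SEQ (WRITE 4 (var 17) (var 28))
    (SEQ (WRITE 3 (var 17) (Const 1))
         (for_nodes add_pair))))"

context machine
begin

text \<open>\<open>J\<close> is indexed by the nodes still to come. It has to tolerate changes of
  arrays 18 and 19, the remaining code and the current node, since the loop itself writes
  them.\<close>

lemma for_nodes_ok:
  assumes inv: "\<And>vs s. J vs s \<Longrightarrow> s 0 0 = n \<and> s 17 0 = e"
    and stable: "\<And>vs s s'. J vs s \<Longrightarrow> frame {18,19} s s' \<Longrightarrow> J vs s'"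
    and body: "\<And>v vs s. J (v # vs) s \<Longrightarrow> v < n \<Longrightarrow> s 19 0 = v \<Longrightarrow>
       ok B c s k (\<lambda>s' _. J vs s' \<and> s' 18 0 = s 18 0)"
    and init: "J (digs n e) s" and e: "e < M" and k: "0 \<le> k"
  shows "ok B (for_nodes c) s ((k + 30) * real (length (digs n e)) + 10) (\<lambda>s' _. J [] s')"
proof -
  let ?body = "SEQ (WRITE 19 (Const 0) (Op Sub (Op Mod (var 18) (Op Add (var 0) (Const 1))) (Const 1)))
     (SEQ (WRITE 18 (Const 0) (Op Div (var 18) (Op Add (var 0) (Const 1)))) c)"
  have loop: "ok B (WHILE (var 18) ?body) s ((k + 30) * real (length (digs n r)) + 4) (\<lambda>s' _. J [] s')"
    if "J (digs n r) s" "s 18 0 = r" "r < B" for r s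
    using that
  proof (induction r arbitrary: s rule: less_induct)
    case (less r)
    have s0: "s 0 0 = n" "s 17 0 = e" using inv less.prems(1) by auto
    show ?case
    proof (cases "r = 0")
      case True
      then show ?thesis using less.prems by (intro ok_WHILE_unfold) (auto simp: digs_0 small)
    next
      case False
      define v where "v = r mod Suc n - Suc 0"
      define r' where "r' = r div Suc n"
      have ds: "digs n r = v # digs n r'" using digs_Suc[OF n_pos, of r] False by (simp add: v_def r'_def)
      then have v: "v < n" using set_digs[of n r] by auto
      have r': "r' < r" using False n_pos by (simp add: r'_def)
      have b: "r mod Suc n < B" "Suc n < B" "v < B" "r' < B"
        using less.prems(3) small v r' by (auto intro: le_less_trans[OF mod_less_eq_dividend])
      let ?s = "s(19 := (s 19)(0 := v), 18 := (s 18)(0 := r'))"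
      let ?T = "(k + 30) * real (length (digs n r')) + 4"
      have "J (v # digs n r') ?s" using stable[OF less.prems(1), of ?s] ds by (simp add: frame_def)
      then have "ok B c ?s k (\<lambda>s' _. J (digs n r') s' \<and> s' 18 0 = ?s 18 0)" using v by (intro body) auto
      then have "ok B c ?s T (\<lambda>s' T'. ok B (WHILE (var 18) ?body) s' T' (\<lambda>s' _. J [] s'))" if T: "k + ?T \<le> T" for T
      proof (rule ok_call)
        fix s' T' assume "J (digs n r') s' \<and> s' 18 0 = ?s 18 0" "T - k \<le> T'"
        then show "ok B (WHILE (var 18) ?body) s' T' (\<lambda>s' _. J [] s')"
          using T b less.IH[OF r', of s'] by (intro ok_call[OF less.IH[OF r', of s']]) auto
      next
        have "0 \<le> (k + 30) * real (length (digs n r'))" using k by simp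
        then show "k \<le> T" using T by linarith
      qed
      then show ?thesis
        using less.prems s0 False
        by (intro ok_WHILE_unfold) (simp_all add: ok_simps small b v_def[symmetric] r'_def[symmetric] ds add_nonneg_nonneg k algebra_simps)
    qed
  qed
  have "J (digs n e) (s(18 := (s 18)(0 := e)))" using stable[OF init] by (simp add: frame_def)
  then show ?thesis
    unfolding for_nodes_def ok_SEQ ok_WRITE
    by (intro conjI ok_call[OF loop[of e]])
      (use inv[OF init] small(8)[OF e] k in \<open>auto simp: small add_nonneg_nonneg\<close>)
qed


lemma detach_ok:
  assumes core: "core n M I s" and hdr: "header n M s" and eM: "e < M" and dist: "distinct (digs n e)"
    and sub: "{e} \<times> set (digs n e) \<subseteq> I" and s: "s 17 0 = e" and st: "stack n 13 X s"
  shows "ok B (for_nodes remove_pair) s (230 * real (length (digs n e)) + 10) (\<lambda>s' _. core n M (I - {e} \<times> set (digs n e)) s' \<and>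
     stack n 13 (X \<union> set (digs n e)) s' \<and> frame detach_arrays s s')"
proof -
  let ?D = "set (digs n e)"
  \<comment> \<open>\<open>?D - set vs\<close> are the nodes already processed.\<close>
  let ?J = "\<lambda>vs s'. distinct vs \<and> set vs \<subseteq> ?D \<and> core n M (I - {e} \<times> (?D - set vs)) s' \<and>
     stack n 13 (X \<union> (?D - set vs)) s' \<and> frame detach_arrays s s'"
  have "ok B (for_nodes remove_pair) s ((200 + 30) * real (length (digs n e)) + 10) (\<lambda>s' _. ?J [] s')"
  proof (rule for_nodes_ok)
    fix vs s' assume J: "?J vs s'"
    show "s' 0 0 = n \<and> s' 17 0 = e" using J hdr s by (auto simp: header_def frameD)
    fix s'' assume f: "frame {18,19} s' s''"
    show "?J vs s''"
      using J core_frame[OF f] stack_frame[OF f, of 13] frame_trans[of _ s s' _ s'', OF _ f]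
      by auto
  next
    fix v vs s' assume J: "?J (v # vs) s'" and v: "v < n" "s' 19 0 = v"
    have hs: "header n M s'" "s' 17 0 = e" using J hdr s header_frame by (auto simp: frameD)
    have I: "(e, v) \<in> I - {e} \<times> (?D - set (v # vs))" "I - {e} \<times> (?D - set (v # vs)) - {(e, v)} = I - {e} \<times> (?D - set vs)"
      "insert v (X \<union> (?D - set (v # vs))) = X \<union> (?D - set vs)"
      using J sub by auto
    have "ok B remove_pair s' 200 (\<lambda>s'' _. core n M (I - {e} \<times> (?D - set (v # vs)) - {(e, v)}) s'' \<and>
        stack n 13 (insert v (X \<union> (?D - set (v # vs)))) s'' \<and> frame {5,6,7,8,13,14,15,20,22,23} s' s'')"
      by (rule remove_pair_ok[OF _ hs(1) I(1) hs(2) v(2)]) (use J in auto)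
    then show "ok B remove_pair s' 200 (\<lambda>s'' _. ?J vs s'' \<and> s'' 18 0 = s' 18 0)"
      unfolding I(2,3)
    proof (rule ok_mono)
      fix s'' :: mem and T' :: real
      assume *: "core n M (I - {e} \<times> (?D - set vs)) s'' \<and> stack n 13 (X \<union> (?D - set vs)) s'' \<and> frame {5,6,7,8,13,14,15,20,22,23} s' s''"
      then have "frame detach_arrays s s''" "s'' 18 = s' 18"
        using J by (auto simp: frame_def)
      then show "?J vs s'' \<and> s'' 18 0 = s' 18 0" using J * by simp
    qed
  qed (use core hdr st dist eM in \<open>auto simp: frame_refl\<close>)
  then show ?thesis by simp
qed


text \<open>Powers of 4 are monotone in the exponent, so maximizing stored values maximizes levels.
  The starting value 1 is harmless, since no power of 4 is smaller.\<close>

lemma Max_pow4: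
  assumes "finite D" "D \<noteq> {}" "\<And>v. v \<in> D \<Longrightarrow> q v = (4::nat) ^ lev v"
  shows "Max (insert 1 (q ` D)) = 4 ^ Max (lev ` D)"
proof (rule Max_eqI)
  show "finite (insert 1 (q ` D))" using assms by simp
  have "Max (lev ` D) \<in> lev ` D" using assms by (intro Max_in) auto
  then show "4 ^ Max (lev ` D) \<in> insert 1 (q ` D)" using assms(3) by force
  fix y assume "y \<in> insert 1 (q ` D)"
  then consider "y = 1" | v where "v \<in> D" "y = 4 ^ lev v" using assms(3) by auto
  then show "y \<le> 4 ^ Max (lev ` D)"
  proof cases
    case 2
    then show ?thesis using assms(1) by (simp add: power_increasing)
  qed simp
qed

lemma attach_pairs_ok:
  assumes core: "core n M I s" and hdr: "header n M s" and eM: "e < M" and dist: "distinct (digs n e)"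
    and new: "\<And>v. (e, v) \<notin> I" and s: "s 17 0 = e" and st: "stack n 10 X s"
    and de: "s 4 e = 4 ^ i" "s 4 e \<le> 4 * M"
  shows "ok B (for_nodes add_pair) s (230 * real (length (digs n e)) + 10) (\<lambda>s' _. core n M (I \<union> {e} \<times> set (digs n e)) s' \<and>
     stack n 10 (X \<union> set (digs n e)) s' \<and> frame {5,6,7,8,9,10,11,12,18,19,20} s s')"
proof -
  let ?D = "set (digs n e)"
  let ?J = "\<lambda>vs s'. distinct vs \<and> set vs \<subseteq> ?D \<and> core n M (I \<union> {e} \<times> (?D - set vs)) s' \<and>
     stack n 10 (X \<union> (?D - set vs)) s' \<and> frame {5,6,7,8,9,10,11,12,18,19,20} s s'"
  have "ok B (for_nodes add_pair) s ((200 + 30) * real (length (digs n e)) + 10) (\<lambda>s' _. ?J [] s')"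
  proof (rule for_nodes_ok)
    fix vs s' assume J: "?J vs s'"
    show "s' 0 0 = n \<and> s' 17 0 = e" using J hdr s by (auto simp: header_def frameD)
    fix s'' assume f: "frame {18,19} s' s''"
    show "?J vs s''"
      using J core_frame[OF f] stack_frame[OF f, of 10] frame_trans[of _ s s' _ s'', OF _ f]
      by auto
  next
    fix v vs s' assume J: "?J (v # vs) s'" and v: "v < n" "s' 19 0 = v"
    have hs: "header n M s'" "s' 17 0 = e" "s' 4 e = 4 ^ i" "s' 4 e \<le> 4 * M" using J hdr s header_frame de by (auto simp: frameD)
    have I: "(e, v) \<notin> I \<union> {e} \<times> (?D - set (v # vs))" "insert (e, v) (I \<union> {e} \<times> (?D - set (v # vs))) = I \<union> {e} \<times> (?D - set vs)"
      "insert v (X \<union> (?D - set (v # vs))) = X \<union> (?D - set vs)"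
      using J new by auto
    have "ok B add_pair s' 200 (\<lambda>s'' _. core n M (insert (e, v) (I \<union> {e} \<times> (?D - set (v # vs)))) s'' \<and>
        stack n 10 (insert v (X \<union> (?D - set (v # vs)))) s'' \<and> frame {5,6,7,8,9,10,11,12,20} s' s'')"
      by (rule add_pair_ok[OF _ hs(1) I(1) eM v(1) hs(3,4,2) v(2)]) (use J in auto)
    then show "ok B add_pair s' 200 (\<lambda>s'' _. ?J vs s'' \<and> s'' 18 0 = s' 18 0)"
      unfolding I(2,3)
    proof (rule ok_mono)
      fix s'' :: mem and T' :: real
      assume *: "core n M (I \<union> {e} \<times> (?D - set vs)) s'' \<and> stack n 10 (X \<union> (?D - set vs)) s'' \<and> frame {5,6,7,8,9,10,11,12,20} s' s''"
      then have "frame {5,6,7,8,9,10,11,12,18,19,20} s s''" "s'' 18 = s' 18"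
        using J by (auto simp: frame_def)
      then show "?J vs s'' \<and> s'' 18 0 = s' 18 0" using J * by simp
    qed
  qed (use core hdr st dist eM in \<open>auto simp: frame_refl\<close>)
  then show ?thesis by simp
qed

lemma attach_ok:
  assumes core: "core n M I s" and hdr: "header n M s" and eM: "e < M" and dist: "distinct (digs n e)"
    and ne: "digs n e \<noteq> []"
    and new: "\<And>v. (e, v) \<notin> I" and s: "s 17 0 = e" and st: "stack n 10 X s"
    and lev: "\<And>v. v < n \<Longrightarrow> Suc (s 2 v) = 4 ^ lev v \<and> Suc (s 2 v) \<le> 4 * M"
  shows "ok B attach s (300 * real (length (digs n e)) + 50) (\<lambda>s' _. core n M (I \<union> {e} \<times> set (digs n e)) s' \<and>
     s' 4 = (s 4)(e := 4 ^ Max (lev ` set (digs n e))) \<and> s' 3 = (s 3)(e := 1) \<and>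
     stack n 10 (X \<union> set (digs n e)) s' \<and> frame attach_arrays s s')"
proof -
  let ?D = "set (digs n e)" and ?q = "\<lambda>v. Suc (s 2 v)"
  let ?Z = "Max (insert 1 (?q ` ?D))"
  have D: "?D \<subseteq> {..<n}" by (rule set_digs)
  have Z: "?Z = 4 ^ Max (lev ` ?D)" by (rule Max_pow4) (use D ne lev in auto)
  have ZM: "?Z \<le> 4 * M" using D lev M_pos by auto
  \<comment> \<open>The maximum over the accumulator and the nodes still to come stays
    \<open>?Z\<close>; when no node is left, it is the accumulator.\<close>
  let ?J = "\<lambda>vs s'. set vs \<subseteq> ?D \<and> 1 \<le> s' 28 0 \<and> s' 28 0 \<le> 4 * M \<and> Max (insert (s' 28 0) (?q ` set vs)) = ?Z \<and> frame {18,19,28} s s'"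
  let ?c = "IF (Op Less (var 28) (Op Add (Read 2 (var 19)) (Const 1)))
                        (WRITE 28 (Const 0) (Op Add (Read 2 (var 19)) (Const 1))) SKIP"
  let ?s = "s(28 := (s 28)(0 := 1))"
  have max: "ok B (for_nodes ?c) ?s ((20 + 30) * real (length (digs n e)) + 10) (\<lambda>s' _. ?J [] s')"
  proof (rule for_nodes_ok)
    fix vs s' assume J: "?J vs s'"
    show "s' 0 0 = n \<and> s' 17 0 = e" using J hdr s by (auto simp: header_def frameD)
    fix s'' assume f: "frame {18,19} s' s''"
    show "?J vs s''"
      using J frame_trans[of _ s s' _ s'', OF _ f] frameD[OF f, of 28] by auto
  next
    fix v vs s' assume J: "?J (v # vs) s'" and v: "v < n" "s' 19 0 = v"
    have s2: "s' 2 = s 2" using J by (auto simp: frameD)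
    have qM: "?q v \<le> 4 * M" using lev[OF v(1)] by (rule conjunct2)
    have mx: "Max (insert (max (s' 28 0) (?q v)) (?q ` set vs)) = ?Z"
    proof (cases "vs = []")
      case False
      then show ?thesis using J by (simp add: max.assoc)
    qed (use J in simp)
    have b: "s' 28 0 < B" "Suc (s 2 v) < B" "s 2 v < B" using J qM small(1) Suc_lessD by auto
    show "ok B ?c s' 20 (\<lambda>s'' _. ?J vs s'' \<and> s'' 18 0 = s' 18 0)"
      using J mx qM v by (auto simp: ok_simps small b s2 max_def frame_def)
  qed (use eM M_pos in \<open>auto simp: frame_def\<close>)
  have rest: "ok B (for_nodes add_pair) (s'(4 := (s' 4)(e := ?Z), 3 := (s' 3)(e := 1))) T (\<lambda>s' _. core n M (I \<union> {e} \<times> ?D) s' \<and>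
     s' 4 = (s 4)(e := 4 ^ Max (lev ` ?D)) \<and> s' 3 = (s 3)(e := 1) \<and>
     stack n 10 (X \<union> ?D) s' \<and> frame attach_arrays s s')"
    if J: "?J [] s'" and T: "230 * real (length (digs n e)) + 10 \<le> T" for s' T
  proof -
    let ?t = "s'(4 := (s' 4)(e := ?Z), 3 := (s' 3)(e := 1))"
    have f: "frame {18,19,28} s s'" and f': "frame {3,4,18,19,28} s ?t" using J by (auto simp: frame_def)
    have "core n M I s'" using core core_frame[OF f] by auto
    \<comment> \<open>No incidence of \<open>e\<close> is present in \<open>I\<close>, so writing
      its value disturbs neither lists nor stored weights.\<close>
    moreover have "((s' 4)(e := z)) e' = s' 4 e'" if "(e', v) \<in> I" for e' v z using that new by auto
    ultimately have "core n M I (s'(4 := (s' 4)(e := z), 3 := (s' 3)(e := 1)))" for z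
      unfolding core_def using edge_lists_cong[of I "(s' 4)(e := z)" "s' 4"] stored_weights_cong[of I "(s' 4)(e := z)" "s' 4"]
      by simp
    then have c: "core n M I ?t" .
    have "ok B (for_nodes add_pair) ?t (230 * real (length (digs n e)) + 10) (\<lambda>s' _. core n M (I \<union> {e} \<times> set (digs n e)) s' \<and>
     stack n 10 (X \<union> set (digs n e)) s' \<and> frame {5,6,7,8,9,10,11,12,18,19,20} ?t s')"
      by (rule attach_pairs_ok[OF c _ eM dist new, where i = "Max (lev ` ?D)"])
        (use hdr s st stack_frame[OF f', of 10] header_frame[OF f'] frameD[OF f', of 17] Z ZM in auto)
    then show ?thesis
    proof (rule ok_call[OF _ T])
      fix s'' T'' assume *: "core n M (I \<union> {e} \<times> set (digs n e)) s'' \<and>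
        stack n 10 (X \<union> set (digs n e)) s'' \<and> frame {5,6,7,8,9,10,11,12,18,19,20} ?t s''"
      then have f'': "frame {5,6,7,8,9,10,11,12,18,19,20} ?t s''" by simp
      have "s'' 4 = (s 4)(e := 4 ^ Max (lev ` ?D))" "s'' 3 = (s 3)(e := 1)"
        using frameD[OF f'', of 4] frameD[OF f'', of 3] frameD[OF f, of 4] frameD[OF f, of 3] Z by auto
      moreover have "frame attach_arrays s s''"
        using frame_trans[OF f' f''] by simp
      ultimately show "core n M (I \<union> {e} \<times> ?D) s'' \<and>
        s'' 4 = (s 4)(e := 4 ^ Max (lev ` ?D)) \<and> s'' 3 = (s 3)(e := 1) \<and>
        stack n 10 (X \<union> ?D) s'' \<and> frame attach_arrays s s''" using * by blast
    qed
  qed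
  show ?thesis
    unfolding attach_def
    apply (simp add: ok_SEQ ok_WRITE[of B 28] small)
    apply (rule ok_call[OF max[simplified]])
    subgoal by simp
    subgoal premises prems for s' T'
    proof -
      have a: "1 \<le> s' 28 0 \<and> s' 28 0 \<le> 4 * M \<and> s' 28 0 = ?Z \<and> frame {18,19,28} s s'"
        using prems(1) unfolding One_nat_def .
      have T: "250 * real (length (digs n e)) + 37 \<le> T'" using prems(2) by simp
      obtain z where zdef: "?Z = z" by blast
      have z: "s' 28 0 = z" "s' 17 0 = e" "z < B" "e < B" using a s small(1)[OF ZM] small(8)[OF eM] zdef by (auto simp: frameD)
      have J: "?J [] s'" using a by auto
      show ?thesis
        using T by (simp add: ok_WRITE small z) (rule rest[OF J, unfolded zdef, simplified], simp)
    qed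
    done
qed

end

section \<open>Changing the level of a node\<close>

definition Inc :: "nat \<Rightarrow> nat set \<Rightarrow> (nat \<times> nat) set" where
  "Inc n E = {(e, v). e \<in> E \<and> v \<in> set (digs n e)}"

text \<open>A number with a digit 0 may qualify and decode to the same nodes as a proper code. This
  is harmless, because the analysis identifies hyperedges by their codes.\<close>

definition edge_codes :: "nat \<Rightarrow> nat \<Rightarrow> nat \<Rightarrow> nat set" where
  "edge_codes n M f = {e. e < M \<and> distinct (digs n e) \<and> digs n e \<noteq> [] \<and> length (digs n e) \<le> f}"

definition cell :: aexp where
  "cell = Op Add (Op Mul (var 25) (var 0)) (var 24)"

text \<open>
  All hyperedges on the level of the node are taken out before the first one is put back, since after a move
  down a hyperedge may have to return to the list being emptied.
\<close>

definition take_out :: com where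
  "take_out = SEQ (WRITE 26 (Const 0) (Const 0))
     (WHILE (Read 5 cell)
       (SEQ (WRITE 17 (Const 0) (Read 6 (Op Add (Op Mul cell (var 16)) (Op Sub (Read 5 cell) (Const 1)))))
       (SEQ (WRITE 27 (var 26) (var 17))
       (SEQ (WRITE 26 (Const 0) (Op Add (var 26) (Const 1)))
            (for_nodes remove_pair)))))"

definition put_back :: com where
  "put_back = WHILE (var 26)
     (SEQ (WRITE 26 (Const 0) (Op Sub (var 26) (Const 1)))
     (SEQ (WRITE 17 (Const 0) (Read 27 (var 26))) attach))"

locale algorithm = machine +
  fixes f :: nat
  assumes f_pos: "0 < f"
begin

abbreviation "Edges \<equiv> edge_codes n M f"
abbreviation "nds e \<equiv> set (digs n e)"
abbreviation "touched N \<equiv> \<Union>e\<in>N. nds e"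

sublocale hypergraph "{..<n}" "\<lambda>e. set (digs n e)" "edge_codes n M f" f
proof
  show "finite (edge_codes n M f)" by (rule finite_subset[of _ "{..<M}"]) (auto simp: edge_codes_def)
  show "set (digs n e) \<noteq> {} \<and> set (digs n e) \<subseteq> {..<n} \<and> card (set (digs n e)) \<le> f" if "e \<in> edge_codes n M f" for e
    using that set_digs[of n e] by (auto simp: edge_codes_def distinct_card)
qed simp

lemma edge_code: "e \<in> Edges \<Longrightarrow> e < M \<and> distinct (digs n e) \<and> digs n e \<noteq> [] \<and> length (digs n e) \<le> f"
  by (simp add: edge_codes_def)

lemma Inc_remove: "e \<in> E \<Longrightarrow> Inc n E - {e} \<times> nds e = Inc n (E - {e})"
  by (auto simp: Inc_def)

lemma Inc_insert: "Inc n E \<union> {e} \<times> nds e = Inc n (insert e E)"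
  by (auto simp: Inc_def)

lemma card_le_M: "A \<subseteq> Edges \<Longrightarrow> card A \<le> M"
  using card_mono[of "{..<M}" A] by (auto simp: edge_codes_def)

text \<open>Array 4 is left alone, so at any time the list of value \<open>q\<close> at
  \<open>x\<close> consists of \<open>N\<close> without the hyperedges already moved to the buffer
  in array 27. Each remaining one carries credit \<open>350 * f\<close>.\<close>

lemma take_out_ok:
  assumes core: "core n M (Inc n E) s" and hdr: "header n M s" and E: "E \<subseteq> Edges"
    and x: "x < n" and s: "s 24 0 = x" "s 25 0 = q" and q: "q \<le> 4 * M" and st: "stack n 13 X s"
  defines "N \<equiv> {e \<in> E. x \<in> nds e \<and> s 4 e = q}"
  shows "ok B take_out s (350 * real f * real (card N) + 30) (\<lambda>s' _. core n M (Inc n (E - N)) s' \<and>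
     stack n 13 (X \<union> touched N) s' \<and> frame {5,6,7,8,13,14,15,17,18,19,20,22,23,26,27} s s' \<and>
     (\<exists>ys. distinct ys \<and> set ys = N \<and> s' 26 0 = length ys \<and> (\<forall>i<length ys. s' 27 i = ys ! i)))"
proof -
  let ?F = "{5,6,7,8,13,14,15,17,18,19,20,22,23,26,27} :: nat set"
  have finN: "finite N" using finite_inc[OF E] by (simp add: N_def)
  have NE: "N \<subseteq> E" by (auto simp: N_def)
  define J where "J = (\<lambda>ys s'. distinct ys \<and> set ys \<subseteq> N \<and> core n M (Inc n (E - set ys)) s' \<and>
     stack n 13 (X \<union> touched (set ys)) s' \<and> frame ?F s s' \<and> s' 26 0 = length ys \<and> (\<forall>i<length ys. s' 27 i = ys ! i))"
  let ?I = "\<lambda>s' T. \<exists>ys. J ys s' \<and> 350 * real f * real (card (N - set ys)) + 10 \<le> T"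
  let ?Q = "\<lambda>s' _. core n M (Inc n (E - N)) s' \<and>
     stack n 13 (X \<union> touched N) s' \<and> frame ?F s s' \<and>
     (\<exists>ys. distinct ys \<and> set ys = N \<and> s' 26 0 = length ys \<and> (\<forall>i<length ys. s' 27 i = ys ! i))"
  let ?body = "(SEQ (WRITE 17 (Const 0) (Read 6 (Op Add (Op Mul cell (var 16)) (Op Sub (Read 5 cell) (Const 1)))))
       (SEQ (WRITE 27 (var 26) (var 17))
       (SEQ (WRITE 26 (Const 0) (Op Add (var 26) (Const 1)))
            (for_nodes remove_pair))))"
  define k where "k = q * n + x"
  note cs = code_small[OF q x, folded k_def]
  have loop: "ok B (WHILE (Read 5 cell) ?body) s' T ?Q" if "?I s' T" for s' T
  proof (rule ok_WHILE[where I = ?I])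
    show "?I s' T" by (rule that)
  next
    fix s' :: mem and T :: real assume "?I s' T"
    then obtain ys where J: "J ys s'" and T: "350 * real f * real (card (N - set ys)) + 10 \<le> T" by blast
    have ys: "distinct ys" "set ys \<subseteq> N" and core': "core n M (Inc n (E - set ys)) s'"
      and st': "stack n 13 (X \<union> touched (set ys)) s'" and fr: "frame ?F s s'"
      and len: "s' 26 0 = length ys" and tmp: "\<forall>i<length ys. s' 27 i = ys ! i"
      using J by (auto simp: J_def)
    have s': "s' 24 0 = x" "s' 25 0 = q" "s' 0 0 = n" "s' 16 0 = M" "s' 4 = s 4"
      using s hdr frameD[OF fr] by (auto simp: header_def)
    have l': "edge_lists n M (Inc n (E - set ys)) (s 4) (s' 5) (s' 6) (s' 7)"
      using core' s' by (simp add: core_def)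
    have set_eq: "{e. (e, x) \<in> Inc n (E - set ys) \<and> s 4 e = q} = N - set ys"
      by (auto simp: Inc_def N_def)
    note lc = edge_lists_count[OF l' x, of q, unfolded set_eq, folded k_def]
    have c: "s' 5 k = card (N - set ys)" "s' 5 k < B" using lc(1,4) small(2) by auto
    have fits_cell: "fits B (Read 5 cell) s'" "aval cell s' = k" "acost cell = 8" "fits B cell s'"
      using s' cs(1-2) small(1)[OF q] small(3,5) small(9)[OF x] k_def c by (simp_all add: cell_def)
    show "fits B (Read 5 cell) s' \<and> (if aval (Read 5 cell) s' \<noteq> 0 then ok B ?body s' (T - real (acost (Read 5 cell) + 1)) ?I
       else real (acost (Read 5 cell) + 1) \<le> T \<and> ?Q s' (T - real (acost (Read 5 cell) + 1)))"
    proof (cases "s' 5 k = 0")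
      case True
      then have "N - set ys = {}" using c finN by simp
      then have "set ys = N" using ys by auto
      then show ?thesis using True fits_cell T core' st' fr len tmp ys by auto
    next
      case False
      then obtain i where i: "s' 5 k = Suc i" using not0_implies_Suc by blast
      define e where "e = s' 6 (k * M + i)"
      have "e \<in> N - set ys"
        using bij_betwE[OF lc(2)] i unfolding e_def by simp
      then have e: "e \<in> N" "e \<notin> set ys" "e \<in> E" "e \<in> Edges" using NE E by auto
      note ec = edge_code[OF e(4)]
      have iM: "i \<le> M" "i < B" "Suc i < B" using lc(4) i c by auto
      have lenM: "length ys < M"
      proof -
        have "length (e # ys) = card (set (e # ys))" using ys e by (simp add: distinct_card)
        also have "\<dots> \<le> card N" using e ys finN by (intro card_mono) auto
        also have "\<dots> \<le> M" using NE E by (intro card_le_M) auto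
        finally show ?thesis by simp
      qed
      define s2 where "s2 = s'(17 := (s' 17)(0 := e), 27 := (s' 27)(length ys := e), 26 := (s' 26)(0 := Suc (length ys)))"
      have f2: "frame {17,26,27} s' s2" by (simp add: frame_def s2_def)
      have det: "ok B (for_nodes remove_pair) s2 (230 * real (length (digs n e)) + 10) (\<lambda>s' _. core n M (Inc n (E - set ys) - {e} \<times> nds e) s' \<and>
          stack n 13 (X \<union> touched (set ys) \<union> nds e) s' \<and> frame detach_arrays s2 s')"
      proof (rule detach_ok)
        show "core n M (Inc n (E - set ys)) s2" using core' core_frame[OF f2] by simp
        show "header n M s2" using s' header_frame[OF f2] by (simp add: header_def)
        show "{e} \<times> nds e \<subseteq> Inc n (E - set ys)" using e by (auto simp: Inc_def)
        show "stack n 13 (X \<union> touched (set ys)) s2" using st' stack_frame[OF f2, of 13] by simp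
        show "s2 17 0 = e" by (simp add: s2_def)
      qed (use ec in auto)
      have "ok B (for_nodes remove_pair) s2 T' ?I" if T': "T - 50 \<le> T'" for T'
      proof (rule ok_call[OF det])
        have "card (N - set ys) \<noteq> 0" using c False by simp
        then have cn: "real (card (N - set ys)) = 1 + real (card (N - set (ys @ [e])))"
        proof -
          have "N - set ys = insert e (N - set (ys @ [e]))" "e \<notin> N - set (ys @ [e])" using e by auto
          then show ?thesis using finN by (metis (no_types, lifting) card_insert_disjoint finite_Diff of_nat_Suc add.commute)
        qed
        have "230 * real (length (digs n e)) \<le> 230 * real f" using ec by simp
        moreover have "1 \<le> real f" using f_pos by simp
        moreover have 1: "350 * real f * real (card (N - set ys)) = 350 * real f + 350 * real f * real (card (N - set (ys @ [e])))"
          unfolding cn by (simp add: algebra_simps)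
        moreover have "0 \<le> 350 * real f * real (card (N - set (ys @ [e])))" by simp
        ultimately have 2: "230 * real (length (digs n e)) + 10 + (350 * real f * real (card (N - set (ys @ [e]))) + 10) \<le> T'"
          using T T' by linarith
        then show "230 * real (length (digs n e)) + 10 \<le> T'" by (smt (verit) mult_nonneg_nonneg of_nat_0_le_iff)
        fix s'' T''
        assume *: "core n M (Inc n (E - set ys) - {e} \<times> nds e) s'' \<and>
          stack n 13 (X \<union> touched (set ys) \<union> nds e) s'' \<and> frame detach_arrays s2 s''"
          and T'': "T' - (230 * real (length (digs n e)) + 10) \<le> T''"
        have f3: "frame detach_arrays s2 s''" using * by simp
        have Ieq: "Inc n (E - set ys) - {e} \<times> nds e = Inc n (E - set (ys @ [e]))"
          using e by (auto simp: Inc_def)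
        have Xeq: "X \<union> touched (set ys) \<union> nds e = X \<union> touched (set (ys @ [e]))" by auto
        have "J (ys @ [e]) s''"
          unfolding J_def
        proof (intro conjI)
          show "frame ?F s s''" using frame_trans[OF fr frame_trans[OF f2 f3 subset_refl[THEN le_supI1] subset_refl[THEN le_supI2]], of ?F] by auto
          show "s'' 26 0 = length (ys @ [e])" using frameD[OF f3, of 26] by (simp add: s2_def)
          show "\<forall>i<length (ys @ [e]). s'' 27 i = (ys @ [e]) ! i"
            using frameD[OF f3, of 27] tmp by (auto simp: s2_def nth_append less_Suc_eq)
        qed (use * Ieq Xeq ys e in auto)
        then show "?I s'' T''" using 2 T'' by (intro exI[of _ "ys @ [e]"]) auto
      qed
      moreover have "350 * 1 * 1 \<le> 350 * real f * real (card (N - set ys))"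
        using f_pos i c by (intro mult_mono) auto
      then have "50 \<le> T" using T by linarith
      ultimately show ?thesis
        using False i s' lenM len iM cs(3) cs(4)[OF iM(1)] small(8)[of e] small(1)[of "Suc (length ys)"] ec c
        by (simp add: fits_cell ok_SEQ ok_WRITE small e_def[symmetric] s2_def)
    qed
  qed
  have "J [] (s(26 := (s 26)(0 := 0)))"
    using core st core_frame[of "{26}" s "s(26 := (s 26)(0 := 0))"] stack_frame[of "{26}" s "s(26 := (s 26)(0 := 0))" 13]
    by (simp add: J_def frame_def)
  then have "ok B (WHILE (Read 5 cell) ?body) (s(26 := (s 26)(0 := 0))) T ?Q" if "350 * real f * real (card N) + 10 \<le> T" for T
    using that by (intro loop exI[of _ "[]"]) simp
  then show ?thesis
    unfolding take_out_def ok_SEQ ok_WRITE by (auto simp: small add_nonneg_nonneg)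
qed


text \<open>Array 2 already shows the new levels given by \<open>lev\<close>, so
  \<open>attach\<close> computes the new hyperedge levels. The buffer is emptied from its end;
  \<open>zs\<close> is the part still to be attached.\<close>

lemma put_back_ok:
  assumes core: "core n M (Inc n (E - N)) s" and hdr: "header n M s" and E: "E \<subseteq> Edges" and N: "N \<subseteq> E"
    and st: "stack n 10 X s"
    and lev: "\<And>v. v < n \<Longrightarrow> Suc (s 2 v) = 4 ^ lev v \<and> Suc (s 2 v) \<le> 4 * M"
    and ys: "distinct ys" "set ys = N" "s 26 0 = length ys" "\<forall>i<length ys. s 27 i = ys ! i"
  shows "ok B put_back s (400 * real f * real (card N) + 30) (\<lambda>s' _. core n M (Inc n E) s' \<and>
     stack n 10 (X \<union> touched N) s' \<and> frame {3,4,5,6,7,8,9,10,11,12,17,18,19,20,26,28} s s' \<and>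
     (\<forall>e. s' 4 e = (if e \<in> N then 4 ^ el lev e else s 4 e) \<and> s' 3 e = (if e \<in> N then 1 else s 3 e)))"
proof -
  let ?F = "{3,4,5,6,7,8,9,10,11,12,17,18,19,20,26,28} :: nat set"
  have finN: "finite N" using ys(2) by auto
  define J where "J = (\<lambda>zs s'. distinct zs \<and> set zs \<subseteq> N \<and> core n M (Inc n (E - set zs)) s' \<and>
     stack n 10 (X \<union> touched (N - set zs)) s' \<and> frame ?F s s' \<and> s' 26 0 = length zs \<and> (\<forall>i<length zs. s' 27 i = zs ! i) \<and>
     (\<forall>e. s' 4 e = (if e \<in> N - set zs then 4 ^ el lev e else s 4 e) \<and> s' 3 e = (if e \<in> N - set zs then 1 else s 3 e)))"
  let ?I = "\<lambda>s' T. \<exists>zs. J zs s' \<and> 400 * real f * real (length zs) + 10 \<le> T"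
  let ?Q = "\<lambda>s' _. core n M (Inc n E) s' \<and>
     stack n 10 (X \<union> touched N) s' \<and> frame ?F s s' \<and>
     (\<forall>e. s' 4 e = (if e \<in> N then 4 ^ el lev e else s 4 e) \<and> s' 3 e = (if e \<in> N then 1 else s 3 e))"
  let ?body = "SEQ (WRITE 26 (Const 0) (Op Sub (var 26) (Const 1)))
     (SEQ (WRITE 17 (Const 0) (Read 27 (var 26))) attach)"
  have loop: "ok B (WHILE (var 26) ?body) s' T ?Q" if "?I s' T" for s' T
  proof (rule ok_WHILE[where I = ?I])
    show "?I s' T" by (rule that)
  next
    fix s' :: mem and T :: real assume "?I s' T"
    then obtain zs where J: "J zs s'" and T: "400 * real f * real (length zs) + 10 \<le> T" by blast
    have zs: "distinct zs" "set zs \<subseteq> N" and core': "core n M (Inc n (E - set zs)) s'"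
      and st': "stack n 10 (X \<union> touched (N - set zs)) s'" and fr: "frame ?F s s'"
      and len: "s' 26 0 = length zs" and tmp: "\<forall>i<length zs. s' 27 i = zs ! i"
      and s4: "\<forall>e. s' 4 e = (if e \<in> N - set zs then 4 ^ el lev e else s 4 e) \<and> s' 3 e = (if e \<in> N - set zs then 1 else s 3 e)"
      using J unfolding J_def by blast+
    have lenM: "length zs \<le> M"
    proof -
      have "set zs \<subseteq> Edges" using zs N E by auto
      then have "card (set zs) \<le> M" by (rule card_le_M)
      then show ?thesis using zs(1) by (simp add: distinct_card)
    qed
    show "fits B (var 26) s' \<and> (if aval (var 26) s' \<noteq> 0 then ok B ?body s' (T - real (acost (var 26) + 1)) ?I
       else real (acost (var 26) + 1) \<le> T \<and> ?Q s' (T - real (acost (var 26) + 1)))"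
    proof (cases "zs = []")
      case True
      have "3 \<le> T" using T True by simp
      then show ?thesis using True len core' st' fr s4 small by simp
    next
      case False
      then obtain ws e where we: "zs = ws @ [e]" using rev_exhaust by blast
      have e: "e \<in> N" "e \<notin> set ws" "e \<in> E" "e \<in> Edges" using zs we N E by auto
      note ec = edge_code[OF e(4)]
      define s2 where "s2 = s'(26 := (s' 26)(0 := length ws), 17 := (s' 17)(0 := e))"
      have f2: "frame {17,26} s' s2" by (simp add: frame_def s2_def)
      have fr2: "frame ?F s s2" using frame_trans[OF fr f2] by simp
      have att: "ok B attach s2 (300 * real (length (digs n e)) + 50) (\<lambda>s'' _. core n M (Inc n (E - set zs) \<union> {e} \<times> nds e) s'' \<and>
         s'' 4 = (s2 4)(e := 4 ^ Max (lev ` nds e)) \<and> s'' 3 = (s2 3)(e := 1) \<and>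
         stack n 10 (X \<union> touched (N - set zs) \<union> nds e) s'' \<and> frame attach_arrays s2 s'')"
      proof (rule attach_ok)
        show "core n M (Inc n (E - set zs)) s2" using core' core_frame[OF f2] by simp
        show "header n M s2" using hdr header_frame[OF fr2] by simp
        show "(e, v) \<notin> Inc n (E - set zs)" for v using we by (auto simp: Inc_def)
        show "stack n 10 (X \<union> touched (N - set zs)) s2" using st' stack_frame[OF f2, of 10] by simp
        show "s2 17 0 = e" by (simp add: s2_def)
        show "Suc (s2 2 v) = 4 ^ lev v \<and> Suc (s2 2 v) \<le> 4 * M" if "v < n" for v
          using lev[OF that] frameD[OF fr2, of 2] by simp
      qed (use ec in auto)
      have f1: "1 \<le> real f" using f_pos by simp
      have Teq: "400 * real f * real (length zs) = 400 * real f + 400 * real f * real (length ws)"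
        by (simp add: we algebra_simps)
      have nn: "0 \<le> 400 * real f * real (length ws)" by simp
      have lf: "300 * real (length (digs n e)) \<le> 300 * real f" using ec by simp
      have "ok B attach s2 T' ?I" if T': "T - 30 \<le> T'" for T'
      proof (rule ok_call[OF att])
        show "300 * real (length (digs n e)) + 50 \<le> T'" using T T' Teq nn lf f1 by linarith
        fix s'' T''
        assume *: "core n M (Inc n (E - set zs) \<union> {e} \<times> nds e) s'' \<and>
         s'' 4 = (s2 4)(e := 4 ^ Max (lev ` nds e)) \<and> s'' 3 = (s2 3)(e := 1) \<and>
         stack n 10 (X \<union> touched (N - set zs) \<union> nds e) s'' \<and> frame attach_arrays s2 s''"
          and T'': "T' - (300 * real (length (digs n e)) + 50) \<le> T''"
        have f3: "frame attach_arrays s2 s''" using * by simp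
        have Ieq: "Inc n (E - set zs) \<union> {e} \<times> nds e = Inc n (E - set ws)"
          using e we by (auto simp: Inc_def)
        have Neq: "N - set ws = insert e (N - set zs)" using e we by auto
        have Xeq: "X \<union> touched (N - set zs) \<union> nds e = X \<union> touched (N - set ws)" unfolding Neq by auto
        have "J ws s''"
          unfolding J_def
        proof (intro conjI)
          show "frame ?F s s''" using frame_trans[OF fr2 f3] by simp
          show "s'' 26 0 = length ws" using frameD[OF f3, of 26] by (simp add: s2_def)
          show "\<forall>i<length ws. s'' 27 i = ws ! i"
            using frameD[OF f3, of 27] tmp we by (auto simp: s2_def nth_append)
          show "\<forall>e. s'' 4 e = (if e \<in> N - set ws then 4 ^ el lev e else s 4 e) \<and> s'' 3 e = (if e \<in> N - set ws then 1 else s 3 e)"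
            unfolding Neq using * s4 by (auto simp: s2_def el_def)
        qed (use * Ieq Xeq zs we in auto)
        then show "?I s'' T''" using T T' T'' Teq lf f1 by (intro exI[of _ ws]) auto
      qed
      moreover have "length ws < B" "Suc (length ws) < B" using lenM we small(1) by auto
      moreover have "30 \<le> T" using T Teq nn f1 by linarith
      moreover have "s' 27 (length ws) = e" using tmp we by simp
      ultimately show ?thesis
        using len we small(8)[of e] ec by (simp add: ok_SEQ ok_WRITE small s2_def)
    qed
  qed
  have "card N = length ys" using ys by (metis distinct_card)
  moreover have "J ys s" using core st ys by (simp add: J_def frame_refl)
  ultimately show ?thesis unfolding put_back_def by (intro loop exI[of _ ys]) auto
qed

end

section \<open>Settling all nodes\<close>

lemma stack_top:
  assumes "stack n a X s"
  shows "s (Suc (Suc a)) 0 = card X" "X \<subseteq> {..<n}" "finite X" "card X \<le> n" "card X = Suc k \<Longrightarrow> s a k \<in> X"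
proof -
  obtain xs where xs: "distinct xs" "set xs = X" "X \<subseteq> {..<n}" "s (Suc (Suc a)) 0 = length xs" "\<forall>i<length xs. s a i = xs ! i"
    using assms by (auto simp: stack_def)
  have len: "length xs = card X" using xs by (metis distinct_card)
  then show "s (Suc (Suc a)) 0 = card X" using xs by simp
  show "X \<subseteq> {..<n}" by fact
  show "finite X" using xs(2) by auto
  show "card X \<le> n" using card_mono[OF _ xs(3)] by simp
  show "card X = Suc k \<Longrightarrow> s a k \<in> X" using xs len by auto
qed

lemma stack_pop:
  assumes st: "stack n a X s" and k: "card X = Suc k"
  shows "stack n a (X - {s a k}) (s(Suc a := (s (Suc a))(s a k := 0), Suc (Suc a) := (s (Suc (Suc a)))(0 := k)))"
proof -
  obtain xs where xs: "distinct xs" "set xs = X" "X \<subseteq> {..<n}" "s (Suc (Suc a)) 0 = length xs" "\<forall>i<length xs. s a i = xs ! i"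
     "\<forall>v<n. s (Suc a) v = (if v \<in> X then 1 else 0)"
    using st by (auto simp: stack_def)
  have len: "length xs = Suc k" using xs k by (metis distinct_card)
  then obtain ys y where ys: "xs = ys @ [y]" by (metis rev_exhaust list.size(3) nat.distinct(1))
  have y: "s a k = y" using xs(5) len ys by (auto simp: nth_append)
  show ?thesis
    unfolding stack_def y
    by (rule exI[of _ ys]) (use xs ys len in \<open>auto simp: nth_append\<close>)
qed

text \<open>Array 24 must hold the top node. The item itself is not erased: height and flag decide
  membership.\<close>

definition pop :: "nat \<Rightarrow> com" where
  "pop a = SEQ (WRITE (Suc a) (var 24) (Const 0))
     (WRITE (Suc (Suc a)) (Const 0) (Op Sub (var (Suc (Suc a))) (Const 1)))"

text \<open>Array 25 preserves the old value, which addresses the list to be emptied, while array 2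
  must show the new level before the hyperedges are put back.\<close>

definition change_level :: "aexp \<Rightarrow> com" where
  "change_level q = SEQ (WRITE 25 (Const 0) (Op Add (Read 2 (var 24)) (Const 1)))
     (SEQ (WRITE 2 (var 24) (Op Sub q (Const 1))) (SEQ take_out put_back))"

text \<open>A node that moves stays on its stack and is popped only when its test fails, so it is
  tested again after each move. The product in the second condition is a conjunction.\<close>

definition settle :: "nat \<Rightarrow> com" where
  "settle G = WHILE (Op Add (var 12) (var 15))
     (IF (var 12)
       (SEQ (WRITE 24 (Const 0) (Read 10 (Op Sub (var 12) (Const 1))))
         (IF (Op Less (Read 8 (var 24)) (Op Add (Read 9 (var 24)) (Const 1)))
            (pop 10) (change_level (Op Mul (var 25) (Const 4)))))
       (SEQ (WRITE 24 (Const 0) (Read 13 (Op Sub (var 15) (Const 1))))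
         (IF (Op Mul (Op Less (Const 0) (Read 2 (var 24)))
                 (Op Less (Op Mul (Read 8 (var 24)) (Const (4 * G))) (Op Add (Read 9 (var 24)) (Const 1))))
            (change_level (Op Div (var 25) (Const 4))) (pop 13))))"

context algorithm
begin

definition represents :: "nat set \<Rightarrow> (nat \<Rightarrow> nat) \<Rightarrow> mem \<Rightarrow> bool" where
  "represents E lev s \<longleftrightarrow> E \<subseteq> Edges \<and> core n M (Inc n E) s \<and>
     (\<forall>v<n. Suc (s 2 v) = 4 ^ lev v \<and> Suc (s 2 v) \<le> 4 * M) \<and>
     (\<forall>e\<in>E. s 4 e = 4 ^ el lev e \<and> s 3 e = 1)"

lemma represents_frame:
  "frame A s s' \<Longrightarrow> A \<inter> {2,3,4,5,6,7,8,9} = {} \<Longrightarrow> represents E lev s' = represents E lev s"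
  unfolding represents_def using core_frame[of A s s' n M "Inc n E"] frameD[of A s s' 2] frameD[of A s s' 3] frameD[of A s s' 4]
  by auto

text \<open>The quotients in the numerator are exact, as each value divides the common denominator;
  the fixed-point representation therefore involves no rounding.\<close>

lemma weight_memory:
  assumes "represents E lev s" "v < n"
  shows "real (s 8 v) = weight E lev v * real (Suc (s 9 v))"
proof -
  have E: "E \<subseteq> Edges" and w: "stored_weights n M (Inc n E) (s 4) (s 8) (s 9)" and s4: "\<And>e. e \<in> E \<Longrightarrow> s 4 e = 4 ^ el lev e"
    using assms by (auto simp: represents_def core_def)
  note w' = w[unfolded stored_weights_def, rule_format, OF assms(2)]
  obtain i where i: "Suc (s 9 v) = 4 ^ i" using w' by auto
  have "real (s 8 v) = (\<Sum>e | (e, v) \<in> Inc n E. real (Suc (s 9 v) div s 4 e))" using w' by simp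
  also have "\<dots> = (\<Sum>e | e \<in> E \<and> v \<in> nds e. (1/4) ^ el lev e * real (Suc (s 9 v)))"
  proof (rule sum.cong)
    fix e assume "e \<in> {e. e \<in> E \<and> v \<in> nds e}"
    then have e: "e \<in> E" "(e, v) \<in> Inc n E" by (auto simp: Inc_def)
    then have "s 4 e dvd Suc (s 9 v)" using pow4_dvd[OF s4[OF e(1)] i] w' by auto
    then have "real (Suc (s 9 v) div s 4 e) = real (Suc (s 9 v)) / real (s 4 e)" by (rule real_of_nat_div)
    then show "real (Suc (s 9 v) div s 4 e) = (1/4) ^ el lev e * real (Suc (s 9 v))"
      using s4[OF e(1)] by (simp add: power_one_over)
  qed (auto simp: Inc_def)
  finally show ?thesis by (simp add: weight_def sum_distrib_right)
qed

lemma weight_tests: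
  assumes "represents E lev s" "v < n"
  shows "s 8 v < Suc (s 9 v) \<longleftrightarrow> weight E lev v < 1"
    "s 8 v * (4 * G) < Suc (s 9 v) \<longleftrightarrow> weight E lev v < 1 / (4 * real G)"
proof -
  note w = weight_memory[OF assms]
  have p: "0 < real (Suc (s 9 v))" by simp
  have "s 8 v < Suc (s 9 v) \<longleftrightarrow> real (s 8 v) < real (Suc (s 9 v))" by (simp only: of_nat_less_iff)
  also have "\<dots> \<longleftrightarrow> weight E lev v < 1" unfolding w using p by (metis mult_less_cancel_right_pos mult_1)
  finally show "s 8 v < Suc (s 9 v) \<longleftrightarrow> weight E lev v < 1" .
  have "s 8 v * (4 * G) < Suc (s 9 v) \<longleftrightarrow> real (s 8 v * (4 * G)) < real (Suc (s 9 v))" by (simp only: of_nat_less_iff)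
  also have "\<dots> \<longleftrightarrow> (weight E lev v * (4 * real G)) * real (Suc (s 9 v)) < 1 * real (Suc (s 9 v))"
    by (simp only: of_nat_mult w) (simp add: algebra_simps)
  also have "\<dots> \<longleftrightarrow> weight E lev v * (4 * real G) < 1" using p by (rule mult_less_cancel_right_pos)
  also have "\<dots> \<longleftrightarrow> weight E lev v < 1 / (4 * real G)" using G_pos by (simp add: field_simps)
  finally show "s 8 v * (4 * G) < Suc (s 9 v) \<longleftrightarrow> weight E lev v < 1 / (4 * real G)" .
qed

text \<open>Covers both directions: all it needs is that hyperedges outside \<open>N\<close> keep
  their level. \<open>t\<close> is the memory after the two writes of \<open>change_level\<close>,
  with the old value of \<open>x\<close> in array 25.\<close>

lemma move_ok:
  assumes rep: "represents E lev s" and hdr: "header n M s" and x: "x < n"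
    and st: "stack n 10 U s" "stack n 13 D s"
    and l: "4 ^ l \<le> 4 * M" and el: "\<And>e. e \<in> E - level_edges E lev x \<Longrightarrow> el (lev(x := l)) e = el lev e"
    and fr: "frame {2,25} s t" and t: "t 24 0 = x" "t 25 0 = 4 ^ lev x" "t 2 = (s 2)(x := 4 ^ l - 1)"
  defines "N \<equiv> level_edges E lev x"
  shows "ok B (SEQ take_out put_back) t (750 * real f * real (card N) + 60) (\<lambda>s' _. represents E (lev(x := l)) s' \<and> header n M s' \<and>
    stack n 10 (U \<union> touched N) s' \<and> stack n 13 (D \<union> touched N) s')"
proof -
  have E: "E \<subseteq> Edges" and core: "core n M (Inc n E) s" and s2: "\<And>v. v < n \<Longrightarrow> Suc (s 2 v) = 4 ^ lev v \<and> Suc (s 2 v) \<le> 4 * M"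
    and s4: "\<And>e. e \<in> E \<Longrightarrow> s 4 e = 4 ^ el lev e" and s3: "\<And>e. e \<in> E \<Longrightarrow> s 3 e = 1"
    using rep by (auto simp: represents_def)
  have t4: "t 4 = s 4" "t 3 = s 3" using fr by (auto simp: frameD)
  have Neq: "N = {e \<in> E. x \<in> nds e \<and> t 4 e = 4 ^ lev x}"
    unfolding N_def level_edges_def t4 using s4 by auto
  have NE: "N \<subseteq> E" by (auto simp: Neq)
  have "ok B take_out t (350 * real f * real (card N) + 30) (\<lambda>s' _. core n M (Inc n (E - N)) s' \<and>
     stack n 13 (D \<union> touched N) s' \<and> frame {5,6,7,8,13,14,15,17,18,19,20,22,23,26,27} t s' \<and>
     (\<exists>ys. distinct ys \<and> set ys = N \<and> s' 26 0 = length ys \<and> (\<forall>i<length ys. s' 27 i = ys ! i)))"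
    unfolding Neq
    by (rule take_out_ok[where s = t and x = x and q = "4 ^ lev x" and E = E and X = D, OF _ _ E x t(1,2)])
      (use core_frame[OF fr] core header_frame[OF fr] hdr stack_frame[OF fr, of 13] st s2[OF x] in auto)
  then show ?thesis
    unfolding ok_SEQ
  proof (rule ok_call)
    show "350 * real f * real (card N) + 30 \<le> 750 * real f * real (card N) + 60" by simp
    fix s' T'
    assume *: "core n M (Inc n (E - N)) s' \<and>
     stack n 13 (D \<union> touched N) s' \<and> frame {5,6,7,8,13,14,15,17,18,19,20,22,23,26,27} t s' \<and>
     (\<exists>ys. distinct ys \<and> set ys = N \<and> s' 26 0 = length ys \<and> (\<forall>i<length ys. s' 27 i = ys ! i))"
      and T': "750 * real f * real (card N) + 60 - (350 * real f * real (card N) + 30) \<le> T'"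
    have f1: "frame {5,6,7,8,13,14,15,17,18,19,20,22,23,26,27} t s'" using * by simp
    obtain ys where ys: "distinct ys" "set ys = N" "s' 26 0 = length ys" "\<forall>i<length ys. s' 27 i = ys ! i" using * by blast
    have lev': "Suc (s' 2 v) = 4 ^ (lev(x := l)) v \<and> Suc (s' 2 v) \<le> 4 * M" if "v < n" for v
      using s2[OF that] l frameD[OF f1, of 2] t(3) by auto
    have "ok B put_back s' (400 * real f * real (card N) + 30) (\<lambda>s'' _. core n M (Inc n E) s'' \<and>
      stack n 10 (U \<union> touched N) s'' \<and> frame {3,4,5,6,7,8,9,10,11,12,17,18,19,20,26,28} s' s'' \<and>
      (\<forall>e. s'' 4 e = (if e \<in> N then 4 ^ el (lev(x := l)) e else s' 4 e) \<and> s'' 3 e = (if e \<in> N then 1 else s' 3 e)))"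
      by (rule put_back_ok[OF _ _ E NE _ lev' ys])
        (use * header_frame[OF f1] header_frame[OF fr] hdr stack_frame[OF f1, of 10] stack_frame[OF fr, of 10] st in auto)
    then show "ok B put_back s' T' (\<lambda>s' _. represents E (lev(x := l)) s' \<and> header n M s' \<and>
        stack n 10 (U \<union> touched N) s' \<and> stack n 13 (D \<union> touched N) s')"
    proof (rule ok_call)
      show "400 * real f * real (card N) + 30 \<le> T'" using T' by simp
      fix s'' T''
      assume **: "core n M (Inc n E) s'' \<and>
      stack n 10 (U \<union> touched N) s'' \<and> frame {3,4,5,6,7,8,9,10,11,12,17,18,19,20,26,28} s' s'' \<and>
      (\<forall>e. s'' 4 e = (if e \<in> N then 4 ^ el (lev(x := l)) e else s' 4 e) \<and> s'' 3 e = (if e \<in> N then 1 else s' 3 e))"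
      then have f2: "frame {3,4,5,6,7,8,9,10,11,12,17,18,19,20,26,28} s' s''" by simp
      have "s'' 4 e = 4 ^ el (lev(x := l)) e \<and> s'' 3 e = 1" if "e \<in> E" for e
        using ** that el[of e] s4 s3 t4 frameD[OF f1, of 4] frameD[OF f1, of 3] unfolding N_def by auto
      moreover have "Suc (s'' 2 v) = 4 ^ (lev(x := l)) v \<and> Suc (s'' 2 v) \<le> 4 * M" if "v < n" for v
        using lev'[OF that] frameD[OF f2, of 2] by simp
      ultimately have "represents E (lev(x := l)) s''" using E ** unfolding represents_def by blast
      then show "represents E (lev(x := l)) s'' \<and> header n M s'' \<and>
        stack n 10 (U \<union> touched N) s'' \<and> stack n 13 (D \<union> touched N) s''"
        using ** * header_frame[OF f2] header_frame[OF f1] header_frame[OF fr] hdr stack_frame[OF f2, of 13] by auto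
    qed
  qed
qed

lemma card_touched:
  assumes "finite U" "N \<subseteq> Edges"
  shows "real (card (U \<union> touched N)) \<le> real (card U) + real f * real (card N)"
proof -
  have fin: "finite N" using assms(2) finE finite_subset by blast
  have "card (touched N) \<le> (\<Sum>e\<in>N. card (nds e))" using fin by (rule card_UN_le)
  also have "\<dots> \<le> (\<Sum>e\<in>N. f)" by (rule sum_mono) (use assms(2) nds in auto)
  finally have "card (U \<union> touched N) \<le> card U + card N * f"
    using card_Un_le[of U "touched N"] by simp
  then have "real (card (U \<union> touched N)) \<le> real (card U + card N * f)" by (simp only: of_nat_le_iff)
  then show ?thesis by (simp add: mult.commute)
qed

section \<open>Invariant and credit of the settling loop\<close>

definition settled :: "nat set \<Rightarrow> (nat \<Rightarrow> nat) \<Rightarrow> bool" where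
  "settled E lev \<longleftrightarrow> (\<forall>v<n. weight E lev v < 1 \<and> (0 < lev v \<longrightarrow> 1 / (4 * real G) \<le> weight E lev v))"

text \<open>The stacks may also hold nodes that need not move; what matters is that none that has to
  move is missing.\<close>

definition settling :: "nat set \<Rightarrow> (nat \<Rightarrow> nat) \<Rightarrow> nat set \<Rightarrow> nat set \<Rightarrow> bool" where
  "settling E lev U D \<longleftrightarrow> (\<forall>v<n. weight E lev v < 2 \<and> (1 \<le> weight E lev v \<longrightarrow> v \<in> U) \<and>
     (0 < lev v \<longrightarrow> weight E lev v < 1 / (4 * real G) \<longrightarrow> v \<in> D))"

abbreviation "potential \<equiv> pot 4000 28800"

text \<open>Each stack entry carries 100 time units for its test and its removal; the 10 pays for
  the final loop test.\<close>

definition settle_inv :: "nat set \<Rightarrow> mem \<Rightarrow> real \<Rightarrow> bool" where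
  "settle_inv E s T \<longleftrightarrow> (\<exists>lev a U D. represents E lev s \<and> header n M s \<and> stack n 10 U s \<and> stack n 13 D s \<and>
     budgeted E lev a \<and> settling E lev U D \<and>
     potential E lev a + 100 * (real (card U) + real (card D)) + 10 \<le> T)"


lemma settle_invI:
  "represents E lev s \<Longrightarrow> header n M s \<Longrightarrow> stack n 10 U s \<Longrightarrow> stack n 13 D s \<Longrightarrow> budgeted E lev a \<Longrightarrow>
   settling E lev U D \<Longrightarrow> potential E lev a + 100 * (real (card U) + real (card D)) + 10 \<le> T \<Longrightarrow> settle_inv E s T"
  unfolding settle_inv_def by blast

lemma ok_WRITE_SEQ: "ok B (SEQ (WRITE a x y) c) s T Q \<longleftrightarrow> fits B x s \<and> fits B y s \<and> real (acost x + acost y + 1) \<le> T \<and>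
   ok B c (s(a := (s a)(aval x s := aval y s))) (T - real (acost x + acost y + 1)) Q"
  by (simp only: ok_SEQ ok_WRITE)

lemma represents_level:
  "represents E lev s \<Longrightarrow> v < n \<Longrightarrow> Suc (s 2 v) = 4 ^ lev v \<and> (4::nat) ^ lev v \<le> 4 * M"
  unfolding represents_def by metis

text \<open>The situation after \<open>x\<close> has been selected. The credit may lie 40 below what
  \<open>settle_inv\<close> guarantees, which covers the tests of the current iteration.\<close>

context
  fixes E lev a U D s x T
  assumes rep: "represents E lev s" and hdr: "header n M s" and st: "stack n 10 U s" "stack n 13 D s"
    and bud: "budgeted E lev a" and stl: "settling E lev U D" and x: "x < n" "s 24 0 = x"
    and T: "potential E lev a + 100 * (real (card U) + real (card D)) - 30 \<le> T"
    and Gf: "G = 100 * f ^ 2"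
begin

lemma E_edges: "E \<subseteq> Edges" using rep by (simp add: represents_def)

lemma stacks_after:
  defines "N \<equiv> level_edges E lev x"
  shows "real (card (U \<union> touched N)) + real (card (D \<union> touched N)) \<le> real (card U) + real (card D) + 2 * (real f * real (card N))"
proof -
  have "N \<subseteq> Edges" using E_edges by (auto simp: N_def level_edges_def)
  then show ?thesis using card_touched[of U N] card_touched[of D N] stack_top(3)[OF st(1)] stack_top(3)[OF st(2)] by linarith
qed

lemma G_big: "1 / (4 * real G) < 1/4" "4 \<le> real G"
proof -
  have "1 \<le> real f ^ 2" using f_pos by (simp add: one_le_power)
  then show "4 \<le> real G" unfolding Gf by simp
  then show "1 / (4 * real G) < 1/4" by (simp add: field_simps)
qed

text \<open>The released \<open>2800 * f * 4 ^ lev x\<close> pays \<open>750 * f\<close> for each of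
  at most \<open>2 * 4 ^ lev x\<close> hyperedges and 100 for each of at most \<open>2 * f\<close>
  new stack entries per hyperedge, together \<open>1900 * f * 4 ^ lev x\<close>, and the constant
  overhead.\<close>

lemma level_up_ok:
  assumes heavy: "1 \<le> weight E lev x"
  shows "ok B (change_level (Op Mul (var 25) (Const 4))) s T (settle_inv E)"
proof -
  let ?N = "level_edges E lev x" and ?l = "Suc (lev x)"
  let ?lev = "lev(x := ?l)"
  have x': "x \<in> {..<n}" using x by simp
  have heavy2: "weight E lev x < 2" using stl x by (simp add: settling_def)
  note up = pot_up[where K = 4000 and \<kappa> = 28800, OF E_edges x' bud _ _ heavy heavy2]
  have "4 ^ lev x \<le> M" by (rule max_level_bound[OF E_edges heavy card_le_M[OF E_edges]])
  then have lM: "4 ^ ?l \<le> 4 * M" "4 ^ lev x * 4 \<le> 4 * M" by auto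
  have lx: "Suc (s 2 x) = 4 ^ lev x" "(4::nat) ^ lev x \<le> 4 * M" using represents_level[OF rep x(1)] by auto
  define t where "t = s(25 := (s 25)(0 := 4 ^ lev x), 2 := (s 2)(x := 4 ^ lev x * 4 - Suc 0))"
  have mv: "ok B (SEQ take_out put_back) t (750 * real f * real (card ?N) + 60) (\<lambda>s' _. represents E ?lev s' \<and> header n M s' \<and>
    stack n 10 (U \<union> touched ?N) s' \<and> stack n 13 (D \<union> touched ?N) s')"
  proof (rule move_ok[OF rep hdr x(1) st lM(1)])
    show "el ?lev e = el lev e" if "e \<in> E - ?N" for e
      using that el_up[of e lev x] E_edges by (auto simp: level_edges_def)
  qed (use x in \<open>auto simp: t_def frame_def mult.commute\<close>)
  have settling': "settling E ?lev (U \<union> touched ?N) (D \<union> touched ?N)"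
    unfolding settling_def
  proof (intro allI impI conjI)
    fix v assume v: "v < n"
    have le: "weight E ?lev v \<le> weight E lev v" using up(3)[of v] by simp
    show "weight E ?lev v < 2" using le stl v by (force simp: settling_def)
    show "v \<in> U \<union> touched ?N" if "1 \<le> weight E ?lev v" using le stl v that by (force simp: settling_def)
    show "v \<in> D \<union> touched ?N" if a: "0 < ?lev v" "weight E ?lev v < 1 / (4 * real G)"
    proof (cases "v \<in> touched ?N")
      case False
      then have "weight E ?lev v = weight E lev v" using up(6)[of v] by simp
      \<comment> \<open>\<open>x\<close> may only now have reached a positive level, but its weight
        is still at least \<open>1/4\<close>.\<close>
      moreover have "v \<noteq> x" using up(5) a(2) G_big(1) by auto
      ultimately show ?thesis using a stl v by (auto simp: settling_def)
    qed simp
  qed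
  have key: "ok B (SEQ take_out put_back) t T' (settle_inv E)" if T': "T - 20 \<le> T'" for T'
  proof (rule ok_call[OF mv])
    have f1: "1 * 1 \<le> real f * 4 ^ lev x" using f_pos by (intro mult_mono) auto
    have "real f * real (card ?N) \<le> real f * (2 * 4 ^ lev x)" using up(4) by (intro mult_left_mono) auto
    then have N: "real f * real (card ?N) \<le> 2 * (real f * 4 ^ lev x)" by simp
    have pot: "potential E ?lev a + 2800 * (real f * 4 ^ lev x) \<le> potential E lev a" using up(2) by simp
    have pot0: "0 \<le> potential E ?lev a" by (rule pot_nonneg) auto
    show "750 * real f * real (card ?N) + 60 \<le> T'" using T T' pot pot0 N f1 by simp
    fix s' T''
    assume *: "represents E ?lev s' \<and> header n M s' \<and>
      stack n 10 (U \<union> touched ?N) s' \<and> stack n 13 (D \<union> touched ?N) s'"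
      and T'': "T' - (750 * real f * real (card ?N) + 60) \<le> T''"
    have "potential E ?lev a + 100 * (real (card (U \<union> touched ?N)) + real (card (D \<union> touched ?N))) + 10 \<le> T''"
      using T T' T'' pot N f1 stacks_after by simp
    with * settling' up(1) show "settle_inv E s' T''" by (intro settle_invI) auto
  qed
  have "40 \<le> T"
  proof -
    have "1 * 1 \<le> real f * 4 ^ lev x" using f_pos by (intro mult_mono) auto
    moreover have "0 \<le> potential E ?lev a" by (rule pot_nonneg) auto
    ultimately show ?thesis using T up(2) by simp
  qed
  moreover have "4 ^ lev x < B" "4 ^ lev x * 4 < B" "s 2 x < B" "4 ^ lev x * 4 - Suc 0 < B" "4 < B"
    using small(1)[OF lx(2)] small(1)[OF lM(2)] lx(1) small(1)[of 4] M_pos by auto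
  ultimately show ?thesis
    using key[unfolded t_def] x unfolding change_level_def
    by (simp add: ok_WRITE_SEQ small lx)
qed

text \<open>As \<open>U\<close> is empty, all weights are below 1 before the move and hence below 2
  after it. \<open>x\<close> has to be in \<open>D\<close>, since it may still be too light on its
  new level.\<close>

lemma level_down_ok:
  assumes light: "weight E lev x < 1 / (4 * real G)" and pos: "0 < lev x" and U: "U = {}" and xD: "x \<in> D"
  shows "ok B (change_level (Op Div (var 25) (Const 4))) s T (settle_inv E)"
proof -
  obtain l where l: "lev x = Suc l" using pos by (cases "lev x") auto
  let ?N = "level_edges E lev x"
  let ?lev = "lev(x := l)"
  have x': "x \<in> {..<n}" using x by simp
  note dn = pot_down[where K = 4000 and \<kappa> = 28800, OF E_edges x' bud _ _ G_big(2) light l]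
  have lx: "Suc (s 2 x) = 4 ^ lev x" "(4::nat) ^ lev x \<le> 4 * M" using represents_level[OF rep x(1)] by auto
  have div: "4 ^ lev x div 4 = (4::nat) ^ l" by (simp add: l)
  then have lM: "4 ^ l \<le> 4 * M" using lx(2) by (metis div_le_dividend le_trans)
  define t where "t = s(25 := (s 25)(0 := 4 ^ lev x), 2 := (s 2)(x := 4 ^ l - Suc 0))"
  have mv: "ok B (SEQ take_out put_back) t (750 * real f * real (card ?N) + 60) (\<lambda>s' _. represents E ?lev s' \<and> header n M s' \<and>
    stack n 10 (U \<union> touched ?N) s' \<and> stack n 13 (D \<union> touched ?N) s')"
  proof (rule move_ok[OF rep hdr x(1) st lM(1)])
    show "el ?lev e = el lev e" if "e \<in> E - ?N" for e
      using that el_down(1)[of e lev x l] E_edges l by (auto simp: level_edges_def)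
  qed (use x in \<open>auto simp: t_def frame_def\<close>)
  have settling': "settling E ?lev (U \<union> touched ?N) (D \<union> touched ?N)"
    unfolding settling_def
  proof (intro allI impI conjI)
    fix v assume v: "v < n"
    have ge: "weight E lev v \<le> weight E ?lev v" using dn(2)[of v] by simp
    have 1: "weight E lev v < 1" using stl v U by (force simp: settling_def)
    show "weight E ?lev v < 2" using 1 dn(3)[of v] by simp
    show "v \<in> U \<union> touched ?N" if "1 \<le> weight E ?lev v"
    proof (rule ccontr)
      assume "v \<notin> U \<union> touched ?N"
      then have "weight E ?lev v = weight E lev v" using dn(5)[of v] by simp
      then show False using 1 that by simp
    qed
    show "v \<in> D \<union> touched ?N" if a: "0 < ?lev v" "weight E ?lev v < 1 / (4 * real G)"
      using a ge stl v xD by (cases "v = x") (force simp: settling_def)+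
  qed
  obtain a' where bud': "budgeted E ?lev a'" and
    "potential E ?lev a' + (4000 / 8 - 28800 * real f * real f / (4 * real G)) * 4 ^ lev x \<le> potential E lev a"
    using dn(1) by auto
  \<comment> \<open>Here \<open>G\<close> has to grow like \<open>f\<^sup>2\<close>: the credit
    passed to other nodes shrinks to a constant times \<open>4 ^ lev x\<close>, and
    \<open>4000 / 8 - 72 = 428\<close>.\<close>
  moreover have "28800 * real f * real f / (4 * real G) = 72"
    using f_pos by (simp add: Gf power2_eq_square)
  ultimately have pot: "potential E ?lev a' + 428 * 4 ^ lev x \<le> potential E lev a" by simp
  have f1: "1 \<le> (4::real) ^ lev x" by simp
  \<comment> \<open>\<open>950\<close> is the time factor 750 plus two stack entries of 100
    each.\<close>
  have N: "950 * (real f * real (card ?N)) \<le> 10 * 4 ^ lev x"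
  proof -
    have "real f * real (card ?N) \<le> real f * (4 ^ lev x / (4 * real G))" using dn(4) by (intro mult_left_mono) auto
    also have "\<dots> = 4 ^ lev x / (400 * real f)" using f_pos by (simp add: Gf power2_eq_square)
    also have "\<dots> \<le> 4 ^ lev x / (400 * 1)" using f_pos by (intro divide_left_mono mult_left_mono) auto
    finally have "400 * (real f * real (card ?N)) \<le> 4 ^ lev x" by simp
    moreover have "0 \<le> real f * real (card ?N)" by simp
    ultimately show ?thesis by linarith
  qed
  have pot0: "0 \<le> potential E ?lev a'" by (rule pot_nonneg) auto
  have key: "ok B (SEQ take_out put_back) t T' (settle_inv E)" if T': "T - 20 \<le> T'" for T'
  proof (rule ok_call[OF mv])
    have "0 \<le> real f * real (card ?N)" "750 * real f * real (card ?N) = 750 * (real f * real (card ?N))"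
      "0 \<le> real (card U) + real (card D)" by simp_all
    moreover have "750 * y + 60 \<le> T'" if "0 \<le> y" "950 * y \<le> 10 * X" "1 \<le> X" "p' + 428 * X \<le> p" "0 \<le> p'" "0 \<le> c" "p + 100 * c - 30 \<le> T"
      for y X p p' c :: real using that T' by linarith
    ultimately show "750 * real f * real (card ?N) + 60 \<le> T'" using N f1 pot pot0 T by metis
    fix s' T''
    assume *: "represents E ?lev s' \<and> header n M s' \<and>
      stack n 10 (U \<union> touched ?N) s' \<and> stack n 13 (D \<union> touched ?N) s'"
      and T'': "T' - (750 * real f * real (card ?N) + 60) \<le> T''"
    have "p' + 100 * c' + 10 \<le> T''" if "0 \<le> y" "950 * y \<le> 10 * X" "1 \<le> X" "p' + 428 * X \<le> p" "p + 100 * c - 30 \<le> T"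
        "T' - (750 * y + 60) \<le> T''" "c' \<le> c + 2 * y" for y X p p' c c' :: real
      using that T' by linarith
    moreover have "0 \<le> real f * real (card ?N)" "T' - (750 * (real f * real (card ?N)) + 60) \<le> T''" using T'' by (simp_all add: mult.assoc)
    ultimately have "potential E ?lev a' + 100 * (real (card (U \<union> touched ?N)) + real (card (D \<union> touched ?N))) + 10 \<le> T''"
      using N f1 pot T stacks_after by metis
    with * settling' bud' show "settle_inv E s' T''" by (intro settle_invI) auto
  qed
  have "40 \<le> T"
  proof -
    have "40 \<le> T" if "1 \<le> X" "p' + 428 * X \<le> p" "0 \<le> p'" "0 \<le> c" "p + 100 * c - 30 \<le> T" for X p p' c :: real
      using that by linarith
    moreover have "0 \<le> real (card U) + real (card D)" by simp
    ultimately show ?thesis using f1 pot pot0 T by metis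
  qed
  moreover have "4 ^ lev x < B" "4 ^ l < B" "s 2 x < B" "4 ^ l - Suc 0 < B" "4 < B"
    using small(1)[OF lx(2)] small(1)[OF lM(1)] lx(1) small(1)[of 4] M_pos by auto
  ultimately show ?thesis
    using key[unfolded t_def] x unfolding change_level_def
    by (simp add: ok_WRITE_SEQ small lx div)
qed

end


lemma pop_ok:
  assumes st: "stack n a X s" and k: "card X = Suc k" and x: "s 24 0 = s a k" and T: "10 \<le> T" and a: "a < 20"
    and Q: "\<And>s'. stack n a (X - {s a k}) s' \<Longrightarrow> frame {Suc a, Suc (Suc a)} s s' \<Longrightarrow> Q s' (T - 10)"
  shows "ok B (pop a) s T Q"
proof -
  let ?s = "s(Suc a := (s (Suc a))(s a k := 0), Suc (Suc a) := (s (Suc (Suc a)))(0 := k))"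
  have "Q ?s (T - 10)" by (rule Q[OF stack_pop[OF st k]]) (simp add: frame_def)
  moreover have "s a k < B" "k < B" "Suc k < B"
    using stack_top[OF st] k small(7,9) by force+
  moreover have "s (Suc (Suc a)) 0 = Suc k" using stack_top(1)[OF st] k by simp
  ultimately show ?thesis using x T a by (simp add: pop_def ok_SEQ ok_WRITE small)
qed

lemma settle_ok:
  assumes inv: "settle_inv E s T" and Gf: "G = 100 * f ^ 2"
  shows "ok B (settle G) s T (\<lambda>s' T'. \<exists>lev a. represents E lev s' \<and> header n M s' \<and> stack n 10 {} s' \<and> stack n 13 {} s' \<and>
    budgeted E lev a \<and> settled E lev \<and> potential E lev a \<le> T')"
  unfolding settle_def
proof (rule ok_WHILE[where I = "settle_inv E", OF _ inv])
  fix s :: mem and T :: real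
  assume "settle_inv E s T"
  then obtain lev a U D where rep: "represents E lev s" and hdr: "header n M s" and st: "stack n 10 U s" "stack n 13 D s"
    and bud: "budgeted E lev a" and stl: "settling E lev U D" and T: "potential E lev a + 100 * (real (card U) + real (card D)) + 10 \<le> T"
    unfolding settle_inv_def by blast
  have pot0: "0 \<le> potential E lev a" by (rule pot_nonneg) auto
  note stU = stack_top[OF st(1), simplified] and stD = stack_top[OF st(2), simplified]
  have nB: "card U < B" "card D < B" "card U + card D < B"
  proof -
    have "M \<le> M ^ 3" using M_powers(1,2) by linarith
    then show "card U < B" "card D < B" "card U + card D < B" using stU(4) stD(4) n_M by (auto intro!: bound6)
  qed
  have sub: "real (card (X - {y})) = real (card X) - 1" if "finite X" "y \<in> X" for X and y :: nat
    using that by (simp add: card_Diff_singleton) (metis One_nat_def Suc_leI card_gt_0_iff empty_iff of_nat_1 of_nat_diff)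
  let ?upper = "SEQ (WRITE 24 (Const 0) (Read 10 (Op Sub (var 12) (Const 1))))
         (IF (Op Less (Read 8 (var 24)) (Op Add (Read 9 (var 24)) (Const 1)))
            (pop 10) (change_level (Op Mul (var 25) (Const 4))))"
  let ?lower = "SEQ (WRITE 24 (Const 0) (Read 13 (Op Sub (var 15) (Const 1))))
         (IF (Op Mul (Op Less (Const 0) (Read 2 (var 24)))
                 (Op Less (Op Mul (Read 8 (var 24)) (Const (4 * G))) (Op Add (Read 9 (var 24)) (Const 1))))
            (change_level (Op Div (var 25) (Const 4))) (pop 13))"
  have upper: "ok B ?upper s (T - 9) (settle_inv E)" if U: "U \<noteq> {}"
  proof -
    obtain k where k: "card U = Suc k" using U stU(3) by (metis card_gt_0_iff gr0_implies_Suc)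
    define x where "x = s 10 k"
    have xU: "x \<in> U" using stU(5)[OF k] by (simp add: x_def)
    then have x: "x < n" using stU(2) by auto
    have kB: "k < B" "Suc k < B" using nB(1) k by auto
    define s1 where "s1 = s(24 := (s 24)(0 := x))"
    have fr: "frame {24} s s1" by (simp add: frame_def s1_def)
    have rep1: "represents E lev s1" "header n M s1" "stack n 10 U s1" "stack n 13 D s1"
      using rep hdr st represents_frame[OF fr] header_frame[OF fr] stack_frame[OF fr] by auto
    note ws = stored_weights_small[OF conjunct1[OF conjunct2[OF rep1(1)[unfolded represents_def]]] x]
    have T40: "80 \<le> T" using T pot0 k by simp
    have "ok B (IF (Op Less (Read 8 (var 24)) (Op Add (Read 9 (var 24)) (Const 1)))
            (pop 10) (change_level (Op Mul (var 25) (Const 4)))) s1 (T - 16) (settle_inv E)"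
    proof (cases "weight E lev x < 1")
      case True
      have "ok B (pop 10) s1 (T - 26) (settle_inv E)"
      proof (rule pop_ok[OF rep1(3) k])
        show "s1 24 0 = s1 10 k" by (simp add: s1_def x_def)
        fix s'
        assume st': "stack n 10 (U - {s1 10 k}) s'" and fr': "frame {Suc 10, Suc (Suc 10)} s1 s'"
        have "settling E lev (U - {x}) D" using stl True by (auto simp: settling_def)
        moreover have "real (card (U - {x})) = real (card U) - 1" using sub[OF stU(3) xU] .
        ultimately show "settle_inv E s' (T - 26 - 10)"
          using st' represents_frame[OF fr'] header_frame[OF fr'] stack_frame[OF fr', of 13] rep1 bud T
          by (intro settle_invI[of E lev s' "U - {x}" D a]) (auto simp: s1_def x_def)
      qed (use T40 in auto)
      then show ?thesis
        using weight_tests(1)[OF rep1(1) x] True ws(1,2) Suc_lessD[OF ws(2)] small T40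
        by (simp add: ok_IF s1_def small(9)[OF x])
    next
      case False
      have "ok B (change_level (Op Mul (var 25) (Const 4))) s1 (T - 26) (settle_inv E)"
        by (rule level_up_ok[OF rep1 bud stl x _ _ Gf]) (use T False in \<open>auto simp: s1_def\<close>)
      then show ?thesis
        using weight_tests(1)[OF rep1(1) x] False ws(1,2) Suc_lessD[OF ws(2)] small T40
        by (simp add: ok_IF s1_def small(9)[OF x])
    qed
    then show ?thesis
      using stU(1) k kB T40 small(9)[OF x] by (simp add: ok_WRITE_SEQ small x_def[symmetric] s1_def)
  qed
  have lower: "ok B ?lower s (T - 9) (settle_inv E)" if U: "U = {}" and D: "D \<noteq> {}"
  proof -
    obtain k where k: "card D = Suc k" using D stD(3) by (metis card_gt_0_iff gr0_implies_Suc)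
    define x where "x = s 13 k"
    have xD: "x \<in> D" using stD(5)[OF k] by (simp add: x_def)
    then have x: "x < n" using stD(2) by auto
    have kB: "k < B" "Suc k < B" using nB(2) k by auto
    define s1 where "s1 = s(24 := (s 24)(0 := x))"
    have fr: "frame {24} s s1" by (simp add: frame_def s1_def)
    have rep1: "represents E lev s1" "header n M s1" "stack n 10 U s1" "stack n 13 D s1"
      using rep hdr st represents_frame[OF fr] header_frame[OF fr] stack_frame[OF fr] by auto
    note ws = stored_weights_small[OF conjunct1[OF conjunct2[OF rep1(1)[unfolded represents_def]]] x]
    have T40: "80 \<le> T" using T pot0 k by simp
    have lx: "Suc (s1 2 x) = 4 ^ lev x" "(4::nat) ^ lev x \<le> 4 * M" using represents_level[OF rep1(1) x] by auto
    then have sB: "s1 2 x < B" using small(1)[of "Suc (s1 2 x)"] by simp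
    have lev0: "0 < s1 2 x \<longleftrightarrow> 0 < lev x" using lx(1) by (cases "s1 2 x"; cases "lev x") auto
    have GB: "4 * G < B"
    proof -
      have "4 * G * 1 \<le> 64 * G * M ^ 3" using M_powers by (intro mult_le_mono) auto
      also note B
      finally show ?thesis by simp
    qed
    let ?b = "Op Mul (Op Less (Const 0) (Read 2 (var 24)))
                 (Op Less (Op Mul (Read 8 (var 24)) (Const (4 * G))) (Op Add (Read 9 (var 24)) (Const 1)))"
    have b: "fits B ?b s1" "acost ?b = 17" "aval ?b s1 \<noteq> 0 \<longleftrightarrow> 0 < lev x \<and> weight E lev x < 1 / (4 * real G)"
    proof -
      have s24: "s1 24 0 = x" by (simp add: s1_def)
      show "fits B ?b s1" "acost ?b = 17"
        using ws(1,2,4) Suc_lessD[OF ws(2)] small small(9)[OF x] GB sB by (simp_all add: s24)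
      show "aval ?b s1 \<noteq> 0 \<longleftrightarrow> 0 < lev x \<and> weight E lev x < 1 / (4 * real G)"
        using weight_tests(2)[OF rep1(1) x] lev0 by (simp add: s24)
    qed
    have "ok B (IF ?b (change_level (Op Div (var 25) (Const 4))) (pop 13)) s1 (T - 16) (settle_inv E)"
    proof (cases "0 < lev x \<and> weight E lev x < 1 / (4 * real G)")
      case True
      have "ok B (change_level (Op Div (var 25) (Const 4))) s1 (T - 34) (settle_inv E)"
        by (rule level_down_ok[OF rep1 bud stl x _ _ Gf]) (use T True U xD in \<open>auto simp: s1_def\<close>)
      then show ?thesis using b True by (simp only: ok_IF) simp
    next
      case False
      have "ok B (pop 13) s1 (T - 34) (settle_inv E)"
      proof (rule pop_ok[OF rep1(4) k])
        show "s1 24 0 = s1 13 k" by (simp add: s1_def x_def)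
        fix s'
        assume st': "stack n 13 (D - {s1 13 k}) s'" and fr': "frame {Suc 13, Suc (Suc 13)} s1 s'"
        have "settling E lev U (D - {x})" using stl False by (auto simp: settling_def)
        moreover have "real (card (D - {x})) = real (card D) - 1" using sub[OF stD(3) xD] .
        ultimately show "settle_inv E s' (T - 34 - 10)"
          using st' represents_frame[OF fr'] header_frame[OF fr'] stack_frame[OF fr', of 10] rep1 bud T
          by (intro settle_invI[of E lev s' U "D - {x}" a]) (auto simp: s1_def x_def)
      qed (use T40 in auto)
      then show ?thesis using b False by (simp only: ok_IF) simp
    qed
    then show ?thesis
      using stD(1) k kB T40 small(9)[OF x] by (simp add: ok_WRITE_SEQ small x_def[symmetric] s1_def)
  qed
  let ?g = "Op Add (var 12) (var 15)"
  have g: "fits B ?g s" "acost ?g = 5" "aval ?g s = card U + card D" "fits B (var 12) s" "aval (var 12) s = card U" "acost (var 12) = 2"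
    using stU(1) stD(1) nB small by simp_all
  show "fits B ?g s \<and> (if aval ?g s \<noteq> 0 then ok B (IF (var 12) ?upper ?lower) s (T - real (acost ?g + 1)) (settle_inv E)
     else real (acost ?g + 1) \<le> T \<and> (\<exists>lev a. represents E lev s \<and> header n M s \<and> stack n 10 {} s \<and> stack n 13 {} s \<and>
       budgeted E lev a \<and> settled E lev \<and> potential E lev a \<le> T - real (acost ?g + 1)))"
  proof (cases "U = {} \<and> D = {}")
    case True
    then have "settled E lev" using stl by (force simp: settling_def settled_def)
    then show ?thesis using True g rep hdr st bud T pot0 by (auto intro!: exI[of _ lev] exI[of _ a])
  next
    case False
    then have "card U + card D \<noteq> 0" using stU(3) stD(3) by auto
    moreover have "ok B (IF (var 12) ?upper ?lower) s (T - 6) (settle_inv E)"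
    proof (cases "U = {}")
      case True
      then have "aval (var 12) s = 0" "ok B ?lower s (T - 9) (settle_inv E)" using g lower False by auto
      then show ?thesis unfolding ok_IF using g by simp
    next
      case U: False
      then have "aval (var 12) s \<noteq> 0" "ok B ?upper s (T - 9) (settle_inv E)" using g upper stU(3) by auto
      then show ?thesis unfolding ok_IF using g by simp
    qed
    ultimately show ?thesis using g by simp
  qed
qed

end

section \<open>Processing an update\<close>

text \<open>The power is unrolled into one expression; the program may depend on \<open>f\<close>,
  but has to read \<open>n\<close> from memory.\<close>

fun power_exp :: "nat \<Rightarrow> aexp" where
  "power_exp 0 = Const 1"
| "power_exp (Suc k) = Op Mul (Op Add (var 0) (Const 1)) (power_exp k)"

lemma power_exp:
  assumes "s 0 0 = n" "Suc n ^ f < B" "0 < n" "n + 1 < B" "k \<le> f"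
  shows "aval (power_exp k) s = Suc n ^ k \<and> acost (power_exp k) = 5 * k + 1 \<and> fits B (power_exp k) s"
  using assms(5)
proof (induction k)
  case (Suc k)
  have "Suc n ^ Suc k \<le> Suc n ^ f" using Suc.prems by (intro power_increasing) auto
  then have "Suc n ^ Suc k < B" using assms(2) by (rule le_less_trans)
  then show ?case using Suc assms by simp
qed (use assms in simp)

text \<open>Horner's scheme, starting from the largest node so that the smallest becomes the lowest
  digit.\<close>

definition read_code :: com where
  "read_code = SEQ (WRITE 17 (Const 0) (Const 0)) (SEQ (WRITE 26 (Const 0) (Read 0 (Const 2)))
     (WHILE (var 26) (SEQ (WRITE 26 (Const 0) (Op Sub (var 26) (Const 1)))
       (WRITE 17 (Const 0) (Op Add (Op Mul (var 17) (Op Add (var 0) (Const 1))) (Op Add (Read 1 (var 26)) (Const 1)))))))"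

definition update_program :: "nat \<Rightarrow> com" where
  "update_program f = SEQ (WRITE 16 (Const 0) (power_exp f))
     (SEQ read_code
     (SEQ (IF (Read 0 (Const 1)) attach (for_nodes remove_pair))
          (settle (100 * f ^ 2))))"

lemma read_code_ok:
  assumes s: "s 0 0 = n" "s 0 2 = length xs" "\<And>i. i < length xs \<Longrightarrow> s 1 i = xs ! i"
    and xs: "set xs \<subseteq> {..<n}" and B: "Suc n ^ length xs \<le> B" "n + 2 < B" "length xs + 2 < B"
  shows "ok B read_code s (50 * real (length xs) + 30) (\<lambda>s' _. s' 17 0 = horner_sum Suc (Suc n) xs \<and> frame {17,26} s s')"
proof -
  let ?body = "SEQ (WRITE 26 (Const 0) (Op Sub (var 26) (Const 1)))
       (WRITE 17 (Const 0) (Op Add (Op Mul (var 17) (Op Add (var 0) (Const 1))) (Op Add (Read 1 (var 26)) (Const 1))))"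
  have loop: "ok B (WHILE (var 26) ?body) s' (50 * real k + 5) (\<lambda>s' _. s' 17 0 = horner_sum Suc (Suc n) xs \<and> frame {17,26} s s')"
    if "frame {17,26} s s'" "s' 26 0 = k" "k \<le> length xs" "s' 17 0 = horner_sum Suc (Suc n) (drop k xs)" for s' k
    using that
  proof (induction k arbitrary: s')
    case 0
    then show ?case using B by (intro ok_WHILE_unfold) auto
  next
    case (Suc k)
    let ?h = "horner_sum Suc (Suc n) (drop (Suc k) xs)" and ?x = "xs ! k"
    have x: "?x < n" using xs Suc.prems(3) nth_mem[of k xs] by (auto simp del: nth_mem)
    have "drop k xs = ?x # drop (Suc k) xs" using Suc.prems(3) by (simp add: Cons_nth_drop_Suc)
    then have h: "horner_sum Suc (Suc n) (drop k xs) = Suc ?x + Suc n * ?h" by simp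
    \<comment> \<open>Intermediate values are codes of suffixes of the node list, so they obey the
      bound for the whole code.\<close>
    have "horner_sum Suc (Suc n) (drop k xs) < Suc n ^ length (drop k xs)"
      by (rule horner_less) (use xs set_drop_subset[of k xs] in auto)
    also have "\<dots> \<le> Suc n ^ length xs" by (rule power_increasing) auto
    finally have hB: "Suc ?x + Suc n * ?h < B" using B(1) unfolding h by linarith
    have b: "?h < B" "Suc n * ?h < B" "?h * Suc n < B" "?h * Suc n + Suc ?x < B" "?x < B" "Suc ?x < B" "k < B" "Suc k < B" "Suc n < B" "n < B"
    proof -
      have "?h \<le> Suc n * ?h" by simp
      then show "?h < B" "Suc n * ?h < B" "?h * Suc n < B" "?h * Suc n + Suc ?x < B" "?x < B" "Suc ?x < B" "k < B" "Suc k < B" "Suc n < B" "n < B"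
        using hB x B Suc.prems(3) by (linarith | simp add: mult.commute)+
    qed
    have s': "s' 0 = s 0" "s' 1 = s 1" using Suc.prems(1) by (auto simp: frameD)
    define t where "t = s'(26 := (s' 26)(0 := k), 17 := (s' 17)(0 := ?h * Suc n + Suc ?x))"
    have "ok B (WHILE (var 26) ?body) t (50 * real k + 5) (\<lambda>s' _. s' 17 0 = horner_sum Suc (Suc n) xs \<and> frame {17,26} s s')"
    proof (rule Suc.IH)
      show "frame {17,26} s t" using Suc.prems(1) by (simp add: frame_def t_def)
      show "t 17 0 = horner_sum Suc (Suc n) (drop k xs)" unfolding h by (simp add: t_def)
    qed (use Suc.prems in \<open>simp_all add: t_def\<close>)
    then have "ok B (WHILE (var 26) ?body) t T (\<lambda>s' _. s' 17 0 = horner_sum Suc (Suc n) xs \<and> frame {17,26} s s')"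
      if "50 * real k + 5 \<le> T" for T by (rule ok_call[OF _ that]) auto
    then show ?case
      using Suc.prems s s' b by (intro ok_WHILE_unfold) (simp_all add: ok_SEQ ok_WRITE t_def)
  qed
  define t where "t = s(17 := (s 17)(0 := 0), 26 := (s 26)(0 := length xs))"
  have "ok B (WHILE (var 26) ?body) t (50 * real (length xs) + 5) (\<lambda>s' _. s' 17 0 = horner_sum Suc (Suc n) xs \<and> frame {17,26} s s')"
    by (rule loop) (simp_all add: t_def frame_def)
  then have "ok B (WHILE (var 26) ?body) t T (\<lambda>s' _. s' 17 0 = horner_sum Suc (Suc n) xs \<and> frame {17,26} s s')"
    if "50 * real (length xs) + 5 \<le> T" for T by (rule ok_call[OF _ that]) auto
  then show ?thesis using s B unfolding read_code_def by (simp add: ok_SEQ ok_WRITE t_def)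
qed

section \<open>Amortized cost of a single update\<close>

context algorithm
begin

text \<open>The state between updates; \<open>\<Phi>\<close> is unspent credit that covers the
  potential. \<open>header\<close> is absent because every update recomputes \<open>M\<close>, so
  the initial memory qualifies too.\<close>

definition steady :: "nat set \<Rightarrow> mem \<Rightarrow> real \<Rightarrow> bool" where
  "steady E s \<Phi> \<longleftrightarrow> s 0 0 = n \<and> (\<exists>lev a. represents E lev s \<and> stack n 10 {} s \<and> stack n 13 {} s \<and>
     budgeted E lev a \<and> settled E lev \<and> potential E lev a \<le> \<Phi>)"

context
  assumes Gf: "G = 100 * f ^ 2" and Mf: "M = Suc n ^ f"
begin

lemma edge_index_code:
  assumes "hyperedge {..<n} f e"
  shows "digs n (edge_index n e) = sorted_list_of_set e" "edge_index n e \<in> Edges" "nds (edge_index n e) = e"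
proof -
  have e: "finite e" "e \<noteq> {}" "e \<subseteq> {..<n}" "card e \<le> f" using assms finite_subset by (auto simp: hyperedge_def)
  show d: "digs n (edge_index n e) = sorted_list_of_set e"
    unfolding edge_index_def using digs_horner[of "sorted_list_of_set e" n] e by simp
  then show "nds (edge_index n e) = e" using e by simp
  have "edge_index n e < Suc n ^ length (sorted_list_of_set e)"
    unfolding edge_index_def using horner_less[of "sorted_list_of_set e" n] e by simp
  also have "\<dots> \<le> M" unfolding Mf by (rule power_increasing) (use e in simp_all)
  finally show "edge_index n e \<in> Edges" using d e by (auto simp: edge_codes_def)
qed

text \<open>Stated for an arbitrary continuation \<open>c\<close>, so that insertion and deletion
  share the \<open>O(f)\<close> prelude.\<close>

lemma prepare_ok:
  assumes e: "hyperedge {..<n} f e" and s: "s 0 0 = n" and u: "s0 = write_input k e s"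
    and rest: "\<And>s' T'. s' 17 0 = edge_index n e \<Longrightarrow> header n M s' \<Longrightarrow> s' 0 1 = k \<Longrightarrow> frame {0,1,16,17,26} s s' \<Longrightarrow>
       T - 100 * real f \<le> T' \<Longrightarrow> ok B c s' T' Q"
    and T: "100 * real f \<le> T"
  shows "ok B (SEQ (WRITE 16 (Const 0) (power_exp f)) (SEQ read_code c)) s0 T Q"
proof -
  have s0: "s0 0 0 = n" "s0 0 1 = k" "s0 0 2 = card e" "\<And>i. i < card e \<Longrightarrow> s0 1 i = sorted_list_of_set e ! i" "frame {0,1} s s0"
    using s by (auto simp: u write_input_def frame_def)
  have e': "finite e" "e \<subseteq> {..<n}" "card e \<le> f" using e finite_subset by (auto simp: hyperedge_def)
  have cn: "card e \<le> n" using card_mono[OF _ e'(2)] by simp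
  have pe: "aval (power_exp f) s0 = M" "acost (power_exp f) = 5 * f + 1" "fits B (power_exp f) s0"
    using power_exp[of s0 n f B f] s0(1) small(2,7) n_pos by (auto simp: Mf)
  define t where "t = s0(16 := (s0 16)(0 := M))"
  have "Suc n ^ card e \<le> M" unfolding Mf by (rule power_increasing) (use e' in auto)
  then have "Suc n ^ card e \<le> B" using small(2) by simp
  then have "ok B read_code t (50 * real (length (sorted_list_of_set e)) + 30)
     (\<lambda>s' _. s' 17 0 = horner_sum Suc (Suc n) (sorted_list_of_set e) \<and> frame {17,26} t s')"
    using s0 e' cn small(7) by (intro read_code_ok) (auto simp: t_def)
  then have "ok B (SEQ read_code c) t T' Q" if T': "T - (5 * real f + 3) \<le> T'" for T'
    unfolding ok_SEQ
  proof (rule ok_call)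
    have f1: "1 \<le> real f" "real (card e) \<le> real f" using f_pos e'(3) by simp_all
    show "50 * real (length (sorted_list_of_set e)) + 30 \<le> T'"
      using T T' f1 by simp
    fix s' T''
    assume *: "s' 17 0 = horner_sum Suc (Suc n) (sorted_list_of_set e) \<and> frame {17,26} t s'"
      and T'': "T' - (50 * real (length (sorted_list_of_set e)) + 30) \<le> T''"
    have f2: "frame {17,26} t s'" using * by simp
    show "ok B c s' T'' Q"
    proof (rule rest)
      show "s' 17 0 = edge_index n e" using * by (simp add: edge_index_def)
      show "header n M s'" using s0 frameD[OF f2, of 0] frameD[OF f2, of 16] by (simp add: header_def t_def)
      show "s' 0 1 = k" using s0 frameD[OF f2, of 0] by (simp add: t_def)
      show "frame {0,1,16,17,26} s s'" using s0(5) f2 by (auto simp: frame_def t_def)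
      show "T - 100 * real f \<le> T''" using T' T'' f1 by simp
    qed
  qed
  then show ?thesis using pe small T f_pos unfolding ok_WRITE_SEQ by (simp add: t_def)
qed


lemma settle_from_steady:
  assumes rep: "represents E lev s" and hdr: "header n M s" and st: "stack n 10 U s" "stack n 13 D s"
    and bud: "budgeted E lev a" and stl: "settling E lev U D"
    and T: "potential E lev a + 100 * (real (card U) + real (card D)) + 10 \<le> T"
  shows "ok B (settle (100 * f ^ 2)) s T (steady E)"
proof -
  have "settle_inv E s T" using assms by (rule settle_invI)
  from settle_ok[OF this Gf] show ?thesis
    unfolding Gf[symmetric]
  proof (rule ok_mono)
    fix s' T'
    assume "\<exists>lev a. represents E lev s' \<and> header n M s' \<and> stack n 10 {} s' \<and> stack n 13 {} s' \<and>
      budgeted E lev a \<and> settled E lev \<and> potential E lev a \<le> T'"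
    then show "steady E s' T'" unfolding steady_def header_def by blast
  qed
qed

lemma f_squared: "1 \<le> real f" "real f \<le> real f ^ 2"
proof -
  show "1 \<le> real f" using f_pos by simp
  then show "real f \<le> real f ^ 2" by (simp add: power2_eq_square)
qed

text \<open>Of the new credit, up to \<open>28800 * f\<^sup>2\<close> becomes potential; reading,
  attaching and the stack entries need only \<open>O(f)\<close>. Only nodes of the new hyperedge can
  have reached weight 1, and these are on the stack.\<close>

lemma insert_ok:
  assumes st: "steady E s \<Phi>" and e: "hyperedge {..<n} f e" and new: "edge_index n e \<notin> E"
  shows "ok B (update_program f) (present (Insert e) s) (\<Phi> + 40000 * real f ^ 2) (steady (insert (edge_index n e) E))"
proof -
  let ?c = "edge_index n e"
  obtain lev a where s0: "s 0 0 = n" and rep: "represents E lev s" and stk: "stack n 10 {} s" "stack n 13 {} s"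
    and bud: "budgeted E lev a" and stl: "settled E lev" and pot: "potential E lev a \<le> \<Phi>"
    using st unfolding steady_def by blast
  note code = edge_index_code[OF e]
  note c = edge_code[OF code(2)]
  have E: "E \<subseteq> Edges" using rep by (simp add: represents_def)
  have pot0: "0 \<le> potential E lev a" by (rule pot_nonneg) auto
  note ins = pot_insert[OF E code(2) new bud, of 4000 28800, simplified]
  define a' where "a' = (\<lambda>v. a v + (if v \<in> nds ?c then 1 else 0))"
  have f2: "0 \<le> real f ^ 2" by simp
  show ?thesis
    unfolding update_program_def
  proof (rule prepare_ok[where s = s and k = 1, OF e s0])
    show "present (Insert e) s = write_input 1 e s" by simp
    show "100 * real f \<le> \<Phi> + 40000 * real f ^ 2" using pot pot0 f_squared by linarith
    fix s' T'
    assume s': "s' 17 0 = ?c" "header n M s'" "s' 0 1 = 1" and fr: "frame {0,1,16,17,26} s s'"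
      and T': "\<Phi> + 40000 * real f ^ 2 - 100 * real f \<le> T'"
    have rep': "represents E lev s'" "stack n 10 {} s'" "stack n 13 {} s'"
      using rep stk represents_frame[OF fr] stack_frame[OF fr] by auto
    have at: "ok B attach s' (300 * real (length (digs n ?c)) + 50) (\<lambda>s''. \<lambda>_. core n M (Inc n E \<union> {?c} \<times> nds ?c) s'' \<and>
       s'' 4 = (s' 4)(?c := 4 ^ Max (lev ` nds ?c)) \<and> s'' 3 = (s' 3)(?c := 1) \<and>
       stack n 10 ({} \<union> nds ?c) s'' \<and> frame attach_arrays s' s'')"
      by (rule attach_ok) (use rep' s' c new in \<open>auto simp: represents_def Inc_def\<close>)
    have "ok B (SEQ attach (settle (100 * f ^ 2))) s' T'' (steady (insert ?c E))" if T'': "T' - 10 \<le> T''" for T''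
      unfolding ok_SEQ
    proof (rule ok_call[OF at])
      show "300 * real (length (digs n ?c)) + 50 \<le> T''"
        using c T' T'' pot pot0 f_squared of_nat_mono[of "length (digs n ?c)" f, where 'a = real] by linarith
      fix t T
      assume *: "core n M (Inc n E \<union> {?c} \<times> nds ?c) t \<and>
       t 4 = (s' 4)(?c := 4 ^ Max (lev ` nds ?c)) \<and> t 3 = (s' 3)(?c := 1) \<and>
       stack n 10 ({} \<union> nds ?c) t \<and> frame attach_arrays s' t"
        and T: "T'' - (300 * real (length (digs n ?c)) + 50) \<le> T"
      have fr': "frame attach_arrays s' t" using * by simp
      show "ok B (settle (100 * f ^ 2)) t T (steady (insert ?c E))"
      proof (rule settle_from_steady)
        show "represents (insert ?c E) lev t"
          using * rep'(1) code(2) new frameD[OF fr', of 2] unfolding represents_def Inc_insert[symmetric]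
          by (auto simp: el_def)
        show "header n M t" using s'(2) header_frame[OF fr'] by simp
        show "stack n 10 (nds ?c) t" using * by simp
        show "stack n 13 {} t" using rep' stack_frame[OF fr', of 13] by simp
        show "budgeted (insert ?c E) lev a'" unfolding a'_def by (rule ins(1))
        show "settling (insert ?c E) lev (nds ?c) {}"
          unfolding settling_def
        proof (intro allI impI conjI)
          fix v assume v: "v < n"
          have w: "weight E lev v < 1" "0 < lev v \<Longrightarrow> 1 / (4 * real G) \<le> weight E lev v"
            using stl v by (auto simp: settled_def)
          show "weight (insert ?c E) lev v < 2" using w ins(3)[of v] by simp
          show "v \<in> nds ?c" if "1 \<le> weight (insert ?c E) lev v"
            using that w weight_insert[OF E new, of lev v] by (auto split: if_splits)
          have "weight E lev v \<le> weight (insert ?c E) lev v" by (simp add: weight_insert[OF E new])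
          then show "v \<in> {}" if "0 < lev v" "weight (insert ?c E) lev v < 1 / (4 * real G)" using that w by simp
        qed
        have bound: "p + 100 * x + 10 \<le> T"
          if "x \<le> real f" "y \<le> real f" "p \<le> potential E lev a + 28800 * real f ^ 2" "T'' - (300 * y + 50) \<le> T" for p x y T :: real
        proof -
          have "p + 100 * x + 10 \<le> T" if "x \<le> r" "y \<le> r" "p \<le> potential E lev a + 28800 * q"
            "\<Phi> + 40000 * q - 100 * r \<le> T'" "1 \<le> r" "r \<le> q" for r q :: real
            using that \<open>T'' - (300 * y + 50) \<le> T\<close> T'' pot by linarith
          then show ?thesis using that T' f_squared by blast
        qed
        have "card (nds ?c) \<le> f" using nds[OF code(2)] by simp
        then have "real (card (nds ?c)) \<le> real f" by simp
        moreover have "real (length (digs n ?c)) \<le> real f" using c by simp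
        moreover have "potential (insert ?c E) lev a' \<le> potential E lev a + 28800 * real f ^ 2"
          using ins(2) unfolding a'_def by (simp add: power2_eq_square)
        ultimately show "potential (insert ?c E) lev a' + 100 * (real (card (nds ?c)) + real (card {})) + 10 \<le> T"
          using bound[OF _ _ _ T] unfolding card.empty of_nat_0 add_0_right add_0_left by blast
      qed
    qed
    moreover have "10 \<le> T'" using T' pot pot0 f_squared by linarith
    ultimately show "ok B (SEQ (IF (Read 0 (Const 1)) attach (for_nodes remove_pair)) (settle (100 * f ^ 2))) s' T' (steady (insert ?c E))"
      unfolding ok_SEQ by (subst ok_IF) (use s'(3) small in simp)
  qed
qed

text \<open>The potential grows by at most \<open>4000 * f\<close>. Only nodes of the deleted
  hyperedge can have become too light.\<close>

lemma delete_ok: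
  assumes st: "steady E s \<Phi>" and e: "hyperedge {..<n} f e" and old: "edge_index n e \<in> E"
  shows "ok B (update_program f) (present (Delete e) s) (\<Phi> + 40000 * real f ^ 2) (steady (E - {edge_index n e}))"
proof -
  let ?c = "edge_index n e"
  obtain lev a where s0: "s 0 0 = n" and rep: "represents E lev s" and stk: "stack n 10 {} s" "stack n 13 {} s"
    and bud: "budgeted E lev a" and stl: "settled E lev" and pot: "potential E lev a \<le> \<Phi>"
    using st unfolding steady_def by blast
  note code = edge_index_code[OF e]
  note c = edge_code[OF code(2)]
  have E: "E \<subseteq> Edges" using rep by (simp add: represents_def)
  have pot0: "0 \<le> potential E lev a" by (rule pot_nonneg) auto
  note del = pot_delete[OF E old bud, of 4000 28800, simplified]
  show ?thesis
    unfolding update_program_def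
  proof (rule prepare_ok[where s = s and k = 0, OF e s0])
    show "present (Delete e) s = write_input 0 e s" by simp
    show "100 * real f \<le> \<Phi> + 40000 * real f ^ 2" using pot pot0 f_squared by linarith
    fix s' T'
    assume s': "s' 17 0 = ?c" "header n M s'" "s' 0 1 = 0" and fr: "frame {0,1,16,17,26} s s'"
      and T': "\<Phi> + 40000 * real f ^ 2 - 100 * real f \<le> T'"
    have rep': "represents E lev s'" "stack n 10 {} s'" "stack n 13 {} s'"
      using rep stk represents_frame[OF fr] stack_frame[OF fr] by auto
    have dt: "ok B (for_nodes remove_pair) s' (230 * real (length (digs n ?c)) + 10) (\<lambda>s''. \<lambda>_. core n M (Inc n E - {?c} \<times> nds ?c) s'' \<and>
       stack n 13 ({} \<union> nds ?c) s'' \<and> frame detach_arrays s' s'')"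
      by (rule detach_ok) (use rep' s' c old in \<open>auto simp: represents_def Inc_def\<close>)
    have "ok B (SEQ (for_nodes remove_pair) (settle (100 * f ^ 2))) s' T'' (steady (E - {?c}))" if T'': "T' - 10 \<le> T''" for T''
      unfolding ok_SEQ
    proof (rule ok_call[OF dt])
      show "230 * real (length (digs n ?c)) + 10 \<le> T''"
        using c T' T'' pot pot0 f_squared of_nat_mono[of "length (digs n ?c)" f, where 'a = real] by linarith
      fix t T
      assume *: "core n M (Inc n E - {?c} \<times> nds ?c) t \<and>
       stack n 13 ({} \<union> nds ?c) t \<and> frame detach_arrays s' t"
        and T: "T'' - (230 * real (length (digs n ?c)) + 10) \<le> T"
      have fr': "frame detach_arrays s' t" using * by simp
      show "ok B (settle (100 * f ^ 2)) t T (steady (E - {?c}))"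
      proof (rule settle_from_steady)
        show "represents (E - {?c}) lev t"
          using * rep'(1) frameD[OF fr', of 2] frameD[OF fr', of 3] frameD[OF fr', of 4]
          unfolding represents_def Inc_remove[OF old, symmetric] by auto
        show "header n M t" using s'(2) header_frame[OF fr'] by simp
        show "stack n 13 (nds ?c) t" using * by simp
        show "stack n 10 {} t" using rep' stack_frame[OF fr', of 10] by simp
        show "budgeted (E - {?c}) lev a" by (rule del(1))
        show "settling (E - {?c}) lev {} (nds ?c)"
          unfolding settling_def
        proof (intro allI impI conjI)
          fix v assume v: "v < n"
          have w: "weight E lev v < 1" "0 < lev v \<Longrightarrow> 1 / (4 * real G) \<le> weight E lev v"
            using stl v by (auto simp: settled_def)
          show "weight (E - {?c}) lev v < 2" using w del(3)[of v] by simp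
          show "v \<in> {}" if "1 \<le> weight (E - {?c}) lev v" using that w del(3)[of v] by simp
          have E': "insert ?c (E - {?c}) = E" and Es: "E - {?c} \<subseteq> Edges" using old E by auto
          show "v \<in> nds ?c" if "0 < lev v" "weight (E - {?c}) lev v < 1 / (4 * real G)"
            using that w weight_insert[OF Es, of ?c lev v, unfolded E'] by (auto split: if_splits)
        qed
        have bound: "p + 100 * x + 10 \<le> T"
          if "x \<le> real f" "y \<le> real f" "p \<le> potential E lev a + 4000 * real f" "T'' - (230 * y + 10) \<le> T" for p x y T :: real
        proof -
          have "p + 100 * x + 10 \<le> T" if "x \<le> r" "y \<le> r" "p \<le> potential E lev a + 4000 * r"
            "\<Phi> + 40000 * q - 100 * r \<le> T'" "1 \<le> r" "r \<le> q" for r q :: real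
            using that \<open>T'' - (230 * y + 10) \<le> T\<close> T'' pot by linarith
          then show ?thesis using that T' f_squared by blast
        qed
        have "card (nds ?c) \<le> f" using nds[OF code(2)] by simp
        then have "real (card (nds ?c)) \<le> real f" by simp
        moreover have "real (length (digs n ?c)) \<le> real f" using c by simp
        ultimately show "potential (E - {?c}) lev a + 100 * (real (card {}) + real (card (nds ?c))) + 10 \<le> T"
          using bound[OF _ _ del(2) T] unfolding card.empty of_nat_0 add_0_right add_0_left by blast
      qed
    qed
    moreover have "10 \<le> T'" using T' pot pot0 f_squared by linarith
    ultimately show "ok B (SEQ (IF (Read 0 (Const 1)) attach (for_nodes remove_pair)) (settle (100 * f ^ 2))) s' T' (steady (E - {?c}))"
      unfolding ok_SEQ by (subst ok_IF) (use s'(3) small in simp)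
  qed
qed

lemma steady_initial: "steady {} (initial_mem n) 0"
proof -
  have "edge_lists n M {} (\<lambda>_. 0) (\<lambda>_. 0) (\<lambda>_. 0) (\<lambda>_. 0)" by (simp add: edge_lists_def)
  moreover have "stored_weights n M {} (\<lambda>_. 0) (\<lambda>_. 0) (\<lambda>_. 0)"
    using M_pos by (auto simp: stored_weights_def intro: exI[of _ 0])
  ultimately have "represents {} (\<lambda>_. 0) (initial_mem n)"
    using M_pos by (simp add: represents_def core_def initial_mem_def Inc_def)
  moreover have "budgeted {} (\<lambda>_. 0) (\<lambda>_. 0)" by (simp add: budgeted_def capped_weight_def)
  moreover have "settled {} (\<lambda>_. 0)" by (simp add: settled_def weight_def)
  moreover have "potential {} (\<lambda>_. 0) (\<lambda>_. 0) \<le> 0" by (simp add: pot_def up_credit_def down_credit_def)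
  moreover have "stack n 10 {} (initial_mem n)" "stack n 13 {} (initial_mem n)" by (auto simp: stack_def initial_mem_def)
  ultimately show ?thesis unfolding steady_def by (auto simp: initial_mem_def)
qed

end
end

section \<open>Approximation guarantees\<close>

text \<open>Weak duality: every hyperedge is counted at some cover node, and every cover node
  carries weight at most 1.\<close>

lemma matching_le_cover:
  assumes "finite V" "finite E" "fractional_matching V E w" "vertex_cover V E S"
  shows "matching_size E w \<le> real (card S)"
proof -
  have S: "S \<subseteq> V" "finite S" using assms finite_subset by (auto simp: vertex_cover_def)
  have "matching_size E w \<le> (\<Sum>e\<in>E. real (card (S \<inter> e)) * w e)"
    unfolding matching_size_def
  proof (rule sum_mono)
    fix e assume e: "e \<in> E"
    then have "S \<inter> e \<noteq> {}" "0 \<le> w e" using assms by (auto simp: vertex_cover_def fractional_matching_def)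
    then have "1 \<le> card (S \<inter> e)" "0 \<le> w e" using S by (auto simp: Suc_le_eq card_gt_0_iff)
    then show "w e \<le> real (card (S \<inter> e)) * w e" by (simp add: mult_le_cancel_right1)
  qed
  also have "\<dots> = (\<Sum>v\<in>S. \<Sum>e | e \<in> E \<and> v \<in> S \<inter> e. w e)"
    by (rule sum_incidence[symmetric]) (use S assms in auto)
  also have "\<dots> \<le> (\<Sum>v\<in>S. 1)"
  proof (rule sum_mono)
    fix v assume v: "v \<in> S"
    then have "{e. e \<in> E \<and> v \<in> S \<inter> e} = {e. e \<in> E \<and> v \<in> e}" by auto
    then show "(\<Sum>e | e \<in> E \<and> v \<in> S \<inter> e. w e) \<le> 1"
      using assms(3) S v by (auto simp: fractional_matching_def)
  qed
  finally show ?thesis by simp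
qed

lemma approximation_from_pair:
  assumes V: "finite V" and E: "finite E" and w: "fractional_matching V E w" and S: "vertex_cover V E S"
    and c: "0 < c" and size: "real (card S) \<le> c * matching_size E w"
  shows "approx_max_fractional_matching c V E w" "approx_min_vertex_cover c V E S"
proof -
  have "max_matching_size V E \<le> real (card S)"
    unfolding max_matching_size_def
    by (rule cSup_least) (use w matching_le_cover[OF V E _ S] in auto)
  also note size
  finally have "1 / c * max_matching_size V E \<le> matching_size E w"
    using c by (simp add: field_simps)
  then show "approx_max_fractional_matching c V E w" using w by (simp add: approx_max_fractional_matching_def)
  have "{card S' |S'. vertex_cover V E S'} \<subseteq> card ` Pow V" by (auto simp: vertex_cover_def)
  then have "finite {card S' |S'. vertex_cover V E S'}" using V finite_subset by blast
  then have "min_cover_size V E \<in> {card S' |S'. vertex_cover V E S'}"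
    unfolding min_cover_size_def using S by (intro Min_in) auto
  then obtain S' where S': "vertex_cover V E S'" "min_cover_size V E = card S'" by auto
  have "c * matching_size E w \<le> c * real (card S')"
    using matching_le_cover[OF V E w S'(1)] c by simp
  then show "approx_min_vertex_cover c V E S" using S S' size by (simp add: approx_min_vertex_cover_def)
qed

section \<open>From single updates to whole runs\<close>

lemma valid_updates_append:
  "valid_updates V f E (us @ [u]) \<longleftrightarrow> valid_updates V f E us \<and> valid_update V f (fold apply_update us E) u"
  by (induction us arbitrary: E) auto

lemma hyperedges_after:
  "valid_updates V f {} us \<Longrightarrow> e \<in> edges_after us \<Longrightarrow> hyperedge V f e"
proof (induction us arbitrary: e rule: rev_induct)
  case (snoc u us)
  then show ?case by (cases u) (auto simp: edges_after_def valid_updates_append)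
qed (simp add: edges_after_def)

context algorithm
begin

lemma steady_approximation:
  assumes Gf: "G = 100 * f ^ 2" and Mf: "M = Suc n ^ f"
    and Es: "\<And>e. e \<in> Es \<Longrightarrow> hyperedge {..<n} f e"
    and st: "steady (edge_index n ` Es) s \<Phi>" and c: "real (400 * f ^ 3) \<le> c"
  shows "approx_max_fractional_matching c {..<n} Es (output_weight n s)"
    and "approx_min_vertex_cover c {..<n} Es (output_cover n s)"
proof -
  let ?E = "edge_index n ` Es"
  obtain lev a where rep: "represents ?E lev s" and stl: "settled ?E lev"
    using st unfolding steady_def by blast
  have E: "?E \<subseteq> Edges" using rep by (simp add: represents_def)
  note code = edge_index_code[OF Gf Mf Es]
  have inj: "inj_on (edge_index n) Es" by (rule inj_on_inverseI[of _ "\<lambda>c. nds c"]) (rule code(3))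
  have finEs: "finite Es"
    by (rule finite_subset[of _ "Pow {..<n}"]) (use Es in \<open>auto simp: hyperedge_def\<close>)
  have w: "output_weight n s e = (1/4) ^ el lev (edge_index n e)" if "e \<in> Es" for e
    using rep that unfolding represents_def output_weight_def by (auto simp: power_one_over)
  have at_node: "(\<Sum>e | e \<in> Es \<and> v \<in> e. output_weight n s e) = weight ?E lev v" for v
  proof -
    have "{e'. e' \<in> ?E \<and> v \<in> nds e'} = edge_index n ` {e. e \<in> Es \<and> v \<in> e}" using code(3) by auto
    then have "weight ?E lev v = (\<Sum>e | e \<in> Es \<and> v \<in> e. (1/4) ^ el lev (edge_index n e))"
      unfolding weight_def using inj by (simp add: sum.reindex inj_on_subset)
    then show ?thesis using w by simp
  qed
  have matching: "fractional_matching {..<n} Es (output_weight n s)"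
    unfolding fractional_matching_def at_node using stl by (auto simp: settled_def output_weight_def intro: less_imp_le)
  have cover_lev: "v \<in> output_cover n s \<longleftrightarrow> v < n \<and> 0 < lev v" for v
  proof -
    have "s 2 v \<noteq> 0 \<longleftrightarrow> 0 < lev v" if "v < n"
      using represents_level[OF rep that] by (cases "s 2 v"; cases "lev v") auto
    then show ?thesis by (auto simp: output_cover_def)
  qed
  have cover: "vertex_cover {..<n} Es (output_cover n s)"
    unfolding vertex_cover_def
  proof (intro conjI ballI)
    show "output_cover n s \<subseteq> {..<n}" by (auto simp: output_cover_def)
    fix e assume e: "e \<in> Es"
    note ce = code(2)[OF e] code(3)[OF e]
    obtain v where v: "v \<in> e" "lev v = el lev (edge_index n e)" using el_witness[OF ce(1)] ce(2) by auto
    have vn: "v < n" using Es[OF e] v by (auto simp: hyperedge_def)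
    have "output_weight n s e \<le> weight ?E lev v"
      unfolding at_node[symmetric]
      by (rule member_le_sum) (use e v finEs in \<open>auto simp: output_weight_def\<close>)
    also have "\<dots> < 1" using stl vn by (simp add: settled_def)
    finally have "0 < lev v" using w[OF e] v(2) by (cases "lev v") auto
    then have "v \<in> output_cover n s" using vn cover_lev[of v] by blast
    then show "output_cover n s \<inter> e \<noteq> {}" using v(1) by blast
  qed
  have f1: "1 \<le> real f" using f_pos by simp
  have "real (card (output_cover n s)) * (1 / (4 * real G)) = (\<Sum>v\<in>output_cover n s. 1 / (4 * real G))" by simp
  also have "\<dots> \<le> (\<Sum>v\<in>output_cover n s. weight ?E lev v)"
    by (rule sum_mono) (use stl cover_lev in \<open>auto simp: settled_def\<close>)
  also have "\<dots> \<le> (\<Sum>v<n. weight ?E lev v)"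
    by (rule sum_mono2) (auto simp: weight_nonneg output_cover_def)
  also have "\<dots> = (\<Sum>e\<in>Es. real (card e) * output_weight n s e)"
    unfolding at_node[symmetric] using Es
    by (intro sum_incidence finEs) (auto simp: hyperedge_def)
  also have "\<dots> \<le> (\<Sum>e\<in>Es. real f * output_weight n s e)"
    by (intro sum_mono mult_right_mono) (use Es in \<open>auto simp: hyperedge_def output_weight_def\<close>)
  also have "\<dots> = real f * matching_size Es (output_weight n s)"
    by (simp add: matching_size_def sum_distrib_left)
  finally have "real (card (output_cover n s)) \<le> real (400 * f ^ 3) * matching_size Es (output_weight n s)"
    using f_pos by (simp add: Gf field_simps power2_eq_square power3_eq_cube)
  also have "\<dots> \<le> c * matching_size Es (output_weight n s)"
    using c by (intro mult_right_mono) (auto simp: matching_size_def output_weight_def intro!: sum_nonneg)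
  finally have size: "real (card (output_cover n s)) \<le> c * matching_size Es (output_weight n s)" .
  have "1 \<le> real f ^ 3" using f1 by (rule one_le_power)
  then have "0 < c" using c by simp
  then show "approx_max_fractional_matching c {..<n} Es (output_weight n s)"
    "approx_min_vertex_cover c {..<n} Es (output_cover n s)"
    using approximation_from_pair[OF _ finEs matching cover _ size] by auto
qed

text \<open>The potential method: the credit \<open>\<Phi>\<close> left by one update is handed to
  the next, so the sum of spent time and \<open>\<Phi>\<close> grows by at most
  \<open>40000 * f\<^sup>2\<close> per update.\<close>

lemma run_ok:
  assumes Gf: "G = 100 * f ^ 2" and Mf: "M = Suc n ^ f" and us: "valid_updates {..<n} f {} us"
  shows "\<exists>s t \<Phi>. run B (update_program f) n us s t \<and> steady (edge_index n ` edges_after us) s \<Phi> \<and>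
    real t + \<Phi> \<le> 40000 * real f ^ 2 * real (length us)"
  using us
proof (induction us rule: rev_induct)
  case Nil
  then show ?case using steady_initial[OF Gf Mf] by (auto simp: edges_after_def intro!: exI run.start)
next
  case (snoc u us)
  then obtain s t \<Phi> where run: "run B (update_program f) n us s t" and st: "steady (edge_index n ` edges_after us) s \<Phi>"
    and T: "real t + \<Phi> \<le> 40000 * real f ^ 2 * real (length us)" by (auto simp: valid_updates_append)
  have valid: "valid_updates {..<n} f {} us" "valid_update {..<n} f (edges_after us) u"
    using snoc.prems by (auto simp: valid_updates_append edges_after_def)
  note code = edge_index_code(3)[OF Gf Mf]
  have hyper: "\<And>e. e \<in> edges_after us \<Longrightarrow> hyperedge {..<n} f e" using hyperedges_after[OF valid(1)] .
  have idx: "edge_index n e \<in> edge_index n ` edges_after us \<longleftrightarrow> e \<in> edges_after us" if "hyperedge {..<n} f e" for e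
  proof
    assume "edge_index n e \<in> edge_index n ` edges_after us"
    then obtain e' where "e' \<in> edges_after us" "edge_index n e = edge_index n e'" by auto
    then show "e \<in> edges_after us" using code[OF that] code[OF hyper] by metis
  qed (rule imageI)
  have "ok B (update_program f) (present u s) (\<Phi> + 40000 * real f ^ 2) (steady (edge_index n ` edges_after (us @ [u])))"
  proof (cases u)
    case (Insert e)
    then have "hyperedge {..<n} f e" "e \<notin> edges_after us" using valid by auto
    then show ?thesis using insert_ok[OF Gf Mf st, of e] idx Insert by (simp add: edges_after_def)
  next
    case (Delete e)
    then have e: "e \<in> edges_after us" "hyperedge {..<n} f e" using valid hyper by auto
    have "edge_index n ` (edges_after us - {e}) = edge_index n ` edges_after us - {edge_index n e}"
    proof -
      have "edge_index n e' \<noteq> edge_index n e" if "e' \<in> edges_after us" "e' \<noteq> e" for e'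
        using that code[OF hyper[OF that(1)]] code[OF e(2)] by metis
      then show ?thesis by auto
    qed
    then show ?thesis using delete_ok[OF Gf Mf st e(2)] e Delete by (simp add: edges_after_def)
  qed
  then obtain t' s' where ex: "exec B (update_program f) (present u s) t' s'" "real t' \<le> \<Phi> + 40000 * real f ^ 2"
    "steady (edge_index n ` edges_after (us @ [u])) s' (\<Phi> + 40000 * real f ^ 2 - real t')" unfolding ok_def by blast
  have "real (t + t') + (\<Phi> + 40000 * real f ^ 2 - real t') \<le> 40000 * real f ^ 2 * real (length (us @ [u]))"
    using T by (simp add: algebra_simps)
  then show ?case using run.step[OF run ex(1)] ex(3) by blast
qed

end

text \<open>The exponent is split: \<open>6400 * f\<^sup>2 < 2 ^ 18 * 4 ^ f\<close> is absorbed by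
  \<open>(n + 2) ^ (20 * f)\<close>, and the cube of \<open>Suc n ^ f\<close> by
  \<open>(n + 2) ^ (3 * f)\<close>. So \<open>23 * f\<close> would already suffice as
  exponent.\<close>

lemma word_bound_large:
  assumes "0 < n" "0 < f" "40000 \<le> C"
  shows "64 * (100 * f ^ 2) * (Suc n ^ f) ^ 3 < word_bound C f n"
proof -
  have "f < 2 ^ f" by (rule less_exp)
  then have "f ^ 2 < (2 ^ f) ^ 2" by (intro power_strict_mono) auto
  then have "6400 * f ^ 2 < 2 ^ 18 * (2 ^ f) ^ 2" by simp
  also have "\<dots> = 2 ^ (18 + 2 * f)" by (simp only: power_add power_mult[symmetric] mult.commute[of f 2])
  also have "\<dots> \<le> 2 ^ (20 * f)" using assms by (intro power_increasing) auto
  also have "\<dots> \<le> (n + 2) ^ (20 * f)" by (rule power_mono) auto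
  finally have 1: "6400 * f ^ 2 < (n + 2) ^ (20 * f)" .
  have "(Suc n ^ f) ^ 3 = Suc n ^ (3 * f)" by (simp add: mult.commute flip: power_mult)
  also have "\<dots> \<le> (n + 2) ^ (3 * f)" by (rule power_mono) auto
  finally have 2: "(Suc n ^ f) ^ 3 \<le> (n + 2) ^ (3 * f)" .
  have "64 * (100 * f ^ 2) * (Suc n ^ f) ^ 3 \<le> 6400 * f ^ 2 * (n + 2) ^ (3 * f)"
    using mult_le_mono2[OF 2, of "6400 * f ^ 2"] by simp
  also have "\<dots> < (n + 2) ^ (20 * f) * (n + 2) ^ (3 * f)" using 1 by (intro mult_strict_right_mono) auto
  also have "\<dots> = (n + 2) ^ (20 * f + 3 * f)" by (simp only: power_add)
  also have "\<dots> \<le> (n + 2) ^ (C * f)"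
  proof (rule power_increasing)
    have "23 * f \<le> C * f" using assms by (intro mult_right_mono) auto
    then show "20 * f + 3 * f \<le> C * f" by simp
  qed simp
  finally show ?thesis by (simp add: word_bound_def)
qed

theorem theorem1:
  shows "\<exists>C::nat. C > 0 \<and> (\<forall>f::nat. f \<ge> 1 \<longrightarrow> (\<exists>P::com. \<forall>(n::nat) (us::nat update list).
    valid_updates {..<n} f {} us \<longrightarrow>
    (\<exists>s t. run (word_bound C f n) P n us s t
       \<and> t \<le> C * f ^ 2 * length us
       \<and> approx_max_fractional_matching (real (C * f ^ 3)) {..<n} (edges_after us) (output_weight n s)
       \<and> approx_min_vertex_cover (real (C * f ^ 3)) {..<n} (edges_after us) (output_cover n s))))"
proof (intro exI[of _ "40000::nat"] conjI allI impI)
  fix f :: nat assume f: "1 \<le> f"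
  \<comment> \<open>This is the credit granted per update; it also exceeds the \<open>400\<close> of
    the approximation ratio and the \<open>23\<close> needed for the word length.\<close>
  let ?C = "40000 :: nat"
  show "\<exists>P. \<forall>n us. valid_updates {..<n} f {} us \<longrightarrow>
    (\<exists>s t. run (word_bound ?C f n) P n us s t
       \<and> t \<le> ?C * f ^ 2 * length us
       \<and> approx_max_fractional_matching (real (?C * f ^ 3)) {..<n} (edges_after us) (output_weight n s)
       \<and> approx_min_vertex_cover (real (?C * f ^ 3)) {..<n} (edges_after us) (output_cover n s))"
  proof (intro exI[of _ "update_program f"] allI impI)
    fix n :: nat and us :: "nat update list"
    assume us: "valid_updates {..<n} f {} us"
    show "\<exists>s t. run (word_bound ?C f n) (update_program f) n us s t
       \<and> t \<le> ?C * f ^ 2 * length us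
       \<and> approx_max_fractional_matching (real (?C * f ^ 3)) {..<n} (edges_after us) (output_weight n s)
       \<and> approx_min_vertex_cover (real (?C * f ^ 3)) {..<n} (edges_after us) (output_cover n s)"
    proof (cases "n = 0")
      \<comment> \<open>Without nodes there is no hyperedge, so no update is possible. The case is
        separate because the locale \<open>machine\<close> requires \<open>0 < n\<close>.\<close>
      case True
      have us0: "us = []"
      proof (cases us)
        case (Cons u us')
        then show ?thesis using us True by (cases u) (auto simp: hyperedge_def)
      qed
      have "fractional_matching {..<n} {} (output_weight n (initial_mem n))"
        "vertex_cover {..<n} ({} :: nat set set) (output_cover n (initial_mem n))"
        "card (output_cover n (initial_mem n)) = 0"
        by (auto simp: fractional_matching_def vertex_cover_def output_cover_def True)
      then have "approx_max_fractional_matching (real (?C * f ^ 3)) {..<n} {} (output_weight n (initial_mem n))"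
        "approx_min_vertex_cover (real (?C * f ^ 3)) {..<n} {} (output_cover n (initial_mem n))"
        using f by (auto intro!: approximation_from_pair simp: matching_size_def)
      then show ?thesis
        by (intro exI[of _ "initial_mem n"] exI[of _ 0]) (simp add: us0 run.start edges_after_def)
    next
      case False
      interpret algorithm n "Suc n ^ f" "100 * f ^ 2" "word_bound ?C f n" f
      proof
        show "n < Suc n ^ f" using f self_le_power[of "Suc n" f] by simp
        show "64 * (100 * f ^ 2) * (Suc n ^ f) ^ 3 < word_bound ?C f n"
          using False f by (intro word_bound_large) auto
      qed (use False f in auto)
      obtain s t \<Phi> where run: "run (word_bound ?C f n) (update_program f) n us s t"
        and st: "steady (edge_index n ` edges_after us) s \<Phi>"
        and T: "real t + \<Phi> \<le> 40000 * real f ^ 2 * real (length us)"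
        using run_ok[OF refl refl us] by blast
      obtain lev a where "potential (edge_index n ` edges_after us) lev a \<le> \<Phi>" using st by (auto simp: steady_def)
      moreover have "0 \<le> potential (edge_index n ` edges_after us) lev a" by (rule pot_nonneg) auto
      ultimately have "real t \<le> 40000 * real f ^ 2 * real (length us)" using T by linarith
      also have "\<dots> = real (?C * f ^ 2 * length us)" by simp
      finally have "t \<le> ?C * f ^ 2 * length us" by (simp only: of_nat_le_iff)
      moreover have "real (400 * f ^ 3) \<le> real (?C * f ^ 3)" by simp
      ultimately show ?thesis
        using run steady_approximation[OF refl refl hyperedges_after[OF us] st] by blast
    qed
  qed
qed simp

end
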